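(* Let $n\geq1$ be an integer, $s\geq0$ and $\tau>0$ real, and let $\psi$ be the solution of the critical Moore-Gibson-Thompson equation $\tau\psi_{ttt}+\psi_{tt}-\Delta\psi-\tau\Delta\psi_t=0$ in $(0,\infty)\times\mathbb{R}^n$, $(\psi,\psi_t,\psi_{tt})(0,\cdot)=(\psi_0,\psi_1,\psi_2)$. Put $g:=\psi_1+\tau\psi_2$. For $n>2s$ let $D(t):=t^{1+s-\frac n2}$ if $n<2+2s$, $D(t):=\sqrt{\ln t}$ if $n=2+2s$, and $D(t):=1$ if $n>2+2s$. (i) If $n>2s$, there are $C,T>0$ depending only on $n,s,\tau$ such that whenever $\psi_0\in L^2$ and $\nabla^s\psi_1,\nabla^s\psi_2\in L^2\cap L^1$, $$\|\psi(t,\cdot)\|_{L^2}\leq C\,D(t)\big(\|\psi_0\|_{L^2}+\|\nabla^s\psi_1\|_{L^2\cap L^1}+\|\nabla^s\psi_2\|_{L^2\cap L^1}\big)\quad\text{for } t\geq T.$$ (ii) If $n>2s$, $\psi_0,\psi_2\in L^2\cap L^1$, $\nabla^s\psi_1,\nabla^s\psi_2\in L^2\cap L^1$, $\nabla^s g\in L^{1,1}$ and $P_{\nabla^s g}\neq0$, then there are $c,T>0$ independent of $t$ (possibly depending on the data) such that $\|\psi(t,\cdot)\|_{L^2}\geq c\,D(t)\,|P_{\nabla^s g}|$ for $t\geq T$. (iii) If $n\leq2s$, $\psi_0,\psi_2\in L^2$, $\nabla^s g\in L^{1,1}$ and $P_{\nabla^s g}\neq0$, then $\|\psi(t,\cdot)\|_{L^2}=+\infty$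 for all $t\in(0,t_0]$, for every $t_0>0$.
   Context: All function spaces are over $\mathbb{R}^n$; $\hat f$ is the Fourier transform. $L^{1,1}:=\{f\in L^1:\|(1+|x|)f\|_{L^1}<\infty\}$; $\|f\|_{X\cap Y}=\|f\|_X+\|f\|_Y$; $P_f:=\int_{\mathbb{R}^n}f\,dx$. For real $s\geq0$, $\nabla^s$ is the Fourier multiplier with symbol $|\xi|^s$: "$\nabla^s f\in X$" means that $\hat f$ is a measurable function such that $|\xi|^s\hat f(\xi)$ is the Fourier transform of a function in $X$, denoted $\nabla^s f$. The solution is understood in Fourier space: for a.e. $\xi$, $\hat\psi(\cdot,\xi)$ solves the ODE $\tau y'''+y''+\tau|\xi|^2y'+|\xi|^2y=0$ with $(y,y',y'')(0)=(\hat\psi_0,\hat\psi_1,\hat\psi_2)(\xi)$, and $\|\psi(t,\cdot)\|_{L^2}\in[0,+\infty]$ is computed from $\hat\psi(t,\cdot)$ by Plancherel. *)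

theory Defs
  imports "HOL-Analysis.Analysis"
begin

text \<open>All norms take values in \<open>[0,\<infinity>]\<close>; functions are complex-valued, which covers real data.\<close>

definition ennreal_sqrt :: "ennreal \<Rightarrow> ennreal" where
  "ennreal_sqrt x = (if x = \<infinity> then \<infinity> else ennreal (sqrt (enn2real x)))"

definition L1_norm :: "('a::euclidean_space \<Rightarrow> complex) \<Rightarrow> ennreal" where
  "L1_norm f = (\<integral>\<^sup>+ x. ennreal (norm (f x)) \<partial>lebesgue)"

definition L2_norm :: "('a::euclidean_space \<Rightarrow> complex) \<Rightarrow> ennreal" where
  "L2_norm f = ennreal_sqrt (\<integral>\<^sup>+ x. ennreal ((norm (f x))\<^sup>2) \<partial>lebesgue)"

definition L2_L1_norm :: "('a::euclidean_space \<Rightarrow> complex) \<Rightarrow> ennreal" where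
  "L2_L1_norm f = L2_norm f + L1_norm f"

definition L1 :: "('a::euclidean_space \<Rightarrow> complex) set" where
  "L1 = {f \<in> borel_measurable lebesgue. L1_norm f < \<infinity>}"

definition L2 :: "('a::euclidean_space \<Rightarrow> complex) set" where
  "L2 = {f \<in> borel_measurable lebesgue. L2_norm f < \<infinity>}"

definition L11 :: "('a::euclidean_space \<Rightarrow> complex) set" where
  "L11 = {f \<in> L1. L1_norm (\<lambda>x. complex_of_real (1 + norm x) * f x) < \<infinity>}"

definition mass :: "('a::euclidean_space \<Rightarrow> complex) \<Rightarrow> complex" where
  "mass f = (LINT x|lebesgue. f x)"

definition fourier :: "('a::euclidean_space \<Rightarrow> complex) \<Rightarrow> 'a \<Rightarrow> complex" where
  "fourier f \<xi> = (LINT x|lebesgue. exp (- \<i> * complex_of_real (x \<bullet> \<xi>)) * f x)"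

text \<open>
  \<open>has_fourier f u\<close>: the function \<open>f\<close> in \<open>L1\<close> or \<open>L2\<close> has Fourier transform \<open>u\<close>
  (determined up to a null set).  On \<open>L2\<close> the transform is the \<open>L2\<close>-limit of the transforms of
  the truncations of \<open>f\<close> to balls; on the intersection of \<open>L1\<close> and \<open>L2\<close> both clauses agree.
\<close>

definition has_fourier :: "('a::euclidean_space \<Rightarrow> complex) \<Rightarrow> ('a \<Rightarrow> complex) \<Rightarrow> bool" where
  "has_fourier f u \<longleftrightarrow> u \<in> borel_measurable lebesgue \<and>
     ((f \<in> L1 \<and> (AE \<xi> in lebesgue. u \<xi> = fourier f \<xi>)) \<or>
      (f \<in> L2 \<and>
       ((\<lambda>R. L2_norm (\<lambda>\<xi>. u \<xi> - fourier (\<lambda>x. indicator (ball 0 R) x * f x) \<xi>)) \<longlongrightarrow> 0) at_top))"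

text \<open>
  An object that need not be a function on physical space (such as \<open>\<psi>\<^sub>1\<close> when only its
  derivative of order \<open>s\<close> is integrable) is represented by its Fourier transform \<open>u\<close>.
  \<open>has_nabla s u h\<close>: the \<open>s\<close>-th derivative of the object with transform \<open>u\<close> is the function \<open>h\<close>.
  For \<open>s = 0\<close> the value \<open>0 powr 0 = 0\<close> affects only the null set \<open>{0}\<close>.
\<close>

definition has_nabla :: "real \<Rightarrow> ('a::euclidean_space \<Rightarrow> complex) \<Rightarrow> ('a \<Rightarrow> complex) \<Rightarrow> bool" where
  "has_nabla s u h \<longleftrightarrow> u \<in> borel_measurable lebesgue \<and>
     has_fourier h (\<lambda>\<xi>. complex_of_real (norm \<xi> powr s) * u \<xi>)"

text \<open>The \<open>L2\<close> norm of the object with Fourier transform \<open>u\<close>, by Plancherel's formula in the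
  normalization of \<^const>\<open>fourier\<close>.\<close>

definition plancherel_norm :: "('a::euclidean_space \<Rightarrow> complex) \<Rightarrow> ennreal" where
  "plancherel_norm u = ennreal ((2 * pi) powr (- real DIM('a) / 2)) * L2_norm u"

definition mgt_ode ::
    "real \<Rightarrow> real \<Rightarrow> complex \<Rightarrow> complex \<Rightarrow> complex \<Rightarrow> (real \<Rightarrow> complex) \<Rightarrow> bool" where
  "mgt_ode \<tau> \<rho> a b c y \<longleftrightarrow>
     (\<exists>y' y'' y'''.
        (\<forall>t\<ge>0. (y has_vector_derivative y' t) (at t within {0..}) \<and>
               (y' has_vector_derivative y'' t) (at t within {0..}) \<and>
               (y'' has_vector_derivative y''' t) (at t within {0..}) \<and>
               \<tau> *\<^sub>R y''' t + y'' t + (\<tau> * \<rho>\<^sup>2) *\<^sub>R y' t + \<rho>\<^sup>2 *\<^sub>R y t = 0) \<and>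
        y 0 = a \<and> y' 0 = b \<and> y'' 0 = c)"

text \<open>\<open>u0\<close>, \<open>u1\<close>, \<open>u2\<close> and \<open>v t\<close> are the Fourier transforms of the data
  and of the solution at time \<open>t\<close>.\<close>

definition mgt_solution ::
    "real \<Rightarrow> ('a::euclidean_space \<Rightarrow> complex) \<Rightarrow> ('a \<Rightarrow> complex) \<Rightarrow> ('a \<Rightarrow> complex)
      \<Rightarrow> (real \<Rightarrow> 'a \<Rightarrow> complex) \<Rightarrow> bool" where
  "mgt_solution \<tau> u0 u1 u2 v \<longleftrightarrow>
     (AE \<xi> in lebesgue. mgt_ode \<tau> (norm \<xi>) (u0 \<xi>) (u1 \<xi>) (u2 \<xi>) (\<lambda>t. v t \<xi>))"

definition mgt_rate :: "nat \<Rightarrow> real \<Rightarrow> real \<Rightarrow> real" where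
  "mgt_rate n s t =
     (if real n < 2 + 2 * s then t powr (1 + s - real n / 2)
      else if real n = 2 + 2 * s then sqrt (ln t)
      else 1)"

text \<open>Solutions exist for arbitrary data: the characteristic polynomial factors as
  \<open>(\<tau> z + 1) (z\<^sup>2 + \<rho>\<^sup>2)\<close>.\<close>

lemma mgt_ode_exists:
  assumes "\<tau> > 0" "\<rho> > 0"
  shows "\<exists>y. mgt_ode \<tau> \<rho> a b c y"
proof -
  define k where "k = \<tau>\<^sup>2 / (1 + \<tau>\<^sup>2 * \<rho>\<^sup>2)"
  define A where "A = k *\<^sub>R (c + \<rho>\<^sup>2 *\<^sub>R a)"
  define B where "B = a - A"
  define C where "C = (1 / \<rho>) *\<^sub>R (b + (1 / \<tau>) *\<^sub>R A)"
  define y where "y p q r t =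
      (p * exp (- t / \<tau>)) *\<^sub>R A + (q * cos (\<rho> * t) - r * sin (\<rho> * t)) *\<^sub>R B
       + (q * sin (\<rho> * t) + r * cos (\<rho> * t)) *\<^sub>R C" for p q r t
  have d: "(y p q r has_vector_derivative y (- p / \<tau>) (- \<rho> * r) (\<rho> * q) t) (at t within S)"
    for p q r t S
    unfolding y_def using assms
    by (auto intro!: derivative_eq_intros simp: algebra_simps)
  have pos: "1 + \<tau>\<^sup>2 * \<rho>\<^sup>2 \<noteq> 0"
    by (metis add_pos_nonneg less_numeral_extra(1) mult_nonneg_nonneg zero_le_power2 less_irrefl)
  have k: "k * (1 / \<tau>\<^sup>2 + \<rho>\<^sup>2) = 1"
  proof -
    have "1 / \<tau>\<^sup>2 + \<rho>\<^sup>2 = (1 + \<tau>\<^sup>2 * \<rho>\<^sup>2) / \<tau>\<^sup>2"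
      using assms by (simp add: field_simps)
    then show ?thesis
      unfolding k_def using assms pos by simp
  qed
  have "(1 / \<tau>\<^sup>2 + \<rho>\<^sup>2) *\<^sub>R A = c + \<rho>\<^sup>2 *\<^sub>R a"
    using k by (simp add: A_def mult.commute del: scaleR_add_right)
  then have c: "(1 / \<tau>\<^sup>2) *\<^sub>R A - \<rho>\<^sup>2 *\<^sub>R B = c"
    by (simp add: B_def algebra_simps)
  show ?thesis
    unfolding mgt_ode_def
  proof (intro exI conjI allI impI)
    fix t :: real assume "t \<ge> 0"
    show "(y 1 1 0 has_vector_derivative y (- 1 / \<tau>) (- \<rho> * 0) (\<rho> * 1) t) (at t within {0..})"
      by (rule d)
    show "(y (- 1 / \<tau>) (- \<rho> * 0) (\<rho> * 1) has_vector_derivative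
        y (- (- 1 / \<tau>) / \<tau>) (- \<rho> * (\<rho> * 1)) (\<rho> * (- \<rho> * 0)) t) (at t within {0..})"
      by (rule d)
    show "(y (- (- 1 / \<tau>) / \<tau>) (- \<rho> * (\<rho> * 1)) (\<rho> * (- \<rho> * 0)) has_vector_derivative
        y (- (- (- 1 / \<tau>) / \<tau>) / \<tau>) (- \<rho> * (\<rho> * (- \<rho> * 0))) (\<rho> * (- \<rho> * (\<rho> * 1))) t)
        (at t within {0..})"
      by (rule d)
    have lin: "\<alpha> *\<^sub>R y p q r t = y (\<alpha> * p) (\<alpha> * q) (\<alpha> * r) t"
         "y p q r t + y p' q' r' t = y (p + p') (q + q') (r + r') t" "y 0 0 0 t = 0"
      for \<alpha> p q r p' q' r'
      by (simp_all add: y_def algebra_simps)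
    show "\<tau> *\<^sub>R y (- (- (- 1 / \<tau>) / \<tau>) / \<tau>) (- \<rho> * (\<rho> * (- \<rho> * 0))) (\<rho> * (- \<rho> * (\<rho> * 1))) t
       + y (- (- 1 / \<tau>) / \<tau>) (- \<rho> * (\<rho> * 1)) (\<rho> * (- \<rho> * 0)) t
       + (\<tau> * \<rho>\<^sup>2) *\<^sub>R y (- 1 / \<tau>) (- \<rho> * 0) (\<rho> * 1) t + \<rho>\<^sup>2 *\<^sub>R y 1 1 0 t = 0"
      unfolding lin(1,2) using assms by (simp add: lin(3) field_simps power2_eq_square)
  next
    show "y 1 1 0 0 = a" by (simp add: y_def B_def)
    show "y (- 1 / \<tau>) (- \<rho> * 0) (\<rho> * 1) 0 = b"
      using assms by (simp add: y_def C_def)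
    show "y (- (- 1 / \<tau>) / \<tau>) (- \<rho> * (\<rho> * 1)) (\<rho> * (- \<rho> * 0)) 0 = c"
      using c by (simp add: y_def power2_eq_square)
  qed
qed

lemma mgt_solution_exists:
  fixes u0 u1 u2 :: "'a::euclidean_space \<Rightarrow> complex"
  assumes "\<tau> > 0"
  shows "\<exists>v. mgt_solution \<tau> u0 u1 u2 v"
proof -
  have "\<forall>\<xi>. \<exists>y. \<xi> \<noteq> 0 \<longrightarrow> mgt_ode \<tau> (norm \<xi>) (u0 \<xi>) (u1 \<xi>) (u2 \<xi>) y"
    using mgt_ode_exists[OF assms] by (metis zero_less_norm_iff)
  then obtain Y where Y: "\<And>\<xi>. \<xi> \<noteq> 0 \<longrightarrow> mgt_ode \<tau> (norm \<xi>) (u0 \<xi>) (u1 \<xi>) (u2 \<xi>) (Y \<xi>)"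
    by metis
  have "AE \<xi>::'a in lebesgue. \<xi> \<noteq> 0"
    by (rule AE_completion) (rule AE_lborel_singleton)
  then have "AE \<xi> in lebesgue. mgt_ode \<tau> (norm \<xi>) (u0 \<xi>) (u1 \<xi>) (u2 \<xi>) (Y \<xi>)"
    by eventually_elim (use Y in blast)
  then show ?thesis
    unfolding mgt_solution_def by (intro exI[of _ "\<lambda>t \<xi>. Y \<xi> t"]) simp
qed

end

theory Submission
  imports Defs "HOL-Probability.Characteristic_Functions"
begin

text \<open>
  In Fourier space the equation factors as \<open>(\<tau> \<partial>\<^sub>t + 1) (\<partial>\<^sub>t\<^sup>2 + \<rho>\<^sup>2) y = 0\<close> with \<open>\<rho> = norm \<xi>\<close>, which gives
  \<open>y = sin (\<rho> t) / \<rho> \<cdot> (b + \<tau> c)\<close> up to an error of size \<open>4 |a| + 3 \<tau>\<^sup>2 |c|\<close> uniformly in \<open>t\<close>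
  and \<open>\<rho>\<close>.  Everything is thus decided by the size of \<open>sin (\<rho> t) / \<rho>\<^bsup>1 + s\<^esup>\<close> near the origin:
  in polar coordinates its square integral over \<open>\<rho> < 1\<close> is that of \<open>\<rho>\<^bsup>p\<^esup> sin\<^sup>2 (\<rho> t)\<close> with
  \<open>p = n - 3 - 2 s\<close>, which grows like the square of the rate if \<open>p > -3\<close> and diverges otherwise.
  The transform of the \<open>L\<^sup>1\<close> function with nonzero mass is bounded away from zero near the origin.
  Of Plancherel's theorem only the upper bound, up to a constant, is needed.
\<close>

subsection \<open>Polar coordinates and Gaussians\<close>

text \<open>At low frequency the singular weight calls for pointwise control of the transforms,
  which \<open>L1\<close> data provide; at high frequency Plancherel's inequality takes over. This
  is why the upper bound carries both norms, with the cut at frequency one. In the exponent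
  \<open>p\<close>, polar coordinates contribute \<open>n - 1\<close>, division by the symbol of the
  derivative contributes \<open>- 2 s\<close>, and the factor \<open>1/\<rho>\<close> contributes
  \<open>- 2\<close>. When the rate is \<open>1\<close>, the error over all frequencies is as large
  as the main term. The lower bound is therefore a pointwise comparison near the origin, where
  \<open>1 / \<rho>^(1 + s)\<close> beats any constant, and only at frequencies with
  \<open>|sin (\<rho> t)| >= 1/2\<close>. A translation of the frequency shows that these carry a
  share of the power integral that depends on \<open>p\<close> alone. In the divergent case the
  initial data are merely square integrable, so the error has no pointwise bound; it is subtracted
  after squaring, as a term of finite integral.\<close>

lemma complex_lebesgue_measurable_AE_borel:
  fixes f :: "'a::euclidean_space \<Rightarrow> complex"
  assumes "f \<in> borel_measurable lebesgue"
  shows "\<exists>g \<in> borel_measurable borel. AE x in lebesgue. f x = g x"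
proof -
  have "(\<lambda>x. Re (f x)) \<in> borel_measurable lebesgue" "(\<lambda>x. Im (f x)) \<in> borel_measurable lebesgue"
    using assms by (auto intro: borel_measurable_complex_iff[THEN iffD1, THEN conjunct1]
        borel_measurable_complex_iff[THEN iffD1, THEN conjunct2])
  then obtain p q where p: "p \<in> borel_measurable lborel" "AE x in lborel. Re (f x) = p x"
    and q: "q \<in> borel_measurable lborel" "AE x in lborel. Im (f x) = q x"
    by (metis completion_ex_borel_measurable_real)
  have m: "(\<lambda>x. Complex (p x) (q x)) \<in> borel_measurable borel"
    using p(1) q(1) by (auto simp: borel_measurable_complex_iff)
  have "AE x in lborel. f x = Complex (p x) (q x)"
    using p(2) q(2) by eventually_elim (simp add: complex_eq_iff)
  then have "AE x in lebesgue. f x = Complex (p x) (q x)"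
    by (rule AE_completion)
  with m show ?thesis by (intro bexI[of _ "\<lambda>x. Complex (p x) (q x)"])
qed

text \<open>Half-lines are closed under intersection and generate the Borel sets, so agreement on
  them suffices. The image measure gives \<open>{..a}\<close> the volume of a ball of radius
  \<open>a\<close>; the density gives the same number by the fundamental theorem of
  calculus.\<close>

lemma distr_norm_lborel:
  "distr (lborel :: 'a::euclidean_space measure) borel norm =
     density lborel (\<lambda>r. ennreal (DIM('a) * unit_ball_vol (real DIM('a)) * r ^ (DIM('a) - 1))
       * indicator {0..} r)"
  (is "?M = density lborel ?d")
proof (rule measure_eqI_generator_eq[where E = "range (\<lambda>a::real. {..a})" and \<Omega> = UNIV
      and A = "\<lambda>i. {..real i}"])
  let ?n = "DIM('a)" and ?V = "unit_ball_vol (real DIM('a))"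
  have [measurable]: "?d \<in> borel_measurable borel" by measurable
  have M: "emeasure ?M {..a} = (if a < 0 then 0 else ennreal (?V * a ^ ?n))" for a
  proof -
    have "emeasure ?M {..a} = emeasure (lborel::'a measure) (cball 0 a)"
      by (subst emeasure_distr) (auto intro!: arg_cong[where f="emeasure lborel"])
    then show ?thesis by (auto simp: emeasure_cball)
  qed
  have D: "emeasure (density lborel ?d) {..a} = (if a < 0 then 0 else ennreal (?V * a ^ ?n))" for a
  proof -
    have "emeasure (density lborel ?d) {..a} =
        (\<integral>\<^sup>+r. ennreal (?n * ?V * r ^ (?n - 1)) * indicator {0..a} r \<partial>lborel)"
      by (subst emeasure_density) (auto intro!: nn_integral_cong simp: indicator_def)
    also have "\<dots> = (if a < 0 then 0 else ennreal (?V * a ^ ?n))"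
    proof (cases "a < 0")
      case False
      then have "(\<integral>\<^sup>+r. ennreal (?n * ?V * r ^ (?n - 1)) * indicator {0..a} r \<partial>lborel)
          = ennreal (?V * a ^ ?n - ?V * 0 ^ ?n)"
        by (intro nn_integral_FTC_Icc) (auto intro!: derivative_eq_intros simp: unit_ball_vol_nonneg)
      then show ?thesis using False by simp
    qed auto
    finally show ?thesis .
  qed
  show "Int_stable (range (\<lambda>a::real. {..a}))"
  proof (rule Int_stableI)
    fix X Y :: "real set"
    assume "X \<in> range (\<lambda>a. {..a})" "Y \<in> range (\<lambda>a. {..a})"
    then obtain a b where "X = {..a}" "Y = {..b}" by blast
    then have "X \<inter> Y = {..min a b}" by auto
    then show "X \<inter> Y \<in> range (\<lambda>a. {..a})" by blast
  qed
  show "sets ?M = sigma_sets UNIV (range (\<lambda>a::real. {..a}))"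
    "sets (density lborel ?d) = sigma_sets UNIV (range (\<lambda>a::real. {..a}))"
    by (simp_all add: borel_eq_atMost)
  show "emeasure ?M X = emeasure (density lborel ?d) X" if "X \<in> range (\<lambda>a::real. {..a})" for X
    using that M D by auto
  show "(\<Union>i. {..real i}) = UNIV"
    using real_arch_simple by (auto simp: set_eq_iff)
  show "range (\<lambda>a::real. {..a}) \<subseteq> Pow UNIV" "range (\<lambda>i. {..real i}) \<subseteq> range (\<lambda>a::real. {..a})"
    by auto
  show "emeasure ?M {..real i} \<noteq> \<infinity>" for i
    by (simp add: M)
qed

text \<open>Integrating over \<open>{0<..}\<close> instead of \<open>{0..}\<close> drops a null set
  and keeps the origin away from the \<open>powr\<close> identities applied later to radial
  integrands.\<close>

lemma nn_integral_radial:
  assumes [measurable]: "\<phi> \<in> borel_measurable borel"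
  shows "(\<integral>\<^sup>+\<xi>. \<phi> (norm (\<xi>::'a::euclidean_space)) \<partial>lebesgue) =
     ennreal (DIM('a) * unit_ball_vol (real DIM('a))) *
       (\<integral>\<^sup>+r. \<phi> r * ennreal (r ^ (DIM('a) - 1)) * indicator {0<..} r \<partial>lborel)"
proof -
  let ?n = "DIM('a)" and ?V = "unit_ball_vol (real DIM('a))"
  have "(\<integral>\<^sup>+\<xi>. \<phi> (norm (\<xi>::'a)) \<partial>lebesgue) = (\<integral>\<^sup>+r. \<phi> r \<partial>distr (lborel::'a measure) borel norm)"
    by (subst nn_integral_distr) (auto simp: nn_integral_completion)
  also have "\<dots> = (\<integral>\<^sup>+r. ennreal (?n * ?V * r ^ (?n - 1)) * indicator {0..} r * \<phi> r \<partial>lborel)"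
    unfolding distr_norm_lborel by (subst nn_integral_density) auto
  also have "\<dots> = (\<integral>\<^sup>+r. ennreal (?n * ?V) * (\<phi> r * ennreal (r ^ (?n - 1)) * indicator {0<..} r) \<partial>lborel)"
  proof (rule nn_integral_cong_AE)
    show "AE r in lborel. ennreal (?n * ?V * r ^ (?n - 1)) * indicator {0..} r * \<phi> r =
        ennreal (?n * ?V) * (\<phi> r * ennreal (r ^ (?n - 1)) * indicator {0<..} r)"
      using AE_lborel_singleton[of "0::real"]
      by eventually_elim (auto simp: indicator_def ennreal_mult'' mult_ac)
  qed
  also have "\<dots> = ennreal (?n * ?V) * (\<integral>\<^sup>+r. \<phi> r * ennreal (r ^ (?n - 1)) * indicator {0<..} r \<partial>lborel)"
    by (subst nn_integral_cmult) auto
  finally show ?thesis .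
qed

section \<open>Fourier transforms of Gaussians, from one dimension to products\<close>

lemma std_gaussian_exp:
  "has_bochner_integral lborel (\<lambda>x. exp (\<i> * complex_of_real (t * x)) * complex_of_real (exp (- x\<^sup>2 / 2)))
     (complex_of_real (sqrt (2 * pi) * exp (- t\<^sup>2 / 2)))"
proof -
  have e: "exp (\<i> * complex_of_real (t * x)) * complex_of_real (exp (- x\<^sup>2 / 2)) =
      complex_of_real (sqrt (2 * pi)) * (std_normal_density x *\<^sub>R exp (\<i> * complex_of_real (t * x)))" for x
    by (simp add: std_normal_density_def scaleR_conv_of_real field_simps)
  have "integrable lborel (\<lambda>x. std_normal_density x *\<^sub>R exp (\<i> * complex_of_real (t * x)))"
    by (rule Bochner_Integration.integrable_bound[OF integrable_normal_density[of 1 0]]) auto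
  moreover have "(LINT x|lborel. std_normal_density x *\<^sub>R exp (\<i> * complex_of_real (t * x))) =
      complex_of_real (exp (- t\<^sup>2 / 2))"
    using fun_cong[OF char_std_normal_distribution, of t]
    unfolding char_def by (subst (asm) integral_density) auto
  ultimately have "has_bochner_integral lborel (\<lambda>x. std_normal_density x *\<^sub>R exp (\<i> * complex_of_real (t * x)))
      (complex_of_real (exp (- t\<^sup>2 / 2)))"
    by (simp add: has_bochner_integral_iff)
  from has_bochner_integral_mult_right[OF this, of "complex_of_real (sqrt (2 * pi))"]
  show ?thesis unfolding e by simp
qed

lemma gaussian_exp:
  assumes "a > 0"
  shows "has_bochner_integral lborel
      (\<lambda>x. exp (- \<i> * complex_of_real (t * x)) * complex_of_real (exp (- (a * x)\<^sup>2 / 2)))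
      (complex_of_real (sqrt (2 * pi) / a * exp (- (t / a)\<^sup>2 / 2)))"
proof -
  let ?s = "\<lambda>x. exp (\<i> * complex_of_real (- t / a * x)) * complex_of_real (exp (- x\<^sup>2 / 2))"
  have "has_bochner_integral lborel (\<lambda>x. ?s (0 + a * x))
      (complex_of_real (sqrt (2 * pi) * exp (- (- t / a)\<^sup>2 / 2)) /\<^sub>R \<bar>a\<bar>)"
    using std_gaussian_exp[of "- t / a"] assms
    by (subst lborel_has_bochner_integral_real_affine_iff[symmetric]) auto
  moreover have "?s (0 + a * x) = exp (- \<i> * complex_of_real (t * x)) * complex_of_real (exp (- (a * x)\<^sup>2 / 2))" for x
    using assms by simp
  moreover have "complex_of_real (sqrt (2 * pi) * exp (- (- t / a)\<^sup>2 / 2)) /\<^sub>R \<bar>a\<bar> =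
      complex_of_real (sqrt (2 * pi) / a * exp (- (t / a)\<^sup>2 / 2))"
    using assms by (simp add: scaleR_conv_of_real field_simps)
  ultimately show ?thesis by simp
qed

text \<open>The Fourier transform of \<open>exp (- (a * norm \<xi>)\<^sup>2 / 2)\<close>, kept as a
  product because its integrals are computed one coordinate at a time. As \<open>a\<close> tends to
  \<open>0\<close> it concentrates at the origin with constant total mass, like a multiple of an
  approximate identity.\<close>

definition gauss_kernel :: "real \<Rightarrow> 'a::euclidean_space \<Rightarrow> real" where
  "gauss_kernel a x = (\<Prod>b\<in>Basis. sqrt (2 * pi) / a * exp (- ((x \<bullet> b) / a)\<^sup>2 / 2))"

lemma borel_measurable_gauss_kernel [measurable]: "gauss_kernel a \<in> borel_measurable borel"
  unfolding gauss_kernel_def by measurable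

lemma gauss_kernel_nonneg: "a > 0 \<Longrightarrow> gauss_kernel a x \<ge> 0"
  unfolding gauss_kernel_def by (intro prod_nonneg) auto

lemma gauss_kernel_minus: "gauss_kernel a (- x) = gauss_kernel a x"
  by (simp add: gauss_kernel_def)

text \<open>By definition \<open>lborel\<close> is the image of a product of copies of
  \<open>interval_measure (\<lambda>x. x)\<close>, over which integrals of products factor. The
  image map recombines coordinates, so its inner product with \<open>b\<close> is coordinate
  \<open>b\<close> again.\<close>

lemma lborel_integral_prod:
  fixes f :: "'a::euclidean_space \<Rightarrow> real \<Rightarrow> complex"
  assumes "\<And>b. b \<in> Basis \<Longrightarrow> has_bochner_integral lborel (f b) (c b)"
  shows "(LINT x|lborel. (\<Prod>b\<in>Basis. f b (x \<bullet> b))) = (\<Prod>b\<in>Basis. c b)"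
proof -
  interpret product_sigma_finite "\<lambda>b::'a. interval_measure (\<lambda>x. x)"
    by (simp add: product_sigma_finite_def sigma_finite_interval_measure)
  have m[measurable]: "f b \<in> borel_measurable borel" if "b \<in> Basis" for b
    using borel_measurable_has_bochner_integral[OF assms[OF that]] by simp
  have [measurable]: "(\<lambda>x. \<Prod>b\<in>Basis. f b (x \<bullet> b)) \<in> borel_measurable borel"
    by measurable
  have "(LINT x|lborel. (\<Prod>b\<in>Basis. f b (x \<bullet> b))) =
      (LINT g|(\<Pi>\<^sub>M b\<in>(Basis::'a set). interval_measure (\<lambda>x. x)). (\<Prod>b\<in>Basis. f b ((\<Sum>b\<in>Basis. g b *\<^sub>R b) \<bullet> b)))"
    by (subst lborel_def, subst integral_distr) auto
  also have "\<dots> = (LINT g|(\<Pi>\<^sub>M b\<in>(Basis::'a set). interval_measure (\<lambda>x. x)). (\<Prod>b\<in>Basis. f b (g b)))"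
    by (intro Bochner_Integration.integral_cong refl prod.cong) simp_all
  also have "\<dots> = (\<Prod>b\<in>Basis. (LINT x|interval_measure (\<lambda>x. x). f b x))"
    using assms by (intro product_integral_prod) (auto simp: has_bochner_integral_iff lborel_eq_real)
  also have "\<dots> = (\<Prod>b\<in>Basis. c b)"
    using assms by (intro prod.cong) (auto simp: has_bochner_integral_iff lborel_eq_real)
  finally show ?thesis .
qed

lemma fourier_gaussian:
  fixes x :: "'a::euclidean_space"
  assumes "a > 0"
  shows "(LINT \<xi>|lborel. exp (- \<i> * complex_of_real (x \<bullet> \<xi>)) * complex_of_real (exp (- (a * norm \<xi>)\<^sup>2 / 2)))
      = complex_of_real (gauss_kernel a x)"
proof -
  have "exp (- \<i> * complex_of_real (x \<bullet> \<xi>)) * complex_of_real (exp (- (a * norm \<xi>)\<^sup>2 / 2)) =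
     (\<Prod>b\<in>Basis. exp (- \<i> * complex_of_real (x \<bullet> b * (\<xi> \<bullet> b))) * complex_of_real (exp (- (a * (\<xi> \<bullet> b))\<^sup>2 / 2)))" for \<xi>
  proof -
    have n: "(norm \<xi>)\<^sup>2 = (\<Sum>b\<in>Basis. (\<xi> \<bullet> b)\<^sup>2)"
      unfolding power2_norm_eq_inner by (subst euclidean_inner) (simp add: power2_eq_square)
    have "- (a * norm \<xi>)\<^sup>2 / 2 = (\<Sum>b\<in>Basis. - (a * (\<xi> \<bullet> b))\<^sup>2 / 2)"
      by (simp add: power_mult_distrib n sum_distrib_left sum_negf sum_divide_distrib)
    moreover have "- \<i> * complex_of_real (x \<bullet> \<xi>) = (\<Sum>b\<in>Basis. - \<i> * complex_of_real (x \<bullet> b * (\<xi> \<bullet> b)))"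
      by (subst euclidean_inner[of x \<xi>]) (simp add: sum_distrib_left sum_negf)
    ultimately show ?thesis
      by (simp only: prod.distrib exp_sum[OF finite_Basis] of_real_prod)
  qed
  then show ?thesis
    unfolding gauss_kernel_def of_real_prod
    by (simp only:) (intro lborel_integral_prod gaussian_exp assms)
qed

lemma integrable_gaussian_norm:
  assumes "a > 0"
  shows "integrable lborel (\<lambda>\<xi>::'a::euclidean_space. exp (- (a * norm \<xi>)\<^sup>2 / 2))"
proof (rule integrableI_nonneg)
  have n: "(norm \<xi>)\<^sup>2 = (\<Sum>b\<in>Basis. (\<xi> \<bullet> b)\<^sup>2)" for \<xi> :: 'a
    unfolding power2_norm_eq_inner by (subst euclidean_inner) (simp add: power2_eq_square)
  have "- (a * norm \<xi>)\<^sup>2 / 2 = (\<Sum>b\<in>Basis. - (a * (\<xi> \<bullet> b))\<^sup>2 / 2)" for \<xi> :: 'a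
    by (simp add: power_mult_distrib n sum_distrib_left sum_negf sum_divide_distrib)
  then have "(\<integral>\<^sup>+\<xi>. ennreal (exp (- (a * norm \<xi>)\<^sup>2 / 2)) \<partial>(lborel::'a measure)) =
      (\<integral>\<^sup>+\<xi>. (\<Prod>b\<in>Basis. ennreal (exp (- (a * (\<xi> \<bullet> b))\<^sup>2 / 2))) \<partial>(lborel::'a measure))"
    by (simp only: exp_sum[OF finite_Basis] prod_ennreal exp_ge_zero)
  also have "\<dots> = (\<Prod>b\<in>(Basis::'a set). \<integral>\<^sup>+x. ennreal (exp (- (a * x)\<^sup>2 / 2)) \<partial>lborel)"
    by (rule nn_integral_lborel_prod) auto
  also have "\<dots> < \<infinity>"
  proof -
    \<comment> \<open>At frequency \<open>0\<close> the integrand of \<open>gaussian_exp\<close> is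
      the Gaussian itself, which gives finiteness of each one-dimensional factor.\<close>
    have "integrable lborel (\<lambda>x. exp (- \<i> * complex_of_real (0 * x)) * complex_of_real (exp (- (a * x)\<^sup>2 / 2)))"
      using gaussian_exp[OF assms, of 0] by (simp add: has_bochner_integral_iff)
    then have "(\<integral>\<^sup>+x. ennreal (exp (- (a * x)\<^sup>2 / 2)) \<partial>lborel) < \<infinity>"
      by (simp add: integrable_iff_bounded)
    then show ?thesis by (simp add: power_less_top_ennreal)
  qed
  finally show "(\<integral>\<^sup>+\<xi>. ennreal (exp (- (a * norm \<xi>)\<^sup>2 / 2)) \<partial>(lborel::'a measure)) < \<infinity>" .
qed auto

lemma nn_integral_gauss_kernel:
  assumes "a > 0"
  shows "(\<integral>\<^sup>+x. ennreal (gauss_kernel a x) \<partial>(lborel::'a::euclidean_space measure)) = ennreal ((2 * pi) ^ DIM('a))"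
proof -
  have g: "has_bochner_integral lborel (\<lambda>x. exp (- (x / a)\<^sup>2 / 2)) (sqrt (2 * pi) * a)"
  proof -
    have "has_bochner_integral lborel (\<lambda>x. complex_of_real (exp (- (x / a)\<^sup>2 / 2))) (complex_of_real (sqrt (2 * pi) * a))"
      \<comment> \<open>Each factor of the kernel is a Gaussian of inverse scale; the
        \<open>a\<close> in its integral cancels the \<open>1 / a\<close> in front, leaving
        \<open>2 * pi\<close> per coordinate.\<close>
      using gaussian_exp[of "1 / a" 0] assms by simp
    from has_bochner_integral_Re[OF this] show ?thesis by simp
  qed
  have i: "(\<integral>\<^sup>+x. ennreal (sqrt (2 * pi) / a * exp (- (x / a)\<^sup>2 / 2)) \<partial>lborel) = ennreal (2 * pi)"
  proof -
    have "has_bochner_integral lborel (\<lambda>x. sqrt (2 * pi) / a * exp (- (x / a)\<^sup>2 / 2)) (sqrt (2 * pi) / a * (sqrt (2 * pi) * a))"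
      by (rule has_bochner_integral_mult_right[OF g])
    moreover have "sqrt (2 * pi) / a * (sqrt (2 * pi) * a) = 2 * pi"
      using assms by simp
    ultimately show ?thesis
      using assms by (subst nn_integral_eq_integral) (auto simp: has_bochner_integral_iff)
  qed
  have "(\<integral>\<^sup>+x. ennreal (gauss_kernel a x) \<partial>(lborel::'a measure)) =
      (\<integral>\<^sup>+x. (\<Prod>b\<in>Basis. ennreal (sqrt (2 * pi) / a * exp (- ((x \<bullet> b) / a)\<^sup>2 / 2))) \<partial>(lborel::'a measure))"
    unfolding gauss_kernel_def using assms by (simp add: prod_ennreal)
  also have "\<dots> = (\<Prod>b\<in>(Basis::'a set). ennreal (2 * pi))"
    by (subst nn_integral_lborel_prod) (simp_all only: i, auto)
  finally show ?thesis by (simp add: ennreal_power)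
qed

text \<open>Integrability is not assumed: the Bochner integral of a non-integrable function is
  \<open>0\<close>, so the bound is then trivial.\<close>

lemma norm_integral_le_nn_integral:
  fixes f :: "'a \<Rightarrow> 'b::{banach, second_countable_topology}"
  shows "ennreal (norm (integral\<^sup>L M f)) \<le> (\<integral>\<^sup>+x. ennreal (norm (f x)) \<partial>M)"
  by (cases "integrable M f") (simp_all add: integral_norm_bound_ennreal not_integrable_integral_eq)

text \<open>The double integrand is dominated by the product of \<open>norm (a x)\<close> and
  \<open>norm (b y)\<close>, whose integral is a product of two finite ones. The kernels to come are
  Fourier exponentials, of modulus one.\<close>

lemma lborel_Fubini_bounded_kernel:
  fixes a b :: "'a::euclidean_space \<Rightarrow> complex" and K :: "'a \<Rightarrow> 'a \<Rightarrow> complex"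
  assumes a: "integrable lborel a" and b: "integrable lborel b"
    and K[measurable]: "(\<lambda>(x, y). K x y) \<in> borel_measurable (borel \<Otimes>\<^sub>M borel)"
    and K1: "\<And>x y. norm (K x y) \<le> 1"
  shows "(LINT x|lborel. a x * (LINT y|lborel. K x y * b y)) =
         (LINT y|lborel. b y * (LINT x|lborel. K x y * a x))"
proof -
  have [measurable]: "a \<in> borel_measurable borel" "b \<in> borel_measurable borel"
    using a b by (auto dest: borel_measurable_integrable)
  have i: "integrable (lborel \<Otimes>\<^sub>M lborel) (\<lambda>(x, y). a x * (K x y * b y))"
  proof (rule integrableI_bounded)
    have "(\<integral>\<^sup>+p. ennreal (norm (case p of (x, y) \<Rightarrow> a x * (K x y * b y))) \<partial>(lborel \<Otimes>\<^sub>M lborel)) \<le>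
        (\<integral>\<^sup>+p. ennreal (norm (a (fst p))) * ennreal (norm (b (snd p))) \<partial>(lborel \<Otimes>\<^sub>M lborel))"
      using K1 by (intro nn_integral_mono)
        (auto simp: norm_mult ennreal_mult[symmetric] intro!: mult_left_mono mult_left_le_one_le)
    also have "\<dots> = (\<integral>\<^sup>+x. (\<integral>\<^sup>+y. ennreal (norm (a x)) * ennreal (norm (b y)) \<partial>lborel) \<partial>lborel)"
      by (subst lborel_pair.nn_integral_snd[symmetric]) (simp_all add: nn_integral_multc nn_integral_cmult mult.commute)
    also have "\<dots> = (\<integral>\<^sup>+x. ennreal (norm (a x)) \<partial>lborel) * (\<integral>\<^sup>+y. ennreal (norm (b y)) \<partial>lborel)"
      by (simp add: nn_integral_multc nn_integral_cmult)
    also have "\<dots> < \<infinity>"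
      using a b by (simp add: integrable_iff_bounded ennreal_mult_less_top)
    finally show "(\<integral>\<^sup>+p. ennreal (norm (case p of (x, y) \<Rightarrow> a x * (K x y * b y))) \<partial>(lborel \<Otimes>\<^sub>M lborel)) < \<infinity>" .
  qed measurable
  have "(LINT x|lborel. a x * (LINT y|lborel. K x y * b y)) = (LINT x|lborel. LINT y|lborel. a x * (K x y * b y))"
    by simp
  also have "\<dots> = (LINT y|lborel. LINT x|lborel. a x * (K x y * b y))"
    by (rule lborel_pair.Fubini_integral[OF i, symmetric])
  also have "\<dots> = (LINT y|lborel. b y * (LINT x|lborel. K x y * a x))"
    by (simp flip: integral_mult_right_zero add: mult_ac)
  finally show ?thesis .
qed

text \<open>Schur's test: AM-GM on \<open>q y * q x\<close> reduces the form to the total mass of the kernel.\<close>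

lemma nn_integral_gauss_kernel_Schur:
  fixes q :: "'a::euclidean_space \<Rightarrow> real"
  assumes [measurable]: "q \<in> borel_measurable borel" and q: "\<And>x. q x \<ge> 0" and a: "a > 0"
  shows "(\<integral>\<^sup>+y. \<integral>\<^sup>+x. ennreal (q y * q x * gauss_kernel a (x - y)) \<partial>lborel \<partial>lborel)
    \<le> ennreal ((2 * pi) ^ DIM('a)) * (\<integral>\<^sup>+x. ennreal ((q x)\<^sup>2) \<partial>lborel)"
proof -
  let ?c = "ennreal ((2 * pi) ^ DIM('a))"
  have shift: "(\<integral>\<^sup>+x. ennreal (gauss_kernel a (x - y)) \<partial>lborel) = ?c" for y :: 'a
  proof -
    have "(\<integral>\<^sup>+x. ennreal (gauss_kernel a x) \<partial>(lborel::'a measure)) = (\<integral>\<^sup>+x. ennreal (gauss_kernel a x) \<partial>distr lborel borel ((+) (- y)))"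
      by (simp only: lborel_distr_plus)
    also have "\<dots> = (\<integral>\<^sup>+x. ennreal (gauss_kernel a (x - y)) \<partial>lborel)"
      by (subst nn_integral_distr) auto
    finally show ?thesis using nn_integral_gauss_kernel[OF a, where 'a='a] by simp
  qed
  have shift': "(\<integral>\<^sup>+y. ennreal (gauss_kernel a (x - y)) \<partial>lborel) = ?c" for x :: 'a
    using shift[of x] by (subst gauss_kernel_minus[symmetric]) simp
  define h :: real where "h = 1/2"
  have h: "h \<ge> 0" "h > 0" by (auto simp: h_def)
  let ?A = "\<lambda>x y. ennreal ((q x)\<^sup>2) * ennreal (gauss_kernel a (x - y))"
  let ?B = "\<lambda>x y. ennreal ((q y)\<^sup>2) * ennreal (gauss_kernel a (x - y))"
  have "(\<integral>\<^sup>+y. \<integral>\<^sup>+x. ennreal (q y * q x * gauss_kernel a (x - y)) \<partial>lborel \<partial>lborel) \<le>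
     (\<integral>\<^sup>+y. \<integral>\<^sup>+x. ennreal h * (?A x y + ?B x y) \<partial>lborel \<partial>lborel)"
  proof (intro nn_integral_mono)
    fix x y :: 'a
    have "q y * q x \<le> h * ((q x)\<^sup>2 + (q y)\<^sup>2)"
      using zero_le_power2[of "q x - q y"] by (simp add: h_def power2_diff mult_ac)
    from mult_right_mono[OF this gauss_kernel_nonneg[OF a, of "x - y"]]
    have "q y * q x * gauss_kernel a (x - y) \<le> h * ((q x)\<^sup>2 * gauss_kernel a (x - y) + (q y)\<^sup>2 * gauss_kernel a (x - y))"
      by (simp add: algebra_simps)
    from ennreal_leI[OF this]
    show "ennreal (q y * q x * gauss_kernel a (x - y)) \<le> ennreal h * (?A x y + ?B x y)"
      using gauss_kernel_nonneg[OF a, where 'a='a] h by (simp add: ennreal_mult[symmetric] ennreal_plus[symmetric] del: ennreal_plus)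
  qed
  also have "\<dots> = ennreal h * ((\<integral>\<^sup>+y. \<integral>\<^sup>+x. ?A x y \<partial>lborel \<partial>lborel) + (\<integral>\<^sup>+y. \<integral>\<^sup>+x. ?B x y \<partial>lborel \<partial>lborel))"
    by (simp add: nn_integral_cmult nn_integral_add)
  \<comment> \<open>In \<open>?A\<close> the square sits on the inner variable, so the order is
    exchanged before the kernel is integrated out. Evenness of the kernel gives both terms the same
    mass, and the factor \<open>h\<close> makes up for counting it twice.\<close>
  also have "(\<integral>\<^sup>+y. \<integral>\<^sup>+x. ?A x y \<partial>lborel \<partial>lborel) = (\<integral>\<^sup>+x. \<integral>\<^sup>+y. ?A x y \<partial>lborel \<partial>lborel)"
    by (rule lborel_pair.Fubini') measurable
  also have "\<dots> = ?c * (\<integral>\<^sup>+x. ennreal ((q x)\<^sup>2) \<partial>lborel)"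
    by (simp add: nn_integral_cmult shift' nn_integral_multc mult.commute)
  also have "(\<integral>\<^sup>+y. \<integral>\<^sup>+x. ?B x y \<partial>lborel \<partial>lborel) = ?c * (\<integral>\<^sup>+x. ennreal ((q x)\<^sup>2) \<partial>lborel)"
    by (simp add: nn_integral_cmult shift nn_integral_multc mult.commute)
  also have "ennreal h * (?c * (\<integral>\<^sup>+x. ennreal ((q x)\<^sup>2) \<partial>lborel) + ?c * (\<integral>\<^sup>+x. ennreal ((q x)\<^sup>2) \<partial>lborel))
     = (ennreal h * 2) * (?c * (\<integral>\<^sup>+x. ennreal ((q x)\<^sup>2) \<partial>lborel))"
    by (simp only: mult_2[symmetric] mult.assoc)
  also have "ennreal h * 2 = 1"
  proof -
    have "ennreal h * ennreal 2 = 1"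
      using h by (subst ennreal_mult[symmetric]) (auto simp: h_def)
    then show ?thesis by simp
  qed
  finally show ?thesis by simp
qed

text \<open>The Gaussian weight makes Fubini's theorem applicable to \<open>F * cnj F\<close>.\<close>

lemma plancherel_bound_gaussian:
  fixes g :: "'a::euclidean_space \<Rightarrow> complex"
  assumes g: "integrable lborel g" and a: "a > 0"
  defines "F \<equiv> \<lambda>\<xi>. LINT x|lborel. exp (- \<i> * complex_of_real (x \<bullet> \<xi>)) * g x"
  shows "(\<integral>\<^sup>+\<xi>. ennreal (exp (- (a * norm \<xi>)\<^sup>2 / 2) * (norm (F \<xi>))\<^sup>2) \<partial>lborel)
    \<le> ennreal ((2 * pi) ^ DIM('a)) * (\<integral>\<^sup>+x. ennreal ((norm (g x))\<^sup>2) \<partial>lborel)"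
proof -
  have gm[measurable]: "g \<in> borel_measurable borel"
    using g by (auto dest: borel_measurable_integrable)
  have Fm[measurable]: "F \<in> borel_measurable borel"
    unfolding F_def by measurable
  have Fb: "norm (F \<xi>) \<le> (LINT x|lborel. norm (g x))" for \<xi>
    unfolding F_def by (rule order_trans[OF integral_norm_bound]) (simp add: norm_mult)
  let ?w = "\<lambda>\<xi>::'a. exp (- (a * norm \<xi>)\<^sup>2 / 2)"
  have w: "integrable lborel ?w" by (rule integrable_gaussian_norm[OF a])
  have cw: "integrable lborel (\<lambda>\<xi>. complex_of_real (?w \<xi>))" using w by simp
  have wF: "integrable lborel (\<lambda>\<xi>. complex_of_real (?w \<xi>) * F \<xi>)"
  proof (rule Bochner_Integration.integrable_bound)
    show "integrable lborel (\<lambda>\<xi>::'a. ?w \<xi> * (LINT x|lborel. norm (g x)))"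
      using w by (rule integrable_mult_left)
    show "AE \<xi> in lborel. norm (complex_of_real (?w \<xi>) * F \<xi>) \<le> norm (?w \<xi> * (LINT x|lborel. norm (g x)))"
      using Fb by (auto simp: norm_mult abs_mult intro!: mult_left_mono order_trans[OF Fb abs_ge_self])
  qed measurable
  \<comment> \<open>Undoing the transform of the damped \<open>F\<close> smears \<open>g\<close>
    with the Gaussian kernel. A second exchange, in \<open>J\<close>, then writes the damped energy
    as the quadratic form treated by Schur's test.\<close>
  have conv: "(LINT \<xi>|lborel. exp (\<i> * complex_of_real (y \<bullet> \<xi>)) * (complex_of_real (?w \<xi>) * F \<xi>)) =
      (LINT x|lborel. complex_of_real (gauss_kernel a (x - y)) * g x)" for y
  proof -
    have "(LINT x|lborel. g x * (LINT \<xi>|lborel. exp (- \<i> * complex_of_real ((x - y) \<bullet> \<xi>)) * complex_of_real (?w \<xi>))) =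
      (LINT \<xi>|lborel. complex_of_real (?w \<xi>) * (LINT x|lborel. exp (- \<i> * complex_of_real ((x - y) \<bullet> \<xi>)) * g x))"
      by (rule lborel_Fubini_bounded_kernel[OF g cw]) (auto, measurable)
    moreover have "(LINT x|lborel. exp (- \<i> * complex_of_real ((x - y) \<bullet> \<xi>)) * g x) = exp (\<i> * complex_of_real (y \<bullet> \<xi>)) * F \<xi>" for \<xi>
      unfolding F_def integral_mult_right_zero[symmetric]
      by (intro Bochner_Integration.integral_cong refl) (simp add: inner_diff_left right_diff_distrib exp_diff exp_minus field_simps)
    ultimately show ?thesis
      unfolding fourier_gaussian[OF a] by (simp only: mult_ac)
  qed
  have J: "(LINT \<xi>|lborel. complex_of_real (?w \<xi>) * F \<xi> * cnj (F \<xi>)) =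
     (LINT y|lborel. cnj (g y) * (LINT x|lborel. complex_of_real (gauss_kernel a (x - y)) * g x))"
  proof -
    have c: "cnj (F \<xi>) = (LINT y|lborel. exp (\<i> * complex_of_real (y \<bullet> \<xi>)) * cnj (g y))" for \<xi>
      unfolding F_def by (subst Bochner_Integration.integral_cnj[symmetric]) (simp add: exp_cnj)
    have "(LINT \<xi>|lborel. complex_of_real (?w \<xi>) * F \<xi> * (LINT y|lborel. exp (\<i> * complex_of_real (y \<bullet> \<xi>)) * cnj (g y))) =
      (LINT y|lborel. cnj (g y) * (LINT \<xi>|lborel. exp (\<i> * complex_of_real (y \<bullet> \<xi>)) * (complex_of_real (?w \<xi>) * F \<xi>)))"
      using g by (intro lborel_Fubini_bounded_kernel wF) (auto, measurable)
    then show ?thesis unfolding c conv .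
  qed
  \<comment> \<open>The damped energy is real and nonnegative, hence equal to the modulus of the
    complex integral in \<open>J\<close>, and the modulus may be moved inside on the physical
    side.\<close>
  have "(\<integral>\<^sup>+\<xi>. ennreal (?w \<xi> * (norm (F \<xi>))\<^sup>2) \<partial>lborel) =
      ennreal (norm (LINT \<xi>|lborel. complex_of_real (?w \<xi>) * F \<xi> * cnj (F \<xi>)))"
  proof -
    have e: "complex_of_real (?w \<xi>) * F \<xi> * cnj (F \<xi>) = complex_of_real (?w \<xi> * (norm (F \<xi>))\<^sup>2)" for \<xi>
      by (simp only: mult.assoc complex_norm_square[symmetric] of_real_mult)
    have "integrable lborel (\<lambda>\<xi>::'a. ?w \<xi> * (norm (F \<xi>))\<^sup>2)"
    proof (rule Bochner_Integration.integrable_bound)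
      show "integrable lborel (\<lambda>\<xi>::'a. ?w \<xi> * (LINT x|lborel. norm (g x))\<^sup>2)"
        using w by (rule integrable_mult_left)
      show "AE \<xi> in lborel. norm (?w \<xi> * (norm (F \<xi>))\<^sup>2) \<le> norm (?w \<xi> * (LINT x|lborel. norm (g x))\<^sup>2)"
        using Fb by (auto simp: abs_mult intro!: mult_left_mono power_mono)
    qed measurable
    then have "(\<integral>\<^sup>+\<xi>. ennreal (?w \<xi> * (norm (F \<xi>))\<^sup>2) \<partial>lborel) = ennreal (LINT \<xi>|lborel. ?w \<xi> * (norm (F \<xi>))\<^sup>2)"
      by (intro nn_integral_eq_integral) auto
    also have "(LINT \<xi>|lborel. ?w \<xi> * (norm (F \<xi>))\<^sup>2) =
        norm (LINT \<xi>|lborel. complex_of_real (?w \<xi> * (norm (F \<xi>))\<^sup>2))"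
      unfolding integral_complex_of_real norm_of_real by (simp add: Bochner_Integration.integral_nonneg)
    finally show ?thesis unfolding e .
  qed
  also have "\<dots> \<le> (\<integral>\<^sup>+y. ennreal (norm (cnj (g y) * (LINT x|lborel. complex_of_real (gauss_kernel a (x - y)) * g x))) \<partial>lborel)"
    unfolding J by (rule norm_integral_le_nn_integral)
  also have "\<dots> \<le> (\<integral>\<^sup>+y. \<integral>\<^sup>+x. ennreal (norm (g y) * norm (g x) * gauss_kernel a (x - y)) \<partial>lborel \<partial>lborel)"
  proof (rule nn_integral_mono)
    fix y
    have "ennreal (norm (cnj (g y) * (LINT x|lborel. complex_of_real (gauss_kernel a (x - y)) * g x))) =
       ennreal (norm (g y)) * ennreal (norm (LINT x|lborel. complex_of_real (gauss_kernel a (x - y)) * g x))"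
      by (simp add: norm_mult ennreal_mult)
    also have "\<dots> \<le> ennreal (norm (g y)) * (\<integral>\<^sup>+x. ennreal (norm (complex_of_real (gauss_kernel a (x - y)) * g x)) \<partial>lborel)"
      by (intro mult_left_mono norm_integral_le_nn_integral) auto
    also have "\<dots> = (\<integral>\<^sup>+x. ennreal (norm (g y) * norm (g x) * gauss_kernel a (x - y)) \<partial>lborel)"
      using gauss_kernel_nonneg[OF a, where 'a='a]
      by (subst nn_integral_cmult[symmetric]) (auto simp: norm_mult ennreal_mult[symmetric] mult_ac abs_of_nonneg)
    finally show "ennreal (norm (cnj (g y) * (LINT x|lborel. complex_of_real (gauss_kernel a (x - y)) * g x))) \<le>
      (\<integral>\<^sup>+x. ennreal (norm (g y) * norm (g x) * gauss_kernel a (x - y)) \<partial>lborel)" .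
  qed
  also have "\<dots> \<le> ennreal ((2 * pi) ^ DIM('a)) * (\<integral>\<^sup>+x. ennreal ((norm (g x))\<^sup>2) \<partial>lborel)"
    by (rule nn_integral_gauss_kernel_Schur[OF _ _ a]) auto
  finally show ?thesis .
qed

subsection \<open>Plancherel's inequality\<close>

text \<open>Sums, Fatou's lemma and polar coordinates all act on the integral of the square, so the
  estimates are made for it and \<open>ennreal_sqrt\<close> is applied only at their end.\<close>

definition L2_sq :: "('a::euclidean_space \<Rightarrow> complex) \<Rightarrow> ennreal" where
  "L2_sq f = (\<integral>\<^sup>+ x. ennreal ((norm (f x))\<^sup>2) \<partial>lebesgue)"

lemma L2_norm_sq: "L2_norm f * L2_norm f = L2_sq f"
proof (cases "L2_sq f = \<infinity>")
  case True
  then show ?thesis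
    unfolding L2_norm_def L2_sq_def[symmetric] ennreal_sqrt_def by (simp add: ennreal_top_mult)
next
  case False
  then obtain r where "L2_sq f = ennreal r" "r \<ge> 0"
    by (metis ennreal_cases infinity_ennreal_def)
  then show ?thesis
    unfolding L2_norm_def L2_sq_def[symmetric] ennreal_sqrt_def
    by (simp add: ennreal_mult[symmetric])
qed

lemma L2_norm_eq: "L2_norm f = ennreal_sqrt (L2_sq f)"
  by (simp add: L2_norm_def L2_sq_def)

lemma ennreal_sqrt_less_top: "ennreal_sqrt x < \<infinity> \<longleftrightarrow> x < \<infinity>"
  by (simp add: ennreal_sqrt_def less_top)

lemma mem_L2_iff: "f \<in> L2 \<longleftrightarrow> f \<in> borel_measurable lebesgue \<and> L2_sq f < \<infinity>"
  by (simp add: L2_def L2_norm_eq ennreal_sqrt_less_top del: infinity_ennreal_def)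

text \<open>A substitute for Minkowski's inequality, from \<open>(a + b)^2 <= 2 a^2 + 2 b^2\<close>
  pointwise; the lost factor only affects constants.\<close>

lemma L2_sq_add_le:
  assumes [measurable]: "f \<in> borel_measurable lebesgue" "g \<in> borel_measurable lebesgue"
  shows "L2_sq (\<lambda>x. f x + g x) \<le> 2 * L2_sq f + 2 * L2_sq g"
proof -
  have "L2_sq (\<lambda>x. f x + g x) \<le>
      (\<integral>\<^sup>+x. 2 * ennreal ((norm (f x))\<^sup>2) + 2 * ennreal ((norm (g x))\<^sup>2) \<partial>lebesgue)"
    unfolding L2_sq_def
  proof (rule nn_integral_mono)
    fix x
    have "(norm (f x + g x))\<^sup>2 \<le> (norm (f x) + norm (g x))\<^sup>2"
      by (simp add: norm_triangle_ineq power_mono)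
    also have "\<dots> \<le> 2 * (norm (f x))\<^sup>2 + 2 * (norm (g x))\<^sup>2"
      using zero_le_power2[of "norm (f x) - norm (g x)"] by (simp add: power2_diff power2_sum)
    finally have "ennreal ((norm (f x + g x))\<^sup>2) \<le> ennreal (2 * (norm (f x))\<^sup>2 + 2 * (norm (g x))\<^sup>2)"
      by (rule ennreal_leI)
    then show "ennreal ((norm (f x + g x))\<^sup>2) \<le> 2 * ennreal ((norm (f x))\<^sup>2) + 2 * ennreal ((norm (g x))\<^sup>2)"
      by (simp add: ennreal_mult)
  qed
  also have "\<dots> = 2 * L2_sq f + 2 * L2_sq g"
    unfolding L2_sq_def by (subst nn_integral_add) (auto simp: nn_integral_cmult)
  finally show ?thesis .
qed

lemma L2_sq_cong_AE: "AE x in lebesgue. f x = g x \<Longrightarrow> L2_sq f = L2_sq g"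
  unfolding L2_sq_def by (rule nn_integral_cong_AE) auto

lemma mem_L1_iff: "f \<in> L1 \<longleftrightarrow> integrable lebesgue f"
  by (simp add: L1_def L1_norm_def integrable_iff_bounded)

lemma norm_fourier_le:
  assumes "f \<in> L1"
  shows "ennreal (norm (fourier f \<xi>)) \<le> L1_norm f"
proof -
  have "ennreal (norm (fourier f \<xi>)) \<le> (\<integral>\<^sup>+x. ennreal (norm (exp (- \<i> * complex_of_real (x \<bullet> \<xi>)) * f x)) \<partial>lebesgue)"
    unfolding fourier_def by (rule norm_integral_le_nn_integral)
  then show ?thesis by (simp add: norm_mult L1_norm_def)
qed

lemma borel_exp_inner_lebesgue [measurable]:
  "(\<lambda>x. exp (- \<i> * complex_of_real (x \<bullet> \<xi>))) \<in> borel_measurable (lebesgue :: 'a::euclidean_space measure)"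
proof -
  have "(\<lambda>x. exp (- \<i> * complex_of_real (x \<bullet> \<xi>))) \<in> borel_measurable (lborel :: 'a measure)"
    by measurable
  then show ?thesis by (rule measurable_completion)
qed

text \<open>Fubini's theorem is applied over \<open>lborel\<close>, while the data are measurable
  only for its completion. A Borel representative has the same transform at every frequency, since
  an integral ignores null sets.\<close>

lemma fourier_eq_lborel:
  fixes f :: "'a::euclidean_space \<Rightarrow> complex"
  assumes "f \<in> L1"
  obtains g where "integrable lborel g" "AE x in lebesgue. f x = g x"
    "\<And>\<xi>. fourier f \<xi> = (LINT x|lborel. exp (- \<i> * complex_of_real (x \<bullet> \<xi>)) * g x)"
proof -
  have i: "integrable lebesgue f" using assms by (simp add: mem_L1_iff)
  then have fm[measurable]: "f \<in> borel_measurable lebesgue" by auto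
  then obtain g where gm: "g \<in> borel_measurable borel" and ae: "AE x in lebesgue. f x = g x"
    using complex_lebesgue_measurable_AE_borel by blast
  have gm'[measurable]: "g \<in> borel_measurable lborel" using gm by simp
  then have gl[measurable]: "g \<in> borel_measurable lebesgue" by (rule measurable_completion)
  have "integrable lebesgue g"
    using i ae by (subst integrable_cong_AE[where g=f]) auto
  then have g: "integrable lborel g" by (simp add: integrable_completion[OF gm'])
  have "fourier f \<xi> = (LINT x|lborel. exp (- \<i> * complex_of_real (x \<bullet> \<xi>)) * g x)" for \<xi>
  proof -
    have "fourier f \<xi> = (LINT x|lebesgue. exp (- \<i> * complex_of_real (x \<bullet> \<xi>)) * g x)"
      unfolding fourier_def
    proof (rule integral_cong_AE)
      show "AE x in lebesgue. exp (- \<i> * complex_of_real (x \<bullet> \<xi>)) * f x = exp (- \<i> * complex_of_real (x \<bullet> \<xi>)) * g x"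
        using ae by eventually_elim simp
    qed measurable
    then show ?thesis by (subst (asm) integral_completion) auto
  qed
  with g ae that show ?thesis by blast
qed

lemma borel_measurable_fourier:
  assumes "f \<in> L1"
  shows "fourier f \<in> borel_measurable lebesgue"
proof -
  obtain g where g: "integrable lborel g"
    and e: "\<And>\<xi>. fourier f \<xi> = (LINT x|lborel. exp (- \<i> * complex_of_real (x \<bullet> \<xi>)) * g x)"
    using fourier_eq_lborel[OF assms] by metis
  have [measurable]: "g \<in> borel_measurable borel" using g by (auto dest: borel_measurable_integrable)
  have "fourier f \<in> borel_measurable lborel"
    unfolding e[abs_def] by measurable
  then show ?thesis by (rule measurable_completion)
qed

text \<open>The bound of \<open>plancherel_bound_gaussian\<close> does not depend on
  \<open>a\<close>. Along \<open>a = 1 / Suc m\<close> the Gaussian weight tends to \<open>1\<close>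
  pointwise, so Fatou's lemma removes it.\<close>

lemma plancherel_le:
  fixes f :: "'a::euclidean_space \<Rightarrow> complex"
  assumes "f \<in> L1"
  shows "L2_sq (fourier f) \<le> ennreal ((2 * pi) ^ DIM('a)) * L2_sq f"
proof -
  obtain g where g: "integrable lborel g" and ae: "AE x in lebesgue. f x = g x"
    and e: "\<And>\<xi>. fourier f \<xi> = (LINT x|lborel. exp (- \<i> * complex_of_real (x \<bullet> \<xi>)) * g x)"
    using fourier_eq_lborel[OF assms] by metis
  have [measurable]: "g \<in> borel_measurable borel" using g by (auto dest: borel_measurable_integrable)
  have Fm[measurable]: "fourier f \<in> borel_measurable borel"
    unfolding e[abs_def] by measurable
  let ?a = "\<lambda>m. 1 / real (Suc m)"
  let ?G = "\<lambda>m \<xi>. ennreal (exp (- (?a m * norm \<xi>)\<^sup>2 / 2) * (norm (fourier f \<xi>))\<^sup>2)"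
  have "L2_sq (fourier f) = (\<integral>\<^sup>+\<xi>. liminf (\<lambda>m. ?G m \<xi>) \<partial>lborel)"
    unfolding L2_sq_def nn_integral_completion
  proof (rule nn_integral_cong)
    fix \<xi>
    have "(\<lambda>m. exp (- (?a m * norm \<xi>)\<^sup>2 / 2) * (norm (fourier f \<xi>))\<^sup>2) \<longlonglongrightarrow> exp (- (0 * norm \<xi>)\<^sup>2 / 2) * (norm (fourier f \<xi>))\<^sup>2"
      by (intro tendsto_intros LIMSEQ_inverse_real_of_nat[unfolded inverse_eq_divide]) auto
    then have "(\<lambda>m. ?G m \<xi>) \<longlonglongrightarrow> ennreal ((norm (fourier f \<xi>))\<^sup>2)"
      by (intro tendsto_ennrealI) simp
    then show "ennreal ((norm (fourier f \<xi>))\<^sup>2) = liminf (\<lambda>m. ?G m \<xi>)"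
      by (rule lim_imp_Liminf[OF sequentially_bot, symmetric])
  qed
  also have "\<dots> \<le> liminf (\<lambda>m. \<integral>\<^sup>+\<xi>. ?G m \<xi> \<partial>lborel)"
    by (rule nn_integral_liminf) measurable
  also have "\<dots> \<le> liminf (\<lambda>m. ennreal ((2 * pi) ^ DIM('a)) * (\<integral>\<^sup>+x. ennreal ((norm (g x))\<^sup>2) \<partial>lborel))"
    unfolding e by (intro Liminf_mono always_eventually allI plancherel_bound_gaussian g) simp
  also have "\<dots> = ennreal ((2 * pi) ^ DIM('a)) * L2_sq g"
    by (simp add: Liminf_const L2_sq_def nn_integral_completion)
  also have "L2_sq g = L2_sq f"
    using ae by (intro L2_sq_cong_AE) auto
  finally show ?thesis .
qed

text \<open>A ball has finite measure, and \<open>r <= 1 + r^2\<close> bounds the modulus by a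
  constant plus its square.\<close>

lemma truncation_L1:
  fixes f :: "'a::euclidean_space \<Rightarrow> complex"
  assumes "f \<in> L2"
  shows "(\<lambda>x. indicator (ball 0 R) x * f x) \<in> L1"
proof -
  have f[measurable]: "f \<in> borel_measurable lebesgue" and fin: "L2_sq f < \<infinity>"
    using assms by (auto simp: mem_L2_iff)
  have [measurable]: "ball (0::'a) R \<in> sets lebesgue" by simp
  have le: "r \<le> 1 + r\<^sup>2" for r :: real
    using zero_le_power2[of "r - 1/2"] by (simp add: power2_diff power_divide)
  have "L1_norm (\<lambda>x. indicator (ball 0 R) x * f x) \<le>
      (\<integral>\<^sup>+x. indicator (ball 0 R) x + ennreal ((norm (f x))\<^sup>2) \<partial>lebesgue)"
    unfolding L1_norm_def
  proof (rule nn_integral_mono)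
    fix x
    show "ennreal (norm (indicator (ball 0 R) x * f x)) \<le> indicator (ball 0 R) x + ennreal ((norm (f x))\<^sup>2)"
      using ennreal_leI[OF le[of "norm (f x)"]] by (simp add: indicator_def)
  qed
  also have "\<dots> = emeasure lebesgue (ball (0::'a) R) + L2_sq f"
    unfolding L2_sq_def by (subst nn_integral_add) auto
  also have "\<dots> < \<infinity>"
    using fin emeasure_bounded_finite[of "ball (0::'a) R"] by (simp add: less_top)
  finally show ?thesis by (simp add: L1_def)
qed

lemma L2_sq_truncation_le: "L2_sq (\<lambda>x. indicator (ball 0 R) x * f x) \<le> L2_sq f"
  unfolding L2_sq_def by (intro nn_integral_mono) (auto simp: indicator_def)

lemma L2_norm_tendsto_0D:
  assumes "((\<lambda>R. L2_norm (h R)) \<longlongrightarrow> 0) F"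
  shows "((\<lambda>R. L2_sq (h R)) \<longlongrightarrow> 0) F"
  unfolding L2_norm_sq[symmetric] using tendsto_mult_ennreal[OF assms assms] by simp

text \<open>Either clause of \<open>has_fourier\<close> may be the valid one. Under the first,
  \<open>plancherel_le\<close> applies directly; under the second it applies to the truncations, and
  the remainder vanishes as the radius grows. The factor \<open>2\<close> comes from
  \<open>L2_sq_add_le\<close>.\<close>

lemma has_fourier_L2_sq_le:
  fixes f :: "'a::euclidean_space \<Rightarrow> complex"
  assumes f: "f \<in> L2" and u: "has_fourier f u"
  shows "L2_sq u \<le> 2 * ennreal ((2 * pi) ^ DIM('a)) * L2_sq f"
proof -
  let ?c = "ennreal ((2 * pi) ^ DIM('a))"
  have um[measurable]: "u \<in> borel_measurable lebesgue" using u by (simp add: has_fourier_def)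
  show ?thesis
  proof (cases "f \<in> L1 \<and> (AE \<xi> in lebesgue. u \<xi> = fourier f \<xi>)")
    case True
    then have "L2_sq u \<le> ?c * L2_sq f"
      using L2_sq_cong_AE[of u "fourier f"] plancherel_le[of f] by simp
    also have "\<dots> \<le> ?c * L2_sq f + ?c * L2_sq f" by simp
    finally show ?thesis by (simp only: mult_2[symmetric] mult.assoc)
  next
    case False
    let ?F = "\<lambda>R. fourier (\<lambda>x. indicator (ball 0 R) x * f x)"
    have "((\<lambda>R. L2_norm (\<lambda>\<xi>. u \<xi> - ?F R \<xi>)) \<longlongrightarrow> 0) at_top"
      using u False by (auto simp: has_fourier_def)
    then have "((\<lambda>R. L2_sq (\<lambda>\<xi>. u \<xi> - ?F R \<xi>)) \<longlongrightarrow> 0) at_top"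
      by (rule L2_norm_tendsto_0D)
    from tendsto_mult_ennreal[OF tendsto_const this, of 2]
    have lim: "((\<lambda>R. 2 * L2_sq (\<lambda>\<xi>. u \<xi> - ?F R \<xi>)) \<longlongrightarrow> 0) at_top" by simp
    have b: "L2_sq u \<le> 2 * L2_sq (\<lambda>\<xi>. u \<xi> - ?F R \<xi>) + 2 * ?c * L2_sq f" for R
    proof -
      have t: "(\<lambda>x. indicator (ball 0 R) x * f x) \<in> L1" using f by (rule truncation_L1)
      note [measurable] = borel_measurable_fourier[OF t]
      have "L2_sq u = L2_sq (\<lambda>\<xi>. (u \<xi> - ?F R \<xi>) + ?F R \<xi>)" by simp
      also have "\<dots> \<le> 2 * L2_sq (\<lambda>\<xi>. u \<xi> - ?F R \<xi>) + 2 * L2_sq (?F R)"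
        by (rule L2_sq_add_le) measurable
      also have "L2_sq (?F R) \<le> ?c * L2_sq f"
        using plancherel_le[OF t] L2_sq_truncation_le by (rule order_trans[OF _ mult_left_mono]) auto
      finally show ?thesis by (simp add: mult.assoc mult_left_mono add_left_mono)
    qed
    have "((\<lambda>R. 2 * L2_sq (\<lambda>\<xi>. u \<xi> - ?F R \<xi>) + 2 * ?c * L2_sq f) \<longlongrightarrow> 0 + 2 * ?c * L2_sq f) at_top"
      by (intro tendsto_add lim tendsto_const)
    from tendsto_lowerbound[OF this] b show ?thesis by simp
  qed
qed

text \<open>Consistency of the two clauses of \<open>has_fourier\<close>: for an integrable function
  certified only by the \<open>L2\<close> clause, the transforms of the truncations tend to
  \<open>u\<close> in square mean and to \<open>fourier f\<close> pointwise by dominated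
  convergence. Fatou's lemma identifies the limits. Sup bounds for \<open>u\<close> rest on
  this.\<close>

lemma has_fourier_L1_AE:
  fixes f :: "'a::euclidean_space \<Rightarrow> complex"
  assumes f: "f \<in> L1" and u: "has_fourier f u"
  shows "AE \<xi> in lebesgue. u \<xi> = fourier f \<xi>"
proof (cases "AE \<xi> in lebesgue. u \<xi> = fourier f \<xi>")
  case False
  let ?F = "\<lambda>R. fourier (\<lambda>x. indicator (ball 0 R) x * f x)"
  have um[measurable]: "u \<in> borel_measurable lebesgue" using u by (simp add: has_fourier_def)
  have f2: "f \<in> L2" using u False by (auto simp: has_fourier_def)
  have "((\<lambda>R. L2_norm (\<lambda>\<xi>. u \<xi> - ?F R \<xi>)) \<longlongrightarrow> 0) at_top"
    using u False by (auto simp: has_fourier_def)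
  then have "((\<lambda>R. L2_sq (\<lambda>\<xi>. u \<xi> - ?F R \<xi>)) \<longlongrightarrow> 0) at_top"
    by (rule L2_norm_tendsto_0D)
  then have lim: "(\<lambda>k. L2_sq (\<lambda>\<xi>. u \<xi> - ?F (real k) \<xi>)) \<longlonglongrightarrow> 0"
    by (rule filterlim_compose[OF _ filterlim_real_sequentially])
  note [measurable] = borel_measurable_fourier[OF f] borel_measurable_fourier[OF truncation_L1[OF f2]]
  have fi: "integrable lebesgue f" using f by (simp add: mem_L1_iff)
  have ptw: "(\<lambda>k. ?F (real k) \<xi>) \<longlonglongrightarrow> fourier f \<xi>" for \<xi>
    unfolding fourier_def
  proof (rule integral_dominated_convergence[where w="\<lambda>x. norm (f x)"])
    have [measurable]: "f \<in> borel_measurable lebesgue" using fi by auto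
    show "(\<lambda>x. exp (- \<i> * complex_of_real (x \<bullet> \<xi>)) * f x) \<in> borel_measurable lebesgue" by measurable
    have [measurable]: "ball (0::'a) R \<in> sets lebesgue" for R by simp
    show "(\<lambda>x. exp (- \<i> * complex_of_real (x \<bullet> \<xi>)) * (indicator (ball 0 (real k)) x * f x)) \<in> borel_measurable lebesgue" for k
      by measurable
    show "integrable lebesgue (\<lambda>x. norm (f x))" using fi by simp
    show "AE x in lebesgue. norm (exp (- \<i> * complex_of_real (x \<bullet> \<xi>)) * (indicator (ball 0 (real k)) x * f x)) \<le> norm (f x)" for k
      by (auto simp: norm_mult indicator_def)
    show "AE x in lebesgue. (\<lambda>k. exp (- \<i> * complex_of_real (x \<bullet> \<xi>)) * (indicator (ball 0 (real k)) x * f x))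
        \<longlonglongrightarrow> exp (- \<i> * complex_of_real (x \<bullet> \<xi>)) * f x"
    proof (rule AE_I2)
      fix x :: 'a
      have "\<forall>\<^sub>F k in sequentially. norm x < real k"
        using filterlim_real_sequentially by (rule filterlim_at_top_dense[THEN iffD1, THEN spec])
      then have "\<forall>\<^sub>F k in sequentially. exp (- \<i> * complex_of_real (x \<bullet> \<xi>)) * (indicator (ball 0 (real k)) x * f x)
          = exp (- \<i> * complex_of_real (x \<bullet> \<xi>)) * f x"
        by eventually_elim (simp add: indicator_def)
      then show "(\<lambda>k. exp (- \<i> * complex_of_real (x \<bullet> \<xi>)) * (indicator (ball 0 (real k)) x * f x))
        \<longlonglongrightarrow> exp (- \<i> * complex_of_real (x \<bullet> \<xi>)) * f x"
        by (rule tendsto_eventually)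
    qed
  qed
  have "L2_sq (\<lambda>\<xi>. u \<xi> - fourier f \<xi>) = (\<integral>\<^sup>+\<xi>. liminf (\<lambda>k. ennreal ((norm (u \<xi> - ?F (real k) \<xi>))\<^sup>2)) \<partial>lebesgue)"
    unfolding L2_sq_def
  proof (rule nn_integral_cong)
    fix \<xi>
    have "(\<lambda>k. ennreal ((norm (u \<xi> - ?F (real k) \<xi>))\<^sup>2)) \<longlonglongrightarrow> ennreal ((norm (u \<xi> - fourier f \<xi>))\<^sup>2)"
      by (intro tendsto_ennrealI tendsto_intros ptw)
    then show "ennreal ((norm (u \<xi> - fourier f \<xi>))\<^sup>2) = liminf (\<lambda>k. ennreal ((norm (u \<xi> - ?F (real k) \<xi>))\<^sup>2))"
      by (rule lim_imp_Liminf[OF sequentially_bot, symmetric])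
  qed
  also have "\<dots> \<le> liminf (\<lambda>k. L2_sq (\<lambda>\<xi>. u \<xi> - ?F (real k) \<xi>))"
    unfolding L2_sq_def by (rule nn_integral_liminf) measurable
  also have "\<dots> = 0"
    using lim by (simp add: lim_imp_Liminf)
  finally have "(\<integral>\<^sup>+\<xi>. ennreal ((norm (u \<xi> - fourier f \<xi>))\<^sup>2) \<partial>lebesgue) = 0"
    by (simp add: L2_sq_def)
  then have "AE \<xi> in lebesgue. ennreal ((norm (u \<xi> - fourier f \<xi>))\<^sup>2) = 0"
    by (subst (asm) nn_integral_0_iff_AE) auto
  then show ?thesis by (rule AE_mp) (auto intro!: AE_I2 simp: ennreal_eq_0_iff)
qed

text \<open>The transform is continuous at the origin by dominated convergence along sequences, and
  its value there is the mass.\<close>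

lemma fourier_lower_near_0:
  fixes f :: "'a::euclidean_space \<Rightarrow> complex"
  assumes f: "f \<in> L1" and m: "mass f \<noteq> 0"
  shows "\<exists>\<delta>>0. \<forall>\<xi>. norm \<xi> < \<delta> \<longrightarrow> norm (fourier f \<xi>) \<ge> norm (mass f) / 2"
proof -
  have fi: "integrable lebesgue f" using f by (simp add: mem_L1_iff)
  have f0: "fourier f 0 = mass f" by (simp add: fourier_def mass_def)
  have "(fourier f \<longlongrightarrow> fourier f 0) (at 0)"
    unfolding tendsto_at_iff_sequentially
  proof (intro allI impI)
    fix X :: "nat \<Rightarrow> 'a" assume X: "X \<longlonglongrightarrow> 0"
    show "(fourier f \<circ> X) \<longlonglongrightarrow> fourier f 0"
      unfolding fourier_def o_def
    proof (rule integral_dominated_convergence[where w="\<lambda>x. norm (f x)"])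
      have [measurable]: "f \<in> borel_measurable lebesgue" using fi by auto
      show "(\<lambda>x. exp (- \<i> * complex_of_real (x \<bullet> 0)) * f x) \<in> borel_measurable lebesgue"
        "(\<lambda>x. exp (- \<i> * complex_of_real (x \<bullet> X i)) * f x) \<in> borel_measurable lebesgue" for i by measurable
      show "integrable lebesgue (\<lambda>x. norm (f x))" using fi by simp
      show "AE x in lebesgue. norm (exp (- \<i> * complex_of_real (x \<bullet> X i)) * f x) \<le> norm (f x)" for i
        by (auto simp: norm_mult)
      show "AE x in lebesgue. (\<lambda>i. exp (- \<i> * complex_of_real (x \<bullet> X i)) * f x)
         \<longlonglongrightarrow> exp (- \<i> * complex_of_real (x \<bullet> 0)) * f x"
        by (intro AE_I2 tendsto_intros X)
    qed
  qed
  then have "((\<lambda>\<xi>. norm (fourier f \<xi>)) \<longlongrightarrow> norm (mass f)) (at 0)"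
    unfolding f0 by (rule tendsto_norm)
  moreover have "norm (mass f) / 2 < norm (mass f)" using m by simp
  ultimately have "\<forall>\<^sub>F \<xi> in at 0. norm (mass f) / 2 < norm (fourier f \<xi>)"
    by (rule order_tendstoD)
  then obtain \<delta> where d: "\<delta> > 0" "\<And>\<xi>. \<xi> \<noteq> 0 \<Longrightarrow> dist \<xi> 0 < \<delta> \<Longrightarrow> norm (mass f) / 2 < norm (fourier f \<xi>)"
    unfolding eventually_at by auto
  have "norm (fourier f \<xi>) \<ge> norm (mass f) / 2" if "norm \<xi> < \<delta>" for \<xi>
    using d(2)[of \<xi>] that f0 by (cases "\<xi> = 0") auto
  with d(1) show ?thesis by blast
qed

subsection \<open>The ordinary differential equation\<close>

text \<open>The combination \<open>z = y'' + \<rho>^2 y\<close> satisfies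
  \<open>\<tau> z' + z = 0\<close>, so it decays exponentially from \<open>c + \<rho>^2 a\<close>.
  Subtracting a particular solution of \<open>y'' + \<rho>^2 y = z\<close> leaves a free harmonic
  oscillator, solved through two conserved quantities instead of a uniqueness theorem.\<close>

lemma mgt_ode_solution:
  assumes ode: "mgt_ode \<tau> \<rho> a b c y" and \<tau>: "\<tau> > 0" and \<rho>: "\<rho> > 0" and t: "t \<ge> 0"
  defines "A \<equiv> (\<tau>\<^sup>2 / (1 + \<tau>\<^sup>2 * \<rho>\<^sup>2)) *\<^sub>R (c + \<rho>\<^sup>2 *\<^sub>R a)"
  shows "y t = exp (- t / \<tau>) *\<^sub>R A + cos (\<rho> * t) *\<^sub>R (a - A) + (sin (\<rho> * t) / \<rho>) *\<^sub>R (b + (1 / \<tau>) *\<^sub>R A)"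
proof -
  obtain y' y'' y''' where
    d0: "\<And>t. t \<ge> 0 \<Longrightarrow> (y has_vector_derivative y' t) (at t within {0..})" and
    d1: "\<And>t. t \<ge> 0 \<Longrightarrow> (y' has_vector_derivative y'' t) (at t within {0..})" and
    d2: "\<And>t. t \<ge> 0 \<Longrightarrow> (y'' has_vector_derivative y''' t) (at t within {0..})" and
    eq: "\<And>t. t \<ge> 0 \<Longrightarrow> \<tau> *\<^sub>R y''' t + y'' t + (\<tau> * \<rho>\<^sup>2) *\<^sub>R y' t + \<rho>\<^sup>2 *\<^sub>R y t = 0" and
    i: "y 0 = a" "y' 0 = b" "y'' 0 = c"
    using ode unfolding mgt_ode_def by metis
  have const: "f t = f 0" if "\<And>s. s \<ge> 0 \<Longrightarrow> (f has_vector_derivative 0) (at s within {0..})" "t \<ge> 0"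
    for f :: "real \<Rightarrow> complex" and t
    using has_vector_derivative_zero_constant[of "{0::real..}" f] that
    by (metis atLeast_iff convex_real_interval(1) order_refl)
  let ?z = "\<lambda>t. y'' t + \<rho>\<^sup>2 *\<^sub>R y t"
  have z: "?z t = exp (- t / \<tau>) *\<^sub>R (c + \<rho>\<^sup>2 *\<^sub>R a)" if t: "t \<ge> 0" for t
  proof -
    have dz: "((\<lambda>t. exp (t / \<tau>) *\<^sub>R ?z t) has_vector_derivative 0) (at s within {0..})" if s: "s \<ge> 0" for s
    proof -
      have "((\<lambda>t. exp (t / \<tau>) *\<^sub>R ?z t) has_vector_derivative
         exp (s / \<tau>) *\<^sub>R (y''' s + \<rho>\<^sup>2 *\<^sub>R y' s) + (exp (s / \<tau>) / \<tau>) *\<^sub>R ?z s) (at s within {0..})"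
        using \<tau> by (auto intro!: derivative_eq_intros d0[OF s] d2[OF s])
      moreover have "exp (s / \<tau>) *\<^sub>R (y''' s + \<rho>\<^sup>2 *\<^sub>R y' s) + (exp (s / \<tau>) / \<tau>) *\<^sub>R ?z s =
          (exp (s / \<tau>) / \<tau>) *\<^sub>R (\<tau> *\<^sub>R y''' s + y'' s + (\<tau> * \<rho>\<^sup>2) *\<^sub>R y' s + \<rho>\<^sup>2 *\<^sub>R y s)"
        using \<tau> by (simp add: scaleR_add_right)
      ultimately show ?thesis using eq[OF s] by simp
    qed
    have "exp (t / \<tau>) *\<^sub>R ?z t = c + \<rho>\<^sup>2 *\<^sub>R a"
      using const[of "\<lambda>t. exp (t / \<tau>) *\<^sub>R ?z t", OF dz t] i by simp
    then have "exp (- t / \<tau>) *\<^sub>R (exp (t / \<tau>) *\<^sub>R ?z t) = exp (- t / \<tau>) *\<^sub>R (c + \<rho>\<^sup>2 *\<^sub>R a)" by simp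
    then show ?thesis by (simp add: exp_add[symmetric])
  qed
  let ?p = "\<lambda>t. y t - exp (- t / \<tau>) *\<^sub>R A"
  let ?p' = "\<lambda>t. y' t + (exp (- t / \<tau>) / \<tau>) *\<^sub>R A"
  let ?p'' = "\<lambda>t. y'' t - (exp (- t / \<tau>) / \<tau>\<^sup>2) *\<^sub>R A"
  have pos: "1 + \<tau>\<^sup>2 * \<rho>\<^sup>2 > 0"
    by (simp add: add_pos_nonneg)
  \<comment> \<open>This equation is the origin of \<open>A\<close>: it makes
    \<open>exp (- t / \<tau>)\<close> times \<open>A\<close> the particular solution to
    subtract.\<close>
  have kA: "(1 / \<tau>\<^sup>2 + \<rho>\<^sup>2) *\<^sub>R A = c + \<rho>\<^sup>2 *\<^sub>R a"
  proof -
    have "(1 / \<tau>\<^sup>2 + \<rho>\<^sup>2) * (\<tau>\<^sup>2 / (1 + \<tau>\<^sup>2 * \<rho>\<^sup>2)) = 1"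
    proof -
      have "1 / \<tau>\<^sup>2 + \<rho>\<^sup>2 = (1 + \<tau>\<^sup>2 * \<rho>\<^sup>2) / \<tau>\<^sup>2"
        using \<tau> by (simp add: field_simps)
      then show ?thesis using \<tau> pos by simp
    qed
    then show ?thesis by (simp only: A_def scaleR_scaleR scaleR_one)
  qed
  have p: "?p'' s = - (\<rho>\<^sup>2 *\<^sub>R ?p s)" if "s \<ge> 0" for s
  proof -
    have "?p'' s + \<rho>\<^sup>2 *\<^sub>R ?p s = ?z s - exp (- s / \<tau>) *\<^sub>R ((1 / \<tau>\<^sup>2 + \<rho>\<^sup>2) *\<^sub>R A)"
      by (simp add: algebra_simps)
    also have "\<dots> = 0" unfolding kA using z[OF that] by simp
    finally show ?thesis by (simp add: eq_neg_iff_add_eq_0)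
  qed
  have dp: "(?p has_vector_derivative ?p' s) (at s within {0..})"
    "(?p' has_vector_derivative - (\<rho>\<^sup>2 *\<^sub>R ?p s)) (at s within {0..})" if s: "s \<ge> 0" for s
  proof -
    show "(?p has_vector_derivative ?p' s) (at s within {0..})"
      using \<tau> by (auto intro!: derivative_eq_intros d0[OF s])
    have "(?p' has_vector_derivative ?p'' s) (at s within {0..})"
      using \<tau> by (auto intro!: derivative_eq_intros d1[OF s] simp: power2_eq_square)
    then show "(?p' has_vector_derivative - (\<rho>\<^sup>2 *\<^sub>R ?p s)) (at s within {0..})"
      unfolding p[OF s] .
  qed
  \<comment> \<open>Rotating position and scaled velocity back by the angle
    \<open>\<rho> * t\<close> recovers their values at time \<open>0\<close>. Hence
    \<open>?E\<close> and \<open>?G\<close> are constant, and rotating forward again yields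
    \<open>?p t\<close>.\<close>
  let ?E = "\<lambda>t. cos (\<rho> * t) *\<^sub>R ?p t - (sin (\<rho> * t) / \<rho>) *\<^sub>R ?p' t"
  let ?G = "\<lambda>t. sin (\<rho> * t) *\<^sub>R ?p t + (cos (\<rho> * t) / \<rho>) *\<^sub>R ?p' t"
  have E: "?E t = ?E 0"
  proof (rule const[OF _ t])
    fix s :: real assume s: "s \<ge> 0"
    have "(?E has_vector_derivative
       (cos (\<rho> * s) *\<^sub>R ?p' s + (- sin (\<rho> * s) * \<rho>) *\<^sub>R ?p s)
       - ((sin (\<rho> * s) / \<rho>) *\<^sub>R (- (\<rho>\<^sup>2 *\<^sub>R ?p s)) + (cos (\<rho> * s) * \<rho> / \<rho>) *\<^sub>R ?p' s)) (at s within {0..})"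
      by (intro has_vector_derivative_diff has_vector_derivative_scaleR dp[OF s]) (use \<rho> in \<open>auto intro!: derivative_eq_intros\<close>)
    then show "(?E has_vector_derivative 0) (at s within {0..})"
      using \<rho> by (simp add: power2_eq_square scaleR_minus_right del: scaleR_right_diff_distrib scaleR_add_right)
  qed
  have G: "?G t = ?G 0"
  proof (rule const[OF _ t])
    fix s :: real assume s: "s \<ge> 0"
    have "(?G has_vector_derivative
       (sin (\<rho> * s) *\<^sub>R ?p' s + (cos (\<rho> * s) * \<rho>) *\<^sub>R ?p s)
       + ((cos (\<rho> * s) / \<rho>) *\<^sub>R (- (\<rho>\<^sup>2 *\<^sub>R ?p s)) + (- sin (\<rho> * s) * \<rho> / \<rho>) *\<^sub>R ?p' s)) (at s within {0..})"
      by (intro has_vector_derivative_add has_vector_derivative_scaleR dp[OF s]) (use \<rho> in \<open>auto intro!: derivative_eq_intros\<close>)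
    then show "(?G has_vector_derivative 0) (at s within {0..})"
      using \<rho> by (simp add: power2_eq_square scaleR_minus_right del: scaleR_right_diff_distrib scaleR_add_right)
  qed
  have "cos (\<rho> * t) *\<^sub>R ?E t + sin (\<rho> * t) *\<^sub>R ?G t =
      ((cos (\<rho> * t))\<^sup>2 + (sin (\<rho> * t))\<^sup>2) *\<^sub>R ?p t"
  proof -
    have "C *\<^sub>R (C *\<^sub>R P - (S / \<rho>) *\<^sub>R Q) + S *\<^sub>R (S *\<^sub>R P + (C / \<rho>) *\<^sub>R Q) = (C\<^sup>2 + S\<^sup>2) *\<^sub>R P"
      for C S :: real and P Q :: complex
      by (simp add: algebra_simps power2_eq_square)
    then show ?thesis .
  qed
  then have "?p t = cos (\<rho> * t) *\<^sub>R ?E t + sin (\<rho> * t) *\<^sub>R ?G t" by simp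
  also have "\<dots> = cos (\<rho> * t) *\<^sub>R (a - A) + (sin (\<rho> * t) / \<rho>) *\<^sub>R (b + (1 / \<tau>) *\<^sub>R A)"
    unfolding E G using i by simp
  finally show ?thesis by (simp add: algebra_simps)
qed

text \<open>In the explicit solution only the sine term contains \<open>1/\<rho>\<close>. Replacing
  \<open>(1/\<tau>) A\<close> there by \<open>\<tau> c\<close> costs a term with a spare factor
  \<open>\<rho>^2\<close>, which cancels the singularity. The remainder involves \<open>a\<close>
  and \<open>c\<close> but not \<open>b\<close>, for which no bound is available without the
  weight.\<close>

lemma mgt_ode_wave_part:
  assumes ode: "mgt_ode \<tau> \<rho> a b c y" and \<tau>: "\<tau> > 0" and \<rho>: "\<rho> > 0" and t: "t \<ge> 0"
  shows "norm (y t - (sin (\<rho> * t) / \<rho>) *\<^sub>R (b + \<tau> *\<^sub>R c)) \<le> 4 * norm a + 3 * \<tau>\<^sup>2 * norm c"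
proof -
  define D where "D = 1 + \<tau>\<^sup>2 * \<rho>\<^sup>2"
  have D: "D > 0" "D \<ge> 1" "\<tau>\<^sup>2 * \<rho>\<^sup>2 \<le> D" unfolding D_def by (auto simp: add_pos_nonneg)
  define A where "A = (\<tau>\<^sup>2 / D) *\<^sub>R (c + \<rho>\<^sup>2 *\<^sub>R a)"
  have nA: "norm A \<le> \<tau>\<^sup>2 * norm c + norm a"
  proof -
    have "norm A \<le> (\<tau>\<^sup>2 / D) * (norm c + \<rho>\<^sup>2 * norm a)"
      unfolding A_def using D norm_triangle_ineq[of c "\<rho>\<^sup>2 *\<^sub>R a"] by (simp add: mult_left_mono divide_right_mono)
    also have "\<dots> = (\<tau>\<^sup>2 / D) * norm c + (\<tau>\<^sup>2 * \<rho>\<^sup>2 / D) * norm a" by (simp add: algebra_simps)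
    also have "\<dots> \<le> \<tau>\<^sup>2 * norm c + 1 * norm a"
      using D by (intro add_mono mult_right_mono) (auto simp: divide_simps mult_left_mono mult_le_cancel_left1)
    finally show ?thesis by simp
  qed
  have sp: "(sin (\<rho> * t) / \<rho>) *\<^sub>R (b + (1 / \<tau>) *\<^sub>R A) =
     (sin (\<rho> * t) / \<rho>) *\<^sub>R (b + \<tau> *\<^sub>R c) + (sin (\<rho> * t) * (\<tau> * \<rho> / D)) *\<^sub>R (a - \<tau>\<^sup>2 *\<^sub>R c)"
  proof -
    have "(1 / \<tau>) *\<^sub>R A = (\<tau> / D) *\<^sub>R c + (\<tau> * \<rho>\<^sup>2 / D) *\<^sub>R a"
      unfolding A_def using \<tau> by (simp add: algebra_simps power2_eq_square)
    moreover have "\<tau> / D = \<tau> - \<tau> * \<rho>\<^sup>2 * \<tau>\<^sup>2 / D"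
      using D(1) by (simp add: D_def field_simps)
    ultimately have "b + (1 / \<tau>) *\<^sub>R A = (b + \<tau> *\<^sub>R c) + (\<tau> * \<rho>\<^sup>2 / D) *\<^sub>R (a - \<tau>\<^sup>2 *\<^sub>R c)"
      by (simp add: algebra_simps)
    then show ?thesis using \<rho> by (simp add: scaleR_add_right power2_eq_square)
  qed
  \<comment> \<open>AM-GM for \<open>1\<close> and \<open>\<tau> * \<rho>\<close>; this makes the
    remaining coefficient uniform in frequency, at the high end as well.\<close>
  have q: "\<tau> * \<rho> / D \<le> 1/2"
    using zero_le_power2[of "1 - \<tau> * \<rho>"] D(1) by (simp add: D_def power2_diff power_mult_distrib divide_simps)
  have q0: "\<tau> * \<rho> / D \<ge> 0" using \<tau> \<rho> D by simp
  have "y t - (sin (\<rho> * t) / \<rho>) *\<^sub>R (b + \<tau> *\<^sub>R c) =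
     exp (- t / \<tau>) *\<^sub>R A + cos (\<rho> * t) *\<^sub>R (a - A) + (sin (\<rho> * t) * (\<tau> * \<rho> / D)) *\<^sub>R (a - \<tau>\<^sup>2 *\<^sub>R c)"
    using mgt_ode_solution[OF ode \<tau> \<rho> t, folded D_def, folded A_def] sp by simp
  also have "norm \<dots> \<le> norm (exp (- t / \<tau>) *\<^sub>R A) + norm (cos (\<rho> * t) *\<^sub>R (a - A))
      + norm ((sin (\<rho> * t) * (\<tau> * \<rho> / D)) *\<^sub>R (a - \<tau>\<^sup>2 *\<^sub>R c))"
    by (intro norm_triangle_le add_mono order_refl)
  also have "\<dots> \<le> 1 * norm A + 1 * (norm a + norm A) + 1/2 * (norm a + \<tau>\<^sup>2 * norm c)"
  proof (intro add_mono)
    show "norm (exp (- t / \<tau>) *\<^sub>R A) \<le> 1 * norm A"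
      using t \<tau> by (simp add: mult_left_le_one_le)
    show "norm (cos (\<rho> * t) *\<^sub>R (a - A)) \<le> 1 * (norm a + norm A)"
      unfolding norm_scaleR by (intro mult_mono norm_triangle_ineq4) auto
    have "\<bar>sin (\<rho> * t) * (\<tau> * \<rho> / D)\<bar> = \<bar>sin (\<rho> * t)\<bar> * (\<tau> * \<rho> / D)"
      using q0 by (simp only: abs_mult abs_of_nonneg)
    also have "\<dots> \<le> 1 * (1/2)" using q q0 by (intro mult_mono) auto
    finally have "\<bar>sin (\<rho> * t) * (\<tau> * \<rho> / D)\<bar> \<le> 1/2" by simp
    moreover have "norm (a - \<tau>\<^sup>2 *\<^sub>R c) \<le> norm a + \<tau>\<^sup>2 * norm c"
      using norm_triangle_ineq4[of a "\<tau>\<^sup>2 *\<^sub>R c"] by simp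
    ultimately show "norm ((sin (\<rho> * t) * (\<tau> * \<rho> / D)) *\<^sub>R (a - \<tau>\<^sup>2 *\<^sub>R c)) \<le> 1/2 * (norm a + \<tau>\<^sup>2 * norm c)"
      unfolding norm_scaleR by (intro mult_mono) auto
  qed
  \<comment> \<open>Inserting \<open>nA\<close> gives the coefficients 7/2 and 5/2, rounded
    up.\<close>
  also have "\<dots> \<le> 4 * norm a + 3 * \<tau>\<^sup>2 * norm c"
    using nA norm_ge_zero[of a] mult_nonneg_nonneg[OF zero_le_power2[of \<tau>] norm_ge_zero[of c]] by argo
  finally show ?thesis .
qed

subsection \<open>Power integrals with oscillation\<close>

lemma one_divide_powr:
  fixes t :: real
  assumes "t > 0"
  shows "(1 / t) powr q = t powr (- q)"
  using assms by (simp add: powr_divide powr_minus_divide)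

text \<open>Over one doubling a power falls by at most the factor
  \<open>2 powr \<bar>p\<bar>\<close>, for either sign of \<open>p\<close>. This yields lower bounds
  without antiderivatives and controls the effect of a shift.\<close>

lemma powr_ge_of_le_double:
  fixes p :: real
  assumes "0 < a" "a \<le> r" "r \<le> 2 * a"
  shows "2 powr (- \<bar>p\<bar>) * a powr p \<le> r powr p"
proof -
  define x where "x = r / a"
  have x: "1 \<le> x" "x \<le> 2" "r = x * a" using assms by (auto simp: x_def field_simps)
  have "2 powr (- \<bar>p\<bar>) \<le> x powr (- \<bar>p\<bar>)"
    using x by (intro powr_mono2') auto
  also have "\<dots> \<le> x powr p"
    using x by (intro powr_mono) auto
  finally show ?thesis
    using x assms by (simp add: powr_mult mult_right_mono)
qed

lemma nn_integral_powr_double_ge: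
  fixes p :: real
  assumes a: "0 < a"
  shows "ennreal (2 powr (- \<bar>p\<bar>) * a powr (p + 1)) \<le> (\<integral>\<^sup>+r. ennreal (r powr p) * indicator {a..2 * a} r \<partial>lborel)"
proof -
  have "ennreal (2 powr (- \<bar>p\<bar>) * a powr (p + 1)) = ennreal (2 powr (- \<bar>p\<bar>) * a powr p) * emeasure lborel {a..2 * a}"
    using a by (simp add: powr_add ennreal_mult[symmetric] mult.assoc)
  also have "\<dots> = (\<integral>\<^sup>+r. ennreal (2 powr (- \<bar>p\<bar>) * a powr p) * indicator {a..2 * a} r \<partial>lborel)"
    by (simp add: nn_integral_cmult)
  also have "\<dots> \<le> (\<integral>\<^sup>+r. ennreal (r powr p) * indicator {a..2 * a} r \<partial>lborel)"
    using powr_ge_of_le_double[OF a] by (intro nn_integral_mono) (auto simp: indicator_def intro!: ennreal_leI)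
  finally show ?thesis .
qed

lemma nn_integral_powr_Icc:
  fixes p :: real
  assumes "0 < a" "a \<le> b" "p \<noteq> -1"
  shows "(\<integral>\<^sup>+r. ennreal (r powr p) * indicator {a..b} r \<partial>lborel) = ennreal ((b powr (p + 1) - a powr (p + 1)) / (p + 1))"
proof -
  have "(\<integral>\<^sup>+r. ennreal (r powr p) * indicator {a..b} r \<partial>lborel) = ennreal (b powr (p + 1) / (p + 1) - a powr (p + 1) / (p + 1))"
  proof (rule nn_integral_FTC_Icc)
    fix r assume r: "r \<in> {a..b}"
    have "((\<lambda>x. x powr (p + 1)) has_real_derivative (p + 1) * r powr (p + 1 - 1)) (at r)"
      using assms r by (intro has_real_derivative_powr) auto
    from DERIV_cdivide[OF this, of "p + 1"]
    show "DERIV (\<lambda>x. x powr (p + 1) / (p + 1)) r :> r powr p"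
      using assms by simp
  qed (use assms in auto)
  then show ?thesis by (simp add: diff_divide_distrib)
qed

lemma nn_integral_inverse_Icc:
  fixes a :: real
  assumes "0 < a" "a \<le> b"
  shows "(\<integral>\<^sup>+r. ennreal (r powr (-1)) * indicator {a..b} r \<partial>lborel) = ennreal (ln b - ln a)"
  using assms by (intro nn_integral_FTC_Icc) (auto intro!: derivative_eq_intros simp: powr_minus_divide)

lemma nn_integral_powr_from_0:
  fixes p :: real
  assumes p: "p > -1" and b: "b \<ge> 0"
  shows "(\<integral>\<^sup>+r. ennreal (r powr p) * indicator {0<..b} r \<partial>lborel) = ennreal (b powr (p + 1) / (p + 1))"
proof -
  have "(\<integral>\<^sup>+r. ennreal (r powr p) * indicator {0<..b} r \<partial>lborel) = (\<integral>\<^sup>+r. ennreal (indicator {0..b} r * r powr p) \<partial>lborel)"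
  proof (rule nn_integral_cong)
    fix r :: real
    \<comment> \<open>Since \<open>0 powr p = 0\<close>, the endpoint contributes nothing to the
      closed interval either.\<close>
    show "ennreal (r powr p) * indicator {0<..b} r = ennreal (indicator {0..b} r * r powr p)"
      by (cases "r = 0") (auto simp: indicator_def)
  qed
  also have "\<dots> = ennreal (b powr (p + 1) / (p + 1))"
    using nn_integral_has_integral_lebesgue[OF _ has_integral_powr_from_0[OF p b]] by simp
  finally show ?thesis .
qed

lemma nn_integral_powr_diverges:
  fixes p :: real
  assumes p: "p \<le> -1" and d: "d > 0"
  shows "(\<integral>\<^sup>+r. ennreal (r powr p) * indicator {0<..<d} r \<partial>lborel) = \<infinity>" (is "?I = _")
proof (rule ccontr)
  assume "?I \<noteq> \<infinity>"
  then obtain K where K: "?I = ennreal K" "K \<ge> 0"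
    by (metis ennreal_cases infinity_ennreal_def)
  \<comment> \<open>With \<open>b <= 1\<close> the integrand dominates \<open>1/r\<close> on the
    chosen interval. The ratio \<open>b / a = exp (K + 1)\<close> makes the logarithmic integral
    \<open>K + 1\<close>, which exceeds the supposed value \<open>K\<close> of the whole.\<close>
  define b where "b = min 1 (d / 2)"
  define a where "a = b * exp (- (K + 1))"
  have b: "0 < b" "b \<le> 1" "b < d" using d by (auto simp: b_def)
  have ab: "0 < a" "a \<le> b" using b K by (auto simp: a_def)
  have "ln b - ln a = K + 1" using b by (simp add: a_def ln_mult)
  then have "ennreal (K + 1) = (\<integral>\<^sup>+r. ennreal (r powr (-1)) * indicator {a..b} r \<partial>lborel)"
    using nn_integral_inverse_Icc[OF ab] by simp
  also have "\<dots> \<le> ?I"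
  proof (rule nn_integral_mono)
    fix r :: real
    show "ennreal (r powr (-1)) * indicator {a..b} r \<le> ennreal (r powr p) * indicator {0<..<d} r"
    proof (cases "r \<in> {a..b}")
      case True
      then have "r powr (-1) \<le> r powr p"
        using p ab b by (intro powr_mono') auto
      then show ?thesis using True ab b by (simp add: ennreal_leI)
    qed auto
  qed
  finally show False using K by (simp add: ennreal_le_iff)
qed

text \<open>The order of the integral of \<open>r powr p\<close> from \<open>1/t\<close> to
  \<open>1\<close> for large \<open>t\<close>. With \<open>p = n - 3 - 2 s\<close> the case
  \<open>p < -1\<close> is \<open>n < 2 + 2 s\<close>, and the value is the square of
  \<open>mgt_rate\<close>.\<close>

definition power_rate :: "real \<Rightarrow> real \<Rightarrow> real" where
  "power_rate p t = (if p < -1 then t powr (- (p + 1)) else if p = -1 then ln t else 1)"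

text \<open>From \<open>exp 1\<close> on also the logarithmic rate is at least \<open>1\<close>, so
  bounded contributions can be absorbed in all three cases; this is the origin of the time
  threshold.\<close>

lemma mgt_rate_sq:
  assumes "t \<ge> exp 1"
  shows "(mgt_rate n s t)\<^sup>2 = power_rate (real n - 3 - 2 * s) t"
    and "mgt_rate n s t \<ge> 1"
proof -
  have t: "t > 0" "t \<ge> 1" "ln t \<ge> 1"
    using assms less_le_trans[OF exp_gt_zero assms] exp_ge_add_one_self[of 1] by (auto simp: ln_ge_iff)
  have "(t powr (1 + s - real n / 2))\<^sup>2 = t powr (- (real n - 3 - 2 * s + 1))"
  proof -
    have "1 + s - real n / 2 + (1 + s - real n / 2) = - (real n - 3 - 2 * s + 1)" by simp
    then show ?thesis by (simp only: power2_eq_square powr_add[symmetric])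
  qed
  then show "(mgt_rate n s t)\<^sup>2 = power_rate (real n - 3 - 2 * s) t"
    unfolding mgt_rate_def power_rate_def using t by (auto simp: not_less)
  show "mgt_rate n s t \<ge> 1"
    unfolding mgt_rate_def using t by (auto intro!: ge_one_powr_ge_zero)
qed

text \<open>The integral is split at \<open>r = 1/t\<close>. Below,
  \<open>|sin (r t)| <= r t\<close> adds two powers of \<open>r\<close>, integrable at
  \<open>0\<close> exactly because \<open>p > -3\<close>; above, the sine is bounded by
  \<open>1\<close>. The two summands of \<open>C\<close> pay for these two ranges.\<close>

lemma sin_sq_integral_upper:
  fixes p :: real
  assumes p: "p > -3"
  shows "\<exists>C>0. \<forall>t\<ge>exp 1. (\<integral>\<^sup>+r. ennreal (r powr p * (sin (r * t))\<^sup>2) * indicator {0<..1} r \<partial>lborel) \<le> ennreal (C * power_rate p t)"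
proof -
  define C where "C = 1 / (p + 3) + (if p = -1 then 1 else 1 / \<bar>p + 1\<bar>)"
  have "1 / (p + 3) > 0" "(if p = -1 then 1 else 1 / \<bar>p + 1\<bar>) > 0" using p by auto
  then have C: "C > 0" unfolding C_def by linarith
  have "(\<integral>\<^sup>+r. ennreal (r powr p * (sin (r * t))\<^sup>2) * indicator {0<..1} r \<partial>lborel) \<le> ennreal (C * power_rate p t)"
    if t: "t \<ge> exp 1" for t
  proof -
    have t: "t > 0" "t \<ge> 1" "ln t \<ge> 1"
      using t less_le_trans[OF exp_gt_zero t] exp_ge_add_one_self[of 1] by (auto simp: ln_ge_iff)
    have "(\<integral>\<^sup>+r. ennreal (r powr p * (sin (r * t))\<^sup>2) * indicator {0<..1} r \<partial>lborel) \<le>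
      (\<integral>\<^sup>+r. ennreal (t\<^sup>2) * (ennreal (r powr (p + 2)) * indicator {0<..1/t} r) + ennreal (r powr p) * indicator {1/t..1} r \<partial>lborel)"
    proof (rule nn_integral_mono)
      fix r :: real
      show "ennreal (r powr p * (sin (r * t))\<^sup>2) * indicator {0<..1} r \<le>
        ennreal (t\<^sup>2) * (ennreal (r powr (p + 2)) * indicator {0<..1/t} r) + ennreal (r powr p) * indicator {1/t..1} r"
      proof (cases "0 < r \<and> r \<le> 1")
        case r: True
        show ?thesis
        proof (cases "r \<le> 1/t")
          case True
          have "\<bar>sin (r * t)\<bar> \<le> \<bar>r * t\<bar>" by (rule abs_sin_x_le_abs_x)
          then have "(sin (r * t))\<^sup>2 \<le> (r * t)\<^sup>2" by (rule abs_le_square_iff[THEN iffD1])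
          then have "r powr p * (sin (r * t))\<^sup>2 \<le> r powr p * (r * t)\<^sup>2" by (intro mult_left_mono) auto
          also have "\<dots> = t\<^sup>2 * r powr (p + 2)" using r by (simp add: powr_add powr_numeral power_mult_distrib)
          finally have "ennreal (r powr p * (sin (r * t))\<^sup>2) \<le> ennreal (t\<^sup>2) * ennreal (r powr (p + 2))"
            by (simp add: ennreal_mult[symmetric] ennreal_leI)
          then show ?thesis using r True by (simp add: add_increasing2)
        next
          case False
          have "r powr p * (sin (r * t))\<^sup>2 \<le> r powr p * 1"
            by (intro mult_left_mono) (auto simp: abs_square_le_1)
          then show ?thesis using r False by (simp add: ennreal_leI)
        qed
      qed auto
    qed
    also have "\<dots> = ennreal (t\<^sup>2) * ennreal ((1/t) powr (p + 3) / (p + 3)) + (\<integral>\<^sup>+r. ennreal (r powr p) * indicator {1/t..1} r \<partial>lborel)"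
    proof -
      have "(\<integral>\<^sup>+r. ennreal (r powr (p + 2)) * indicator {0<..1/t} r \<partial>lborel) = ennreal ((1/t) powr (p + 3) / (p + 3))"
        using nn_integral_powr_from_0[of "p + 2" "1/t"] p t by (simp add: add.assoc)
      then show ?thesis by (subst nn_integral_add) (auto simp: nn_integral_cmult)
    qed
    also have "ennreal (t\<^sup>2) * ennreal ((1/t) powr (p + 3) / (p + 3)) \<le> ennreal (1 / (p + 3) * power_rate p t)"
    proof -
      have "t\<^sup>2 * (1/t) powr (p + 3) = t powr 2 * t powr (- (p + 3))"
        using t by (simp only: one_divide_powr powr_numeral)
      also have "\<dots> = t powr (- (p + 1))"
        by (simp add: powr_add[symmetric] algebra_simps)
      also have "\<dots> \<le> power_rate p t"
      proof (cases "p < -1")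
        case False
        then have "t powr (- (p + 1)) \<le> t powr 0" using t by (intro powr_mono) auto
        then show ?thesis using False t unfolding power_rate_def by auto
      qed (simp add: power_rate_def)
      finally have "t\<^sup>2 * (1/t) powr (p + 3) / (p + 3) \<le> power_rate p t / (p + 3)"
        using p by (intro divide_right_mono) auto
      then show ?thesis using p by (simp add: ennreal_mult[symmetric] ennreal_leI)
    qed
    also have "(\<integral>\<^sup>+r. ennreal (r powr p) * indicator {1/t..1} r \<partial>lborel) \<le> ennreal ((if p = -1 then 1 else 1 / \<bar>p + 1\<bar>) * power_rate p t)"
    proof (cases "p = -1")
      case True
      then show ?thesis using nn_integral_inverse_Icc[of "1/t" 1] t by (simp add: power_rate_def ln_div)
    next
      case False
      have "(1 - (1/t) powr (p + 1)) / (p + 1) \<le> 1 / \<bar>p + 1\<bar> * power_rate p t"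
      proof (cases "p < -1")
        case True
        have "(1/t) powr (p + 1) = t powr (- (p + 1))"
          using t by (simp only: one_divide_powr)
        then show ?thesis using True by (simp add: power_rate_def field_simps)
      next
        case False
        then show ?thesis using \<open>p \<noteq> -1\<close> by (simp add: power_rate_def divide_right_mono)
      qed
      then show ?thesis
        using nn_integral_powr_Icc[of "1/t" 1 p] t False by (simp add: ennreal_leI)
    qed
    also have "ennreal (1 / (p + 3) * power_rate p t) + ennreal ((if p = -1 then 1 else 1 / \<bar>p + 1\<bar>) * power_rate p t) = ennreal (C * power_rate p t)"
      using p t by (subst ennreal_plus[symmetric]) (auto simp: C_def power_rate_def distrib_right)
    finally show ?thesis by (simp add: add_mono)
  qed
  with C show ?thesis by blast
qed

text \<open>A small sine forces \<open>|cos x|\<close> above \<open>sqrt 3 / 2\<close>. In the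
  addition formula the cosine term is then at least 3/4 and the sine term at most 1/4.\<close>

lemma sin_shift_ge_half:
  fixes x :: real
  assumes "\<bar>sin x\<bar> < 1/2"
  shows "\<bar>sin (x + pi / 3)\<bar> \<ge> 1/2"
proof -
  have "(sin x)\<^sup>2 < (1/2)\<^sup>2"
    using assms power2_strict_mono[of "sin x" "1/2"] by simp
  then have "(cos x)\<^sup>2 > (sqrt 3 / 2)\<^sup>2"
    unfolding cos_squared_eq by (simp add: power_divide)
  then have c: "\<bar>cos x\<bar> > sqrt 3 / 2"
    using power2_less_imp_less[of "sqrt 3 / 2" "\<bar>cos x\<bar>"] by simp
  have "\<bar>sin (x + pi / 3)\<bar> = \<bar>sin x * (1/2) + cos x * (sqrt 3 / 2)\<bar>"
    by (simp add: sin_add cos_60 sin_60)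
  also have "\<dots> \<ge> \<bar>cos x * (sqrt 3 / 2)\<bar> - \<bar>sin x * (1/2)\<bar>"
    by linarith
  also have "\<bar>cos x * (sqrt 3 / 2)\<bar> - \<bar>sin x * (1/2)\<bar> = \<bar>cos x\<bar> * (sqrt 3 / 2) - \<bar>sin x\<bar> * (1/2)"
    unfolding abs_mult by simp
  finally have "\<bar>sin (x + pi / 3)\<bar> \<ge> \<bar>cos x\<bar> * (sqrt 3 / 2) - \<bar>sin x\<bar> * (1/2)" .
  moreover have "\<bar>cos x\<bar> * (sqrt 3 / 2) \<ge> (sqrt 3 / 2) * (sqrt 3 / 2)"
    using c by (intro mult_right_mono) auto
  ultimately show ?thesis using assms by simp
qed

text \<open>Where \<open>|sin (r t)| < 1/2\<close>, the point \<open>r + pi / (3 t)\<close> is good, and it is at most twice \<open>r\<close>.\<close>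

lemma sin_ge_half_integral_shift:
  fixes p :: real
  assumes t: "t > 0" and d: "d > 0"
  shows "(\<integral>\<^sup>+r. ennreal (r powr p) * indicator {pi / (3 * t)..d / 3} r \<partial>lborel) \<le>
    ennreal (1 + 2 powr \<bar>p\<bar>) * (\<integral>\<^sup>+r. ennreal (r powr p) * indicator {r. 0 < r \<and> r < d \<and> \<bar>sin (r * t)\<bar> \<ge> 1/2} r \<partial>lborel)"
proof -
  define h where "h = pi / (3 * t)"
  have h: "h > 0" using t by (simp add: h_def)
  define \<phi> where "\<phi> r = ennreal (r powr p) * indicator {r. 0 < r \<and> r < d \<and> \<bar>sin (r * t)\<bar> \<ge> 1/2} r" for r :: real
  have [measurable]: "\<phi> \<in> borel_measurable borel" unfolding \<phi>_def by measurable
  \<comment> \<open>The upper limit keeps the shifted point in range: \<open>h <= r <= d / 3\<close>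
    gives \<open>h + r <= 2 * d / 3 < d\<close>. The form \<open>h + 1 * r\<close> is that of
    \<open>nn_integral_real_affine\<close>.\<close>
  have "(\<integral>\<^sup>+r. ennreal (r powr p) * indicator {h..d / 3} r \<partial>lborel) \<le> (\<integral>\<^sup>+r. \<phi> r + ennreal (2 powr \<bar>p\<bar>) * \<phi> (h + 1 * r) \<partial>lborel)"
  proof (rule nn_integral_mono)
    fix r :: real
    show "ennreal (r powr p) * indicator {h..d / 3} r \<le> \<phi> r + ennreal (2 powr \<bar>p\<bar>) * \<phi> (h + 1 * r)"
    proof (cases "r \<in> {h..d / 3}")
      case r: True
      show ?thesis
      proof (cases "\<bar>sin (r * t)\<bar> \<ge> 1/2")
        case True
        then have "\<phi> r = ennreal (r powr p)" using r h d by (simp add: \<phi>_def)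
        then show ?thesis using r by simp
      next
        case False
        have "h * t = pi / 3" using t by (simp add: h_def)
        then have "(h + r) * t = r * t + pi / 3" by (simp add: distrib_right)
        then have "\<bar>sin ((h + r) * t)\<bar> \<ge> 1/2"
          using sin_shift_ge_half[of "r * t"] False by simp
        then have e: "\<phi> (h + r) = ennreal ((h + r) powr p)" using r h d by (simp add: \<phi>_def)
        have "2 powr (- \<bar>p\<bar>) * r powr p \<le> (h + r) powr p"
          using r h by (intro powr_ge_of_le_double) auto
        then have "2 powr \<bar>p\<bar> * (2 powr (- \<bar>p\<bar>) * r powr p) \<le> 2 powr \<bar>p\<bar> * (h + r) powr p"
          by (intro mult_left_mono) auto
        then have "r powr p \<le> 2 powr \<bar>p\<bar> * (h + r) powr p"
          by (simp add: mult.assoc[symmetric] powr_add[symmetric])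
        then have "ennreal (r powr p) \<le> ennreal (2 powr \<bar>p\<bar>) * \<phi> (h + 1 * r)"
          unfolding mult_1 e by (simp add: ennreal_mult[symmetric] ennreal_leI)
        then show ?thesis using r by (simp add: add_increasing)
      qed
    qed auto
  qed
  also have "\<dots> = (\<integral>\<^sup>+r. \<phi> r \<partial>lborel) + ennreal (2 powr \<bar>p\<bar>) * (\<integral>\<^sup>+r. \<phi> (h + 1 * r) \<partial>lborel)"
    by (subst nn_integral_add) (auto simp: nn_integral_cmult)
  also have "(\<integral>\<^sup>+r. \<phi> (h + 1 * r) \<partial>lborel) = (\<integral>\<^sup>+r. \<phi> r \<partial>lborel)"
    using nn_integral_real_affine[of \<phi> 1 h] by simp
  also have "(\<integral>\<^sup>+r. \<phi> r \<partial>lborel) + ennreal (2 powr \<bar>p\<bar>) * (\<integral>\<^sup>+r. \<phi> r \<partial>lborel) = ennreal (1 + 2 powr \<bar>p\<bar>) * (\<integral>\<^sup>+r. \<phi> r \<partial>lborel)"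
    by (simp add: ennreal_plus distrib_right)
  finally show ?thesis unfolding \<phi>_def h_def .
qed

text \<open>After the shift lemma only the plain power integral from \<open>pi / (3 t)\<close> to
  \<open>d / 3\<close> has to be bounded below. Its bulk lies at the lower end, over all scales, or
  at the upper end, according to the position of \<open>p\<close> relative to
  \<open>-1\<close>.\<close>

lemma sin_ge_half_integral_lower:
  fixes p :: real
  assumes d: "d > 0"
  shows "\<exists>c>0. \<exists>T>0. \<forall>t\<ge>T. ennreal (c * power_rate p t) \<le>
    (\<integral>\<^sup>+r. ennreal (r powr p) * indicator {r. 0 < r \<and> r < d \<and> \<bar>sin (r * t)\<bar> \<ge> 1/2} r \<partial>lborel)"
proof -
  have "\<exists>c>0. \<exists>T>0. \<forall>t\<ge>T. ennreal (c * power_rate p t) \<le> (\<integral>\<^sup>+r. ennreal (r powr p) * indicator {pi / (3 * t)..d / 3} r \<partial>lborel)"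
  proof -
    consider "p < -1" | "p = -1" | "p > -1" by linarith
    then show ?thesis
    proof cases
      case 1
      \<comment> \<open>One doubling from the lower limit already gives the full rate; it fits below
        \<open>d / 3\<close> once \<open>t >= 2 * pi / d\<close>.\<close>
      define c where "c = 2 powr (- \<bar>p\<bar>) * (pi / 3) powr (p + 1)"
      have "ennreal (c * power_rate p t) \<le> (\<integral>\<^sup>+r. ennreal (r powr p) * indicator {pi / (3 * t)..d / 3} r \<partial>lborel)"
        if t: "t \<ge> 2 * pi / d" for t
      proof -
        have "2 * pi / d > 0" using d by simp
        then have t0: "t > 0" using t by linarith
        have le: "2 * (pi / (3 * t)) \<le> d / 3" using t t0 d by (simp add: field_simps)
        have "c * power_rate p t = 2 powr (- \<bar>p\<bar>) * ((pi / 3) powr (p + 1) * t powr (- (p + 1)))"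
          using 1 by (simp add: c_def power_rate_def)
        also have "(pi / 3) powr (p + 1) * t powr (- (p + 1)) = (pi / (3 * t)) powr (p + 1)"
          using t0 powr_mult[of "pi / 3" "1 / t" "p + 1"] by (simp only: one_divide_powr) (simp add: mult.commute)
        finally have "ennreal (c * power_rate p t) \<le> (\<integral>\<^sup>+r. ennreal (r powr p) * indicator {pi / (3 * t)..2 * (pi / (3 * t))} r \<partial>lborel)"
          using nn_integral_powr_double_ge[of "pi / (3 * t)" p] t0 by simp
        also have "\<dots> \<le> (\<integral>\<^sup>+r. ennreal (r powr p) * indicator {pi / (3 * t)..d / 3} r \<partial>lborel)"
          using le by (intro nn_integral_mono) (auto simp: indicator_def)
        finally show ?thesis .
      qed
      moreover have "c > 0" by (simp add: c_def)
      moreover have "2 * pi / d > 0" using d by simp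
      ultimately show ?thesis by blast
    next
      case 2
      \<comment> \<open>The integral equals \<open>ln t - ln (pi / d)\<close>. For
        \<open>t >= (pi / d)^2\<close> the second logarithm costs at most half of
        \<open>ln t\<close>.\<close>
      have "ennreal (1/2 * power_rate p t) \<le> (\<integral>\<^sup>+r. ennreal (r powr p) * indicator {pi / (3 * t)..d / 3} r \<partial>lborel)"
        if t: "t \<ge> max 1 ((pi / d)\<^sup>2)" for t
      proof -
        have t0: "t \<ge> 1" "t > 0" using t by auto
        have "(pi / d)\<^sup>2 \<le> t" using t by simp
        then have "ln ((pi / d)\<^sup>2) \<le> ln t" using d t0 by simp
        then have l: "2 * ln (pi / d) \<le> ln t" using d by (simp add: ln_realpow)
        have "pi / d \<le> sqrt t" using \<open>(pi / d)\<^sup>2 \<le> t\<close> by (simp add: real_le_rsqrt)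
        also have "sqrt t \<le> t" using t0 by (simp add: real_le_lsqrt power2_eq_square)
        finally have "pi / (3 * t) \<le> d / 3" using t0 d by (simp add: field_simps)
        moreover have "ln (d / 3) - ln (pi / (3 * t)) \<ge> 1/2 * ln t"
          using l t0 d by (simp add: ln_div ln_mult)
        ultimately show ?thesis
          using nn_integral_inverse_Icc[of "pi / (3 * t)" "d / 3"] 2 t0 d by (simp add: power_rate_def ennreal_leI)
      qed
      moreover have "(1/2::real) > 0" "max 1 ((pi / d)\<^sup>2) > 0" by auto
      ultimately show ?thesis by blast
    next
      case 3
      \<comment> \<open>The fixed doubling from \<open>d / 6\<close> to \<open>d / 3\<close>
        suffices, as the rate is \<open>1\<close>.\<close>
      define c where "c = 2 powr (- \<bar>p\<bar>) * (d / 6) powr (p + 1)"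
      have "ennreal (c * power_rate p t) \<le> (\<integral>\<^sup>+r. ennreal (r powr p) * indicator {pi / (3 * t)..d / 3} r \<partial>lborel)"
        if t: "t \<ge> 2 * pi / d" for t
      proof -
        have "2 * pi / d > 0" using d by simp
        then have t0: "t > 0" using t by linarith
        have le: "pi / (3 * t) \<le> d / 6" using t t0 d by (simp add: field_simps)
        have "ennreal (c * power_rate p t) \<le> (\<integral>\<^sup>+r. ennreal (r powr p) * indicator {d / 6..2 * (d / 6)} r \<partial>lborel)"
          using nn_integral_powr_double_ge[of "d / 6" p] d 3 by (simp add: c_def power_rate_def)
        also have "\<dots> \<le> (\<integral>\<^sup>+r. ennreal (r powr p) * indicator {pi / (3 * t)..d / 3} r \<partial>lborel)"
          using le by (intro nn_integral_mono) (auto simp: indicator_def)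
        finally show ?thesis .
      qed
      moreover have "c > 0" using d by (simp add: c_def)
      moreover have "2 * pi / d > 0" using d by simp
      ultimately show ?thesis by blast
    qed
  qed
  then obtain c T where c: "c > 0" and T: "T > 0" and *: "\<And>t. t \<ge> T \<Longrightarrow>
      ennreal (c * power_rate p t) \<le> (\<integral>\<^sup>+r. ennreal (r powr p) * indicator {pi / (3 * t)..d / 3} r \<partial>lborel)"
    by blast
  define K where "K = 1 + 2 powr \<bar>p\<bar>"
  have K: "K > 0" by (simp add: K_def add_pos_pos)
  have "ennreal (c / K * power_rate p t) \<le>
    (\<integral>\<^sup>+r. ennreal (r powr p) * indicator {r. 0 < r \<and> r < d \<and> \<bar>sin (r * t)\<bar> \<ge> 1/2} r \<partial>lborel)" (is "_ \<le> ?I")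
    if t: "t \<ge> T" for t
  proof -
    have "ennreal (c * power_rate p t) \<le> ennreal K * ?I"
      using order_trans[OF *[OF t] sin_ge_half_integral_shift[of t d p]] t T d by (simp add: K_def)
    then have "ennreal (1 / K) * ennreal (c * power_rate p t) \<le> ennreal (1 / K) * (ennreal K * ?I)"
      by (intro mult_left_mono) auto
    also have "\<dots> = ?I"
      using K by (simp add: mult.assoc[symmetric] ennreal_mult[symmetric])
    finally show ?thesis using K by (simp add: ennreal_mult'[symmetric])
  qed
  moreover have "c / K > 0" using c K by simp
  ultimately show ?thesis using T by blast
qed

subsection \<open>Estimates for the solution\<close>

lemma borel_measurable_norm_lebesgue:
  assumes "\<phi> \<in> borel_measurable borel"
  shows "(\<lambda>\<xi>::'a::euclidean_space. \<phi> (norm \<xi>)) \<in> borel_measurable lebesgue"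
proof -
  have "(\<lambda>\<xi>::'a. \<phi> (norm \<xi>)) \<in> borel_measurable lborel"
    using assms by measurable
  then show ?thesis by (rule measurable_completion)
qed

lemma nn_integral_radial_powr:
  fixes q :: real
  assumes [measurable]: "\<psi> \<in> borel_measurable borel"
  shows "(\<integral>\<^sup>+\<xi>. ennreal (norm (\<xi>::'a::euclidean_space) powr q) * \<psi> (norm \<xi>) \<partial>lebesgue) =
     ennreal (DIM('a) * unit_ball_vol (real DIM('a))) *
       (\<integral>\<^sup>+r. ennreal (r powr (q + real DIM('a) - 1)) * \<psi> r * indicator {0<..} r \<partial>lborel)"
proof -
  have "ennreal (r powr q) * \<psi> r * ennreal (r ^ (DIM('a) - 1)) * indicator {0<..} r =
      ennreal (r powr (q + real DIM('a) - 1)) * \<psi> r * indicator {0<..} r" for r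
  proof (cases "r > 0")
    case True
    have "r powr (q + real DIM('a) - 1) = r powr q * r powr (real (DIM('a) - 1))"
      unfolding powr_add[symmetric] by (simp add: of_nat_diff Suc_leI algebra_simps)
    then have "ennreal (r powr (q + real DIM('a) - 1)) = ennreal (r powr q) * ennreal (r ^ (DIM('a) - 1))"
      using True powr_realpow[OF True, of "DIM('a) - 1"] by (simp only: ennreal_mult powr_ge_zero zero_le_power less_imp_le)
    then show ?thesis by (simp add: mult_ac)
  qed simp
  then show ?thesis
    using nn_integral_radial[of "\<lambda>r. ennreal (r powr q) * \<psi> r", where 'a='a] by simp
qed

lemma AE_nonzero_lebesgue: "AE \<xi>::'a::euclidean_space in lebesgue. \<xi> \<noteq> 0"
  by (rule AE_completion) (rule AE_lborel_singleton)

lemma L1_norm_eq_ennreal: "f \<in> L1 \<Longrightarrow> L1_norm f = ennreal (enn2real (L1_norm f))"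
  by (simp add: L1_def less_top)

lemma has_fourier_L1_bound:
  assumes "f \<in> L1" "has_fourier f u"
  shows "AE \<xi> in lebesgue. norm (u \<xi>) \<le> enn2real (L1_norm f)"
  using has_fourier_L1_AE[OF assms]
proof eventually_elim
  case (elim \<xi>)
  have "ennreal (norm (u \<xi>)) \<le> ennreal (enn2real (L1_norm f))"
    unfolding elim using norm_fourier_le[OF assms(1)] L1_norm_eq_ennreal[OF assms(1)] by simp
  then show ?case by (simp add: ennreal_le_iff)
qed

lemma has_nabla_L1_bound:
  assumes "h \<in> L1" "has_nabla s u h"
  shows "AE \<xi> in lebesgue. norm \<xi> powr s * norm (u \<xi>) \<le> enn2real (L1_norm h)"
  using has_fourier_L1_bound[of h "\<lambda>\<xi>. complex_of_real (norm \<xi> powr s) * u \<xi>"] assms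
  by (simp add: has_nabla_def norm_mult)

text \<open>Below frequency \<open>1\<close> the sup bound for the transform of \<open>h\<close>
  gives \<open>norm (u \<xi>) <= M * norm \<xi> powr (- s)\<close>, and \<open>J\<close> collects
  the remaining radial integral. Above it \<open>\<bar>m\<bar> <= 1 <= norm \<xi> powr s\<close>, so
  the integrand is bounded by the squared transform of \<open>h\<close> and Plancherel's inequality
  applies.\<close>

lemma L2_sq_multiplier_le:
  fixes u h :: "'a::euclidean_space \<Rightarrow> complex"
  assumes s: "s \<ge> 0" and h1: "h \<in> L1" and h2: "h \<in> L2" and u: "has_nabla s u h"
    and m[measurable]: "m \<in> borel_measurable borel" and m1: "\<And>r. r > 1 \<Longrightarrow> \<bar>m r\<bar> \<le> 1"
    and J: "(\<integral>\<^sup>+\<xi>. ennreal ((m (norm \<xi>))\<^sup>2 * norm (\<xi>::'a) powr (- 2 * s)) * indicator {..1} (norm \<xi>) \<partial>lebesgue) \<le> ennreal J"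
    and J0: "J \<ge> 0"
  shows "L2_sq (\<lambda>\<xi>. m (norm \<xi>) *\<^sub>R u \<xi>) \<le> ennreal (J + 2 * (2 * pi) ^ DIM('a)) * (L2_L1_norm h * L2_L1_norm h)"
proof -
  define M where "M = enn2real (L1_norm h)"
  let ?w = "\<lambda>\<xi>. complex_of_real (norm \<xi> powr s) * u \<xi>"
  let ?k = "\<lambda>\<xi>. ennreal ((m (norm \<xi>))\<^sup>2 * norm (\<xi>::'a) powr (- 2 * s)) * indicator {..1} (norm \<xi>)"
  have um[measurable]: "u \<in> borel_measurable lebesgue" and wf: "has_fourier h ?w"
    using u by (auto simp: has_nabla_def)
  have wm[measurable]: "?w \<in> borel_measurable lebesgue" using wf by (simp add: has_fourier_def)
  have km: "?k \<in> borel_measurable lebesgue"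
    by (rule borel_measurable_norm_lebesgue) measurable
  have "L2_sq (\<lambda>\<xi>. m (norm \<xi>) *\<^sub>R u \<xi>) \<le> (\<integral>\<^sup>+\<xi>. ennreal (M\<^sup>2) * ?k \<xi> + ennreal ((norm (?w \<xi>))\<^sup>2) \<partial>lebesgue)"
    unfolding L2_sq_def
  proof (rule nn_integral_mono_AE)
    show "AE \<xi> in lebesgue. ennreal ((norm (m (norm \<xi>) *\<^sub>R u \<xi>))\<^sup>2) \<le> ennreal (M\<^sup>2) * ?k \<xi> + ennreal ((norm (?w \<xi>))\<^sup>2)"
      using has_nabla_L1_bound[OF h1 u] AE_nonzero_lebesgue
    proof eventually_elim
      case (elim \<xi>)
      define r where "r = norm \<xi>"
      have r: "r > 0" using elim by (simp add: r_def)
      have b: "r powr s * norm (u \<xi>) \<le> M" using elim by (simp add: M_def r_def)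
      show ?case
      proof (cases "r \<le> 1")
        case True
        have "norm (u \<xi>) = r powr (- s) * (r powr s * norm (u \<xi>))"
          using r by (simp add: mult.assoc[symmetric] powr_add[symmetric])
        also have "\<dots> \<le> r powr (- s) * M" using b by (intro mult_left_mono) auto
        finally have "(norm (u \<xi>))\<^sup>2 \<le> (r powr (- s) * M)\<^sup>2" by (intro power_mono) auto
        also have "\<dots> = M\<^sup>2 * r powr (- 2 * s)"
        proof -
          have "r powr (- 2 * s) = r powr (- s) * r powr (- s)" unfolding powr_add[symmetric] by simp
          then show ?thesis by (simp add: power2_eq_square mult_ac)
        qed
        finally have "(m r)\<^sup>2 * (norm (u \<xi>))\<^sup>2 \<le> (m r)\<^sup>2 * (M\<^sup>2 * r powr (- 2 * s))"
          by (intro mult_left_mono) auto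
        then have "(norm (m r *\<^sub>R u \<xi>))\<^sup>2 \<le> M\<^sup>2 * ((m r)\<^sup>2 * r powr (- 2 * s))"
          by (simp add: power_mult_distrib mult_ac)
        then have "ennreal ((norm (m r *\<^sub>R u \<xi>))\<^sup>2) \<le> ennreal (M\<^sup>2) * ?k \<xi>"
          using True by (simp add: ennreal_mult[symmetric] ennreal_leI r_def[symmetric])
        then show ?thesis unfolding r_def by (simp add: add_increasing2)
      next
        case False
        then have rs: "r powr s \<ge> 1" using s by (intro ge_one_powr_ge_zero) auto
        have "norm (m r *\<^sub>R u \<xi>) \<le> 1 * norm (u \<xi>)"
          using m1[of r] False unfolding norm_scaleR by (intro mult_right_mono) auto
        also have "\<dots> \<le> r powr s * norm (u \<xi>)" using rs by (intro mult_right_mono) auto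
        also have "\<dots> = norm (?w \<xi>)" by (simp add: norm_mult r_def)
        finally have "(norm (m r *\<^sub>R u \<xi>))\<^sup>2 \<le> (norm (?w \<xi>))\<^sup>2" by (intro power_mono) auto
        then show ?thesis unfolding r_def by (intro add_increasing ennreal_leI) auto
      qed
    qed
  qed
  also have "\<dots> = ennreal (M\<^sup>2) * (\<integral>\<^sup>+\<xi>. ?k \<xi> \<partial>lebesgue) + L2_sq ?w"
    unfolding L2_sq_def using km by (subst nn_integral_add) (auto simp: nn_integral_cmult)
  also have "\<dots> \<le> ennreal (M\<^sup>2) * ennreal J + 2 * ennreal ((2 * pi) ^ DIM('a)) * L2_sq h"
    by (intro add_mono mult_left_mono J has_fourier_L2_sq_le[OF h2 wf]) auto
  also have "\<dots> \<le> ennreal J * (L2_L1_norm h * L2_L1_norm h) + 2 * ennreal ((2 * pi) ^ DIM('a)) * (L2_L1_norm h * L2_L1_norm h)"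
  proof (intro add_mono mult_left_mono)
    have "ennreal (M\<^sup>2) = L1_norm h * L1_norm h"
      using L1_norm_eq_ennreal[OF h1] by (simp add: M_def power2_eq_square ennreal_mult)
    then have "ennreal (M\<^sup>2) \<le> L2_L1_norm h * L2_L1_norm h"
      by (simp add: L2_L1_norm_def mult_mono add_increasing)
    then show "ennreal (M\<^sup>2) * ennreal J \<le> ennreal J * (L2_L1_norm h * L2_L1_norm h)"
      by (subst mult.commute) (rule mult_left_mono, auto)
    show "L2_sq h \<le> L2_L1_norm h * L2_L1_norm h"
      unfolding L2_norm_sq[symmetric] L2_L1_norm_def by (intro mult_mono add_increasing2) auto
  qed auto
  also have "\<dots> = (ennreal J + 2 * ennreal ((2 * pi) ^ DIM('a))) * (L2_L1_norm h * L2_L1_norm h)"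
    by (simp only: distrib_right)
  also have "ennreal J + 2 * ennreal ((2 * pi) ^ DIM('a)) = ennreal (J + 2 * (2 * pi) ^ DIM('a))"
    using J0 by (simp add: ennreal_plus ennreal_mult)
  finally show ?thesis .
qed

text \<open>The multiplier is \<open>1\<close>, and \<open>n > 2 s\<close> makes the weight
  integrable on the unit ball. This handles the error term in the third datum, for which the upper
  bound assumes integrability only of its derivative.\<close>

lemma L2_sq_nabla_le:
  assumes s: "s \<ge> 0" and n: "real DIM('a::euclidean_space) > 2 * s"
  shows "\<exists>C>0. \<forall>(u :: 'a \<Rightarrow> complex) h. h \<in> L1 \<and> h \<in> L2 \<and> has_nabla s u h \<longrightarrow>
    L2_sq u \<le> ennreal C * (L2_L1_norm h * L2_L1_norm h)"
proof -
  define \<kappa> where "\<kappa> = DIM('a) * unit_ball_vol (real DIM('a))"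
  have \<kappa>: "\<kappa> \<ge> 0" by (simp add: \<kappa>_def)
  define J where "J = \<kappa> / (real DIM('a) - 2 * s)"
  have J0: "J \<ge> 0" using \<kappa> n by (simp add: J_def)
  have "(\<integral>\<^sup>+\<xi>. ennreal (1\<^sup>2 * norm (\<xi>::'a) powr (- 2 * s)) * indicator {..1} (norm \<xi>) \<partial>lebesgue) =
      ennreal \<kappa> * (\<integral>\<^sup>+r. ennreal (r powr (- 2 * s + real DIM('a) - 1)) * indicator {..1} r * indicator {0<..} r \<partial>lborel)"
    using nn_integral_radial_powr[of "\<lambda>r. indicator {..1} r" "- 2 * s", where 'a='a] by (simp add: \<kappa>_def)
  also have "(\<integral>\<^sup>+r. ennreal (r powr (- 2 * s + real DIM('a) - 1)) * indicator {..1} r * indicator {0<..} r \<partial>lborel) =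
      (\<integral>\<^sup>+r. ennreal (r powr (- 2 * s + real DIM('a) - 1)) * indicator {0<..1} r \<partial>lborel)"
    by (intro nn_integral_cong) (auto simp: indicator_def)
  also have "\<dots> = ennreal (1 / (real DIM('a) - 2 * s))"
    using nn_integral_powr_from_0[of "- 2 * s + real DIM('a) - 1" 1] n by (simp add: algebra_simps)
  also have "ennreal \<kappa> * ennreal (1 / (real DIM('a) - 2 * s)) = ennreal J"
    using \<kappa> n by (simp add: J_def ennreal_mult[symmetric])
  finally have J: "(\<integral>\<^sup>+\<xi>. ennreal (1\<^sup>2 * norm (\<xi>::'a) powr (- 2 * s)) * indicator {..1} (norm \<xi>) \<partial>lebesgue) \<le> ennreal J"
    by simp
  have "L2_sq u \<le> ennreal (J + 2 * (2 * pi) ^ DIM('a)) * (L2_L1_norm h * L2_L1_norm h)"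
    if "h \<in> L1" "h \<in> L2" "has_nabla s u h" for u h :: "'a \<Rightarrow> complex"
    using L2_sq_multiplier_le[OF s that, of "\<lambda>_. 1" J] J J0 by simp
  moreover have "J + 2 * (2 * pi) ^ DIM('a) > 0" using J0 by (simp add: add_nonneg_pos)
  ultimately show ?thesis by blast
qed

text \<open>Time enters the multiplier bound only through the low-frequency integral
  \<open>J\<close>, which is of the order of the squared rate. The constant high-frequency part is
  absorbed because the rate is at least \<open>1\<close>.\<close>

lemma L2_sq_wave_le:
  assumes s: "s \<ge> 0" and n: "real DIM('a::euclidean_space) > 2 * s"
  shows "\<exists>C>0. \<forall>(u :: 'a \<Rightarrow> complex) h t. h \<in> L1 \<and> h \<in> L2 \<and> has_nabla s u h \<and> t \<ge> exp 1 \<longrightarrow>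
    L2_sq (\<lambda>\<xi>. (sin (norm \<xi> * t) / norm \<xi>) *\<^sub>R u \<xi>) \<le>
      ennreal (C * (mgt_rate DIM('a) s t)\<^sup>2) * (L2_L1_norm h * L2_L1_norm h)"
proof -
  define \<kappa> where "\<kappa> = DIM('a) * unit_ball_vol (real DIM('a))"
  have \<kappa>: "\<kappa> \<ge> 0" by (simp add: \<kappa>_def)
  define p where "p = real DIM('a) - 3 - 2 * s"
  have "p > -3" using n by (simp add: p_def)
  then obtain C where C: "C > 0" and up: "\<And>t. t \<ge> exp 1 \<Longrightarrow>
      (\<integral>\<^sup>+r. ennreal (r powr p * (sin (r * t))\<^sup>2) * indicator {0<..1} r \<partial>lborel) \<le> ennreal (C * power_rate p t)"
    using sin_sq_integral_upper by blast
  let ?c = "2 * (2 * pi) ^ DIM('a)"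
  have "L2_sq (\<lambda>\<xi>. (sin (norm \<xi> * t) / norm \<xi>) *\<^sub>R u \<xi>) \<le>
      ennreal ((\<kappa> * C + ?c) * (mgt_rate DIM('a) s t)\<^sup>2) * (L2_L1_norm h * L2_L1_norm h)"
    if h: "h \<in> L1" "h \<in> L2" "has_nabla s u h" and t: "t \<ge> exp 1" for u h :: "'a \<Rightarrow> complex" and t
  proof -
    define R where "R = (mgt_rate DIM('a) s t)\<^sup>2"
    have R: "R = power_rate p t" "R \<ge> 1"
      using mgt_rate_sq[OF t, of "DIM('a)" s] one_le_power[of "mgt_rate DIM('a) s t" 2] by (auto simp: R_def p_def)
    let ?J = "\<kappa> * (C * R)"
    have J0: "?J \<ge> 0" using \<kappa> C R by simp
    let ?m = "\<lambda>r. sin (r * t) / r"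
    have "(\<integral>\<^sup>+\<xi>. ennreal ((?m (norm \<xi>))\<^sup>2 * norm (\<xi>::'a) powr (- 2 * s)) * indicator {..1} (norm \<xi>) \<partial>lebesgue) =
        (\<integral>\<^sup>+\<xi>. ennreal (norm (\<xi>::'a) powr (- 2 * s)) * (ennreal ((?m (norm \<xi>))\<^sup>2) * indicator {..1} (norm \<xi>)) \<partial>lebesgue)"
      by (intro nn_integral_cong) (simp add: ennreal_mult mult_ac)
    also have "\<dots> = ennreal \<kappa> * (\<integral>\<^sup>+r. ennreal (r powr (- 2 * s + real DIM('a) - 1)) * (ennreal ((?m r)\<^sup>2) * indicator {..1} r) * indicator {0<..} r \<partial>lborel)"
      using nn_integral_radial_powr[of "\<lambda>r. ennreal ((?m r)\<^sup>2) * indicator {..1} r" "- 2 * s", where 'a='a] by (simp add: \<kappa>_def)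
    also have "(\<integral>\<^sup>+r. ennreal (r powr (- 2 * s + real DIM('a) - 1)) * (ennreal ((?m r)\<^sup>2) * indicator {..1} r) * indicator {0<..} r \<partial>lborel) =
        (\<integral>\<^sup>+r. ennreal (r powr p * (sin (r * t))\<^sup>2) * indicator {0<..1} r \<partial>lborel)"
    proof (rule nn_integral_cong)
      fix r :: real
      show "ennreal (r powr (- 2 * s + real DIM('a) - 1)) * (ennreal ((?m r)\<^sup>2) * indicator {..1} r) * indicator {0<..} r =
          ennreal (r powr p * (sin (r * t))\<^sup>2) * indicator {0<..1} r"
      proof (cases "0 < r \<and> r \<le> 1")
        case True
        have "r powr (- 2 * s + real DIM('a) - 1) = r powr p * r powr 2"
          unfolding powr_add[symmetric] by (simp add: p_def algebra_simps)
        then have "r powr (- 2 * s + real DIM('a) - 1) * (?m r)\<^sup>2 = r powr p * (sin (r * t))\<^sup>2"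
          using True by (simp add: power_divide powr_numeral)
        then show ?thesis using True by (simp add: ennreal_mult[symmetric])
      qed auto
    qed
    also have "ennreal \<kappa> * \<dots> \<le> ennreal \<kappa> * ennreal (C * R)"
      unfolding R by (intro mult_left_mono up t) auto
    also have "\<dots> = ennreal ?J" using \<kappa> C R by (simp add: ennreal_mult)
    finally have J: "(\<integral>\<^sup>+\<xi>. ennreal ((?m (norm \<xi>))\<^sup>2 * norm (\<xi>::'a) powr (- 2 * s)) * indicator {..1} (norm \<xi>) \<partial>lebesgue) \<le> ennreal ?J" .
    have m1: "\<bar>?m r\<bar> \<le> 1" if "r > 1" for r
      using that abs_sin_le_one[of "r * t"] by (simp add: abs_divide divide_le_eq del: abs_sin_le_one)
    have "L2_sq (\<lambda>\<xi>. ?m (norm \<xi>) *\<^sub>R u \<xi>) \<le> ennreal (?J + ?c) * (L2_L1_norm h * L2_L1_norm h)"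
      by (rule L2_sq_multiplier_le[OF s h _ m1 J J0]) measurable
    also have "\<dots> \<le> ennreal ((\<kappa> * C + ?c) * R) * (L2_L1_norm h * L2_L1_norm h)"
    proof (intro mult_right_mono ennreal_leI)
      have "?c * 1 \<le> ?c * R" using R(2) by (intro mult_left_mono) auto
      then show "?J + ?c \<le> (\<kappa> * C + ?c) * R" by (simp add: distrib_right mult.assoc)
    qed simp
    finally show ?thesis unfolding R_def .
  qed
  moreover have "\<kappa> * C + ?c > 0" using \<kappa> C by (intro add_nonneg_pos) auto
  ultimately show ?thesis by blast
qed

section \<open>Upper bound for the solution\<close>

lemma ennreal_sqrt_le:
  assumes "x \<le> y * y"
  shows "ennreal_sqrt x \<le> y"
proof (cases "y = \<infinity>")
  case False
  then obtain b where b: "y = ennreal b" "b \<ge> 0" by (metis ennreal_cases infinity_ennreal_def)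
  then have x: "x \<le> ennreal (b * b)" using assms by (simp add: ennreal_mult)
  then obtain a where a: "x = ennreal a" "a \<ge> 0"
    by (metis ennreal_cases ennreal_less_top infinity_ennreal_def leD top.not_eq_extremum)
  then have "a \<le> b * b" using x b by (simp add: ennreal_le_iff)
  then have "sqrt a \<le> b" using b a by (simp add: real_le_lsqrt power2_eq_square)
  then show ?thesis using a b by (simp add: ennreal_sqrt_def ennreal_leI)
qed simp

lemma ennreal_sqrt_ge:
  assumes "ennreal (y * y) \<le> x" "y \<ge> 0"
  shows "ennreal y \<le> ennreal_sqrt x"
proof (cases "x = \<infinity>")
  case False
  then obtain a where a: "x = ennreal a" "a \<ge> 0" by (metis ennreal_cases infinity_ennreal_def)
  then have "y * y \<le> a" using assms by (simp add: ennreal_le_iff)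
  then have "y \<le> sqrt a" by (simp add: real_le_rsqrt power2_eq_square)
  then show ?thesis using a by (simp add: ennreal_sqrt_def ennreal_leI)
qed (simp add: ennreal_sqrt_def)

lemma mgt_solution_wave_part:
  fixes u0 u1 u2 :: "'a::euclidean_space \<Rightarrow> complex"
  assumes "mgt_solution \<tau> u0 u1 u2 v" "\<tau> > 0" "t \<ge> 0"
  shows "AE \<xi> in lebesgue. norm (v t \<xi> - (sin (norm \<xi> * t) / norm \<xi>) *\<^sub>R (u1 \<xi> + \<tau> *\<^sub>R u2 \<xi>))
    \<le> 4 * norm (u0 \<xi>) + 3 * \<tau>\<^sup>2 * norm (u2 \<xi>)"
  using assms(1)[unfolded mgt_solution_def] AE_nonzero_lebesgue
  by eventually_elim (rule mgt_ode_wave_part, use assms in auto)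

text \<open>The second and third data are separated because their norms enter the upper bound
  separately. Cauchy-Schwarz for four summands costs a factor \<open>4\<close>, whence
  \<open>64 = 4 * 4^2\<close> and \<open>36 = 4 * 3^2\<close>.\<close>

lemma L2_sq_mgt_solution_le:
  fixes u0 u1 u2 :: "'a::euclidean_space \<Rightarrow> complex"
  assumes v: "mgt_solution \<tau> u0 u1 u2 v" and \<tau>: "\<tau> > 0" and t: "t \<ge> 0"
    and [measurable]: "u0 \<in> borel_measurable lebesgue" "u1 \<in> borel_measurable lebesgue" "u2 \<in> borel_measurable lebesgue"
  defines "W \<equiv> \<lambda>(u :: 'a \<Rightarrow> complex) \<xi>. (sin (norm \<xi> * t) / norm \<xi>) *\<^sub>R u \<xi>"
  shows "L2_sq (v t) \<le> ennreal 64 * L2_sq u0 + ennreal (36 * \<tau> ^ 4) * L2_sq u2 + ennreal 4 * L2_sq (W u1) + ennreal (4 * \<tau>\<^sup>2) * L2_sq (W u2)"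
proof -
  have m: "(\<lambda>\<xi>::'a. sin (norm \<xi> * t) / norm \<xi>) \<in> borel_measurable lebesgue"
    by (rule borel_measurable_norm_lebesgue[of "\<lambda>r. sin (r * t) / r"]) measurable
  note [measurable] = m
  have [measurable]: "W u1 \<in> borel_measurable lebesgue" "W u2 \<in> borel_measurable lebesgue"
    unfolding W_def by measurable
  let ?R = "\<lambda>\<xi>. ennreal 64 * ennreal ((norm (u0 \<xi>))\<^sup>2) + ennreal (36 * \<tau> ^ 4) * ennreal ((norm (u2 \<xi>))\<^sup>2)
     + ennreal 4 * ennreal ((norm (W u1 \<xi>))\<^sup>2) + ennreal (4 * \<tau>\<^sup>2) * ennreal ((norm (W u2 \<xi>))\<^sup>2)"
  have sq: "(a + b + c + d)\<^sup>2 \<le> 4 * (a\<^sup>2 + b\<^sup>2 + c\<^sup>2 + d\<^sup>2)" for a b c d :: real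
    using zero_le_power2[of "a - b"] zero_le_power2[of "a - c"] zero_le_power2[of "a - d"]
      zero_le_power2[of "b - c"] zero_le_power2[of "b - d"] zero_le_power2[of "c - d"]
    by (simp add: power2_eq_square algebra_simps)
  have "L2_sq (v t) \<le> (\<integral>\<^sup>+\<xi>. ?R \<xi> \<partial>lebesgue)"
    unfolding L2_sq_def
  proof (rule nn_integral_mono_AE)
    show "AE \<xi> in lebesgue. ennreal ((norm (v t \<xi>))\<^sup>2) \<le> ?R \<xi>"
      using mgt_solution_wave_part[OF v \<tau> t]
    proof eventually_elim
      case (elim \<xi>)
      let ?k = "sin (norm \<xi> * t) / norm \<xi>"
      have "?k *\<^sub>R (u1 \<xi> + \<tau> *\<^sub>R u2 \<xi>) = W u1 \<xi> + \<tau> *\<^sub>R W u2 \<xi>"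
        by (simp add: W_def scaleR_add_right mult.commute)
      then have e: "norm (v t \<xi> - (W u1 \<xi> + \<tau> *\<^sub>R W u2 \<xi>)) \<le> 4 * norm (u0 \<xi>) + 3 * \<tau>\<^sup>2 * norm (u2 \<xi>)"
        using elim by simp
      have "norm (v t \<xi>) \<le> norm (v t \<xi> - (W u1 \<xi> + \<tau> *\<^sub>R W u2 \<xi>)) + (norm (W u1 \<xi>) + norm (\<tau> *\<^sub>R W u2 \<xi>))"
        using norm_triangle_sub[of "v t \<xi>" "W u1 \<xi> + \<tau> *\<^sub>R W u2 \<xi>"] norm_triangle_ineq[of "W u1 \<xi>" "\<tau> *\<^sub>R W u2 \<xi>"]
        by simp
      also have "\<dots> \<le> 4 * norm (u0 \<xi>) + 3 * \<tau>\<^sup>2 * norm (u2 \<xi>) + norm (W u1 \<xi>) + \<tau> * norm (W u2 \<xi>)"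
        using e \<tau> by simp
      finally have "(norm (v t \<xi>))\<^sup>2 \<le> (4 * norm (u0 \<xi>) + 3 * \<tau>\<^sup>2 * norm (u2 \<xi>) + norm (W u1 \<xi>) + \<tau> * norm (W u2 \<xi>))\<^sup>2"
        by (intro power_mono) auto
      also have "\<dots> \<le> 4 * ((4 * norm (u0 \<xi>))\<^sup>2 + (3 * \<tau>\<^sup>2 * norm (u2 \<xi>))\<^sup>2 + (norm (W u1 \<xi>))\<^sup>2 + (\<tau> * norm (W u2 \<xi>))\<^sup>2)"
        by (rule sq)
      also have "\<dots> = 64 * (norm (u0 \<xi>))\<^sup>2 + (36 * \<tau> ^ 4) * (norm (u2 \<xi>))\<^sup>2 + 4 * (norm (W u1 \<xi>))\<^sup>2 + (4 * \<tau>\<^sup>2) * (norm (W u2 \<xi>))\<^sup>2"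
        by (simp add: power_mult_distrib power_mult[symmetric])
      finally have "ennreal ((norm (v t \<xi>))\<^sup>2) \<le> ennreal \<dots>" by (rule ennreal_leI)
      also have "\<dots> = ?R \<xi>"
      proof -
        have "ennreal (a * x + b * y + c * z + d * w) = ennreal a * ennreal x + ennreal b * ennreal y + ennreal c * ennreal z + ennreal d * ennreal w"
          if "a \<ge> 0" "b \<ge> 0" "c \<ge> 0" "d \<ge> 0" "x \<ge> 0" "y \<ge> 0" "z \<ge> 0" "w \<ge> 0" for a b c d x y z w
          using that by (simp add: ennreal_plus ennreal_mult)
        then show ?thesis by (meson zero_le_power2 zero_le_numeral zero_le_even_power even_numeral mult_nonneg_nonneg)
      qed
      finally show ?case .
    qed
  qed
  also have "\<dots> = ennreal 64 * L2_sq u0 + ennreal (36 * \<tau> ^ 4) * L2_sq u2 + ennreal 4 * L2_sq (W u1) + ennreal (4 * \<tau>\<^sup>2) * L2_sq (W u2)"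
    unfolding L2_sq_def by (simp add: nn_integral_add nn_integral_cmult)
  finally show ?thesis .
qed

lemma plancherel_norm_mgt_solution_le:
  assumes s: "s \<ge> 0" and \<tau>: "\<tau> > 0" and n: "real DIM('a::euclidean_space) > 2 * s"
  shows "\<exists>C>0. \<forall>(f0 :: 'a \<Rightarrow> complex) h1 h2 u0 u1 u2 v t.
    f0 \<in> L2 \<and> has_fourier f0 u0 \<and> h1 \<in> L2 \<inter> L1 \<and> has_nabla s u1 h1 \<and> h2 \<in> L2 \<inter> L1 \<and> has_nabla s u2 h2 \<and>
    mgt_solution \<tau> u0 u1 u2 v \<and> t \<ge> exp 1 \<longrightarrow>
    plancherel_norm (v t) \<le> ennreal (C * mgt_rate DIM('a) s t) * (L2_norm f0 + L2_L1_norm h1 + L2_L1_norm h2)"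
proof -
  obtain A where A: "A > 0" "\<And>u (h :: 'a \<Rightarrow> complex). h \<in> L1 \<Longrightarrow> h \<in> L2 \<Longrightarrow> has_nabla s u h \<Longrightarrow>
      L2_sq u \<le> ennreal A * (L2_L1_norm h * L2_L1_norm h)"
    using L2_sq_nabla_le[OF s n] by blast
  obtain B where B: "B > 0" "\<And>u (h :: 'a \<Rightarrow> complex) t. h \<in> L1 \<Longrightarrow> h \<in> L2 \<Longrightarrow> has_nabla s u h \<Longrightarrow> t \<ge> exp 1 \<Longrightarrow>
      L2_sq (\<lambda>\<xi>. (sin (norm \<xi> * t) / norm \<xi>) *\<^sub>R u \<xi>) \<le>
      ennreal (B * (mgt_rate DIM('a) s t)\<^sup>2) * (L2_L1_norm h * L2_L1_norm h)"
    using L2_sq_wave_le[OF s n] by blast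
  \<comment> \<open>The coefficients of \<open>L2_sq_mgt_solution_le\<close>, multiplied by the
    Plancherel constant for \<open>u0\<close>, by \<open>A\<close> for \<open>u2\<close> and by
    \<open>B\<close> for the two wave terms.\<close>
  define K where "K = 64 * (2 * (2 * pi) ^ DIM('a)) + 36 * \<tau> ^ 4 * A + 4 * B + 4 * \<tau>\<^sup>2 * B"
  have K: "K > 0" unfolding K_def using A(1) B(1) by (intro add_pos_nonneg) auto
  define q where "q = (2 * pi) powr (- real DIM('a) / 2)"
  have q: "q > 0" by (simp add: q_def)
  have "plancherel_norm (v t) \<le> ennreal (q * sqrt K * mgt_rate DIM('a) s t) * (L2_norm f0 + L2_L1_norm h1 + L2_L1_norm h2)"
    if f0: "f0 \<in> L2" "has_fourier f0 u0" and h1: "h1 \<in> L1" "h1 \<in> L2" "has_nabla s u1 h1"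
      and h2: "h2 \<in> L1" "h2 \<in> L2" "has_nabla s u2 h2" and v: "mgt_solution \<tau> u0 u1 u2 v" and t: "t \<ge> exp 1"
    for f0 h1 h2 u0 u1 u2 :: "'a \<Rightarrow> complex" and v t
  proof -
    define D where "D = mgt_rate DIM('a) s t"
    have D: "D \<ge> 1" unfolding D_def by (rule mgt_rate_sq(2)[OF t])
    then have D2: "D\<^sup>2 \<ge> 1" by (rule one_le_power)
    define X where "X = L2_norm f0 + L2_L1_norm h1 + L2_L1_norm h2"
    have X: "L2_norm f0 \<le> X" "L2_L1_norm h1 \<le> X" "L2_L1_norm h2 \<le> X"
      by (auto simp: X_def add_increasing add_increasing2)
    have t0: "t \<ge> 0" using t by (meson exp_ge_zero order_trans)
    have [measurable]: "u0 \<in> borel_measurable lebesgue" "u1 \<in> borel_measurable lebesgue" "u2 \<in> borel_measurable lebesgue"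
      using f0(2) h1(3) h2(3) by (auto simp: has_fourier_def has_nabla_def)
    have b0: "L2_sq u0 \<le> ennreal (2 * (2 * pi) ^ DIM('a) * D\<^sup>2) * (X * X)"
    proof -
      have "L2_sq u0 \<le> 2 * ennreal ((2 * pi) ^ DIM('a)) * L2_sq f0"
        by (rule has_fourier_L2_sq_le[OF f0])
      also have "\<dots> \<le> ennreal (2 * (2 * pi) ^ DIM('a) * D\<^sup>2) * (X * X)"
      proof (rule mult_mono)
        show "2 * ennreal ((2 * pi) ^ DIM('a)) \<le> ennreal (2 * (2 * pi) ^ DIM('a) * D\<^sup>2)"
          using ennreal_leI[of "2 * (2 * pi) ^ DIM('a) * 1" "2 * (2 * pi) ^ DIM('a) * D\<^sup>2"] D2
          by (simp add: ennreal_mult mult_left_mono)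
        show "L2_sq f0 \<le> X * X" unfolding L2_norm_sq[symmetric] by (intro mult_mono X) auto
      qed auto
      finally show ?thesis .
    qed
    have b2: "L2_sq u2 \<le> ennreal (A * D\<^sup>2) * (X * X)"
    proof -
      have "L2_sq u2 \<le> ennreal A * (L2_L1_norm h2 * L2_L1_norm h2)"
        by (rule A(2)[OF h2])
      also have "\<dots> \<le> ennreal (A * D\<^sup>2) * (X * X)"
        using A(1) D2 by (intro mult_mono X ennreal_leI) auto
      finally show ?thesis .
    qed
    have w1: "L2_sq (\<lambda>\<xi>. (sin (norm \<xi> * t) / norm \<xi>) *\<^sub>R u1 \<xi>) \<le> ennreal (B * D\<^sup>2) * (X * X)"
      using B(2)[OF h1 t] unfolding D_def[symmetric] by (rule order_trans) (intro mult_mono X, auto)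
    have w2: "L2_sq (\<lambda>\<xi>. (sin (norm \<xi> * t) / norm \<xi>) *\<^sub>R u2 \<xi>) \<le> ennreal (B * D\<^sup>2) * (X * X)"
      using B(2)[OF h2 t] unfolding D_def[symmetric] by (rule order_trans) (intro mult_mono X, auto)
    have "L2_sq (v t) \<le> ennreal 64 * L2_sq u0 + ennreal (36 * \<tau> ^ 4) * L2_sq u2
      + ennreal 4 * L2_sq (\<lambda>\<xi>. (sin (norm \<xi> * t) / norm \<xi>) *\<^sub>R u1 \<xi>)
      + ennreal (4 * \<tau>\<^sup>2) * L2_sq (\<lambda>\<xi>. (sin (norm \<xi> * t) / norm \<xi>) *\<^sub>R u2 \<xi>)"
      by (rule L2_sq_mgt_solution_le[OF v \<tau> t0]) measurable
    also have "\<dots> \<le> ennreal 64 * (ennreal (2 * (2 * pi) ^ DIM('a) * D\<^sup>2) * (X * X)) + ennreal (36 * \<tau> ^ 4) * (ennreal (A * D\<^sup>2) * (X * X))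
      + ennreal 4 * (ennreal (B * D\<^sup>2) * (X * X)) + ennreal (4 * \<tau>\<^sup>2) * (ennreal (B * D\<^sup>2) * (X * X))"
      by (intro add_mono mult_left_mono b0 b2 w1 w2) auto
    also have "\<dots> = ennreal (K * D\<^sup>2) * (X * X)"
    proof -
      have "ennreal a * (ennreal (x * d) * Y) + ennreal b * (ennreal (y * d) * Y) + ennreal c * (ennreal (z * d) * Y) + ennreal e * (ennreal (w * d) * Y)
         = ennreal ((a * x + b * y + c * z + e * w) * d) * Y"
        if "a \<ge> 0" "b \<ge> 0" "c \<ge> 0" "d \<ge> 0" "e \<ge> 0" "x \<ge> 0" "y \<ge> 0" "z \<ge> 0" "w \<ge> 0" for a b c d e x y z w Y
        using that by (simp add: ennreal_plus ennreal_mult distrib_right mult.assoc)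
      from this[of 64 "36 * \<tau> ^ 4" 4 "D\<^sup>2" "4 * \<tau>\<^sup>2" "2 * (2 * pi) ^ DIM('a)" A B B "X * X"]
      show ?thesis using A(1) B(1) by (simp add: K_def)
    qed
    also have "\<dots> = (ennreal (sqrt K * D) * X) * (ennreal (sqrt K * D) * X)"
    proof -
      have "K * D\<^sup>2 = (sqrt K * D) * (sqrt K * D)" using K by (simp add: power2_eq_square)
      then have "ennreal (K * D\<^sup>2) = ennreal (sqrt K * D) * ennreal (sqrt K * D)"
        using K D by (simp add: ennreal_mult)
      then show ?thesis by (simp only: mult_ac)
    qed
    finally have "ennreal_sqrt (L2_sq (v t)) \<le> ennreal (sqrt K * D) * X"
      by (rule ennreal_sqrt_le)
    then have "plancherel_norm (v t) \<le> ennreal q * (ennreal (sqrt K * D) * X)"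
      unfolding plancherel_norm_def L2_norm_eq q_def by (intro mult_left_mono) auto
    also have "\<dots> = ennreal (q * sqrt K * D) * X"
      using q K D by (simp add: ennreal_mult mult.assoc)
    finally show ?thesis unfolding D_def X_def .
  qed
  moreover have "q * sqrt K > 0" using q K by simp
  ultimately show ?thesis by (intro exI[of _ "q * sqrt K"]) auto
qed

section \<open>Lower bound and divergence from nonzero mass\<close>

lemma low_frequency_lower_bound:
  fixes hg :: "'a::euclidean_space \<Rightarrow> complex"
  assumes hg: "hg \<in> L1" and g: "has_nabla s g hg" and m: "mass hg \<noteq> 0"
  shows "\<exists>\<delta>>0. AE \<xi> in lebesgue. norm \<xi> < \<delta> \<longrightarrow> norm \<xi> powr (- s) * (norm (mass hg) / 2) \<le> norm (g \<xi>)"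
proof -
  obtain \<delta> where \<delta>: "\<delta> > 0" "\<And>\<xi>. norm \<xi> < \<delta> \<Longrightarrow> norm (fourier hg \<xi>) \<ge> norm (mass hg) / 2"
    using fourier_lower_near_0[OF hg m] by blast
  have "AE \<xi> in lebesgue. complex_of_real (norm \<xi> powr s) * g \<xi> = fourier hg \<xi>"
    using g by (intro has_fourier_L1_AE[OF hg]) (simp add: has_nabla_def)
  then have "AE \<xi> in lebesgue. norm \<xi> < \<delta> \<longrightarrow> norm \<xi> powr (- s) * (norm (mass hg) / 2) \<le> norm (g \<xi>)"
    using AE_nonzero_lebesgue
  proof eventually_elim
    case (elim \<xi>)
    show ?case
    proof
      assume "norm \<xi> < \<delta>"
      then have "norm (mass hg) / 2 \<le> norm (complex_of_real (norm \<xi> powr s) * g \<xi>)"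
        unfolding elim(1) by (rule \<delta>(2))
      then have "norm \<xi> powr (- s) * (norm (mass hg) / 2) \<le> norm \<xi> powr (- s) * (norm \<xi> powr s * norm (g \<xi>))"
        by (intro mult_left_mono) (auto simp: norm_mult)
      also have "\<dots> = norm (g \<xi>)"
        using elim(2) by (simp add: mult.assoc[symmetric] powr_add[symmetric])
      finally show "norm \<xi> powr (- s) * (norm (mass hg) / 2) \<le> norm (g \<xi>)" .
    qed
  qed
  with \<delta>(1) show ?thesis by blast
qed

text \<open>Where \<open>|sin (r t)| >= 1/2\<close> and \<open>r\<close> is small, the wave part is
  at least \<open>P / 4 * r powr (-1 - s)\<close>. Integrable data have bounded transforms, so the
  error is at most the constant \<open>K\<close>, and half of the main term absorbs it. The
  surviving square has the radial exponent \<open>p\<close>.\<close>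

lemma plancherel_norm_mgt_solution_ge:
  fixes f0 f2 hg u0 u1 u2 :: "'a::euclidean_space \<Rightarrow> complex"
  assumes s: "s \<ge> 0" and \<tau>: "\<tau> > 0"
    and f0: "f0 \<in> L1" "has_fourier f0 u0" and f2: "f2 \<in> L1" "has_fourier f2 u2"
    and hg: "hg \<in> L1" "has_nabla s (\<lambda>\<xi>. u1 \<xi> + \<tau> *\<^sub>R u2 \<xi>) hg" "mass hg \<noteq> 0"
    and v: "mgt_solution \<tau> u0 u1 u2 v"
  shows "\<exists>c>0. \<exists>T>0. \<forall>t\<ge>T. plancherel_norm (v t) \<ge> ennreal (c * mgt_rate DIM('a) s t * norm (mass hg))"
proof -
  define P where "P = norm (mass hg)"
  have P: "P > 0" using hg(3) by (simp add: P_def)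
  define M0 where "M0 = enn2real (L1_norm f0)"
  define M2 where "M2 = enn2real (L1_norm f2)"
  have M: "M0 \<ge> 0" "M2 \<ge> 0" by (auto simp: M0_def M2_def)
  \<comment> \<open>The summand \<open>1\<close> keeps \<open>K\<close> positive, so that
    \<open>P / (8 * K)\<close> below is a genuine radius.\<close>
  define K where "K = 4 * M0 + 3 * \<tau>\<^sup>2 * M2 + 1"
  have K: "K > 0" using M by (simp add: K_def add_nonneg_pos)
  obtain \<delta> where \<delta>: "\<delta> > 0" and low: "AE \<xi> in lebesgue. norm \<xi> < \<delta> \<longrightarrow> norm \<xi> powr (- s) * (P / 2) \<le> norm (u1 \<xi> + \<tau> *\<^sub>R u2 \<xi>)"
    using low_frequency_lower_bound[OF hg] unfolding P_def by blast
  \<comment> \<open>Below \<open>\<delta>\<close> the transform of \<open>hg\<close> is bounded away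
    from zero, below \<open>1\<close> the power \<open>-1 - s\<close> dominates \<open>-1\<close>,
    and below \<open>P / (8 * K)\<close> the error \<open>K\<close> is at most
    \<open>P / 8 * r powr (-1)\<close>.\<close>
  define d where "d = min (min \<delta> 1) (P / (8 * K))"
  have d: "d > 0" "d \<le> \<delta>" "d \<le> 1" "d \<le> P / (8 * K)" using \<delta> P K by (auto simp: d_def)
  define p where "p = real DIM('a) - 3 - 2 * s"
  obtain c T where c: "c > 0" and T: "T > 0" and lo: "\<And>t. t \<ge> T \<Longrightarrow> ennreal (c * power_rate p t) \<le>
    (\<integral>\<^sup>+r. ennreal (r powr p) * indicator {r. 0 < r \<and> r < d \<and> \<bar>sin (r * t)\<bar> \<ge> 1/2} r \<partial>lborel)"
    using sin_ge_half_integral_lower[OF d(1)] by blast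
  define \<kappa> where "\<kappa> = DIM('a) * unit_ball_vol (real DIM('a))"
  have \<kappa>: "\<kappa> > 0" by (simp add: \<kappa>_def)
  define q where "q = (2 * pi) powr (- real DIM('a) / 2)"
  have q: "q > 0" by (simp add: q_def)
  have "ennreal (q * sqrt (\<kappa> * c) / 8 * mgt_rate DIM('a) s t * P) \<le> plancherel_norm (v t)" if t: "t \<ge> max T (exp 1)" for t
  proof -
    have te: "t \<ge> exp 1" and tT: "t \<ge> T" using t by auto
    have t0: "t \<ge> 0" using te by (meson exp_ge_zero order_trans)
    define D where "D = mgt_rate DIM('a) s t"
    have D: "D\<^sup>2 = power_rate p t" "D \<ge> 1" using mgt_rate_sq[OF te] by (auto simp: D_def p_def)
    let ?S = "{r. 0 < r \<and> r < d \<and> \<bar>sin (r * t)\<bar> \<ge> 1/2}"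
    let ?\<psi> = "\<lambda>r. ennreal ((P / 8)\<^sup>2) * indicator ?S r"
    let ?q = "- 2 - 2 * s"
    have "ennreal ((P / 8)\<^sup>2 * \<kappa> * (c * D\<^sup>2)) = ennreal \<kappa> * (ennreal ((P / 8)\<^sup>2) * ennreal (c * power_rate p t))"
    proof -
      have "power_rate p t \<ge> 0" using D(1) zero_le_power2[of D] by simp
      then show ?thesis using \<kappa> c D(1) by (simp add: ennreal_mult[symmetric] mult_ac)
    qed
    also have "\<dots> \<le> ennreal \<kappa> * (ennreal ((P / 8)\<^sup>2) * (\<integral>\<^sup>+r. ennreal (r powr p) * indicator ?S r \<partial>lborel))"
      by (intro mult_left_mono lo tT) auto
    also have "\<dots> = ennreal \<kappa> * (\<integral>\<^sup>+r. ennreal ((P / 8)\<^sup>2) * (ennreal (r powr p) * indicator ?S r) \<partial>lborel)"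
      by (subst nn_integral_cmult) auto
    also have "\<dots> = ennreal \<kappa> * (\<integral>\<^sup>+r. ennreal (r powr (?q + real DIM('a) - 1)) * ?\<psi> r * indicator {0<..} r \<partial>lborel)"
    proof (rule arg_cong[where f="\<lambda>x. ennreal \<kappa> * x"], rule nn_integral_cong)
      fix r :: real
      have "?q + real DIM('a) - 1 = p" by (simp add: p_def)
      then show "ennreal ((P / 8)\<^sup>2) * (ennreal (r powr p) * indicator ?S r) =
          ennreal (r powr (?q + real DIM('a) - 1)) * ?\<psi> r * indicator {0<..} r"
        by (simp add: indicator_def mult.commute)
    qed
    also have "\<dots> = (\<integral>\<^sup>+\<xi>. ennreal (norm (\<xi>::'a) powr ?q) * ?\<psi> (norm \<xi>) \<partial>lebesgue)"
      unfolding \<kappa>_def by (rule nn_integral_radial_powr[symmetric]) measurable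
    also have "\<dots> \<le> L2_sq (v t)"
      unfolding L2_sq_def
    proof (rule nn_integral_mono_AE)
      show "AE \<xi> in lebesgue. ennreal (norm (\<xi>::'a) powr ?q) * ?\<psi> (norm \<xi>) \<le> ennreal ((norm (v t \<xi>))\<^sup>2)"
        using mgt_solution_wave_part[OF v \<tau> t0] low has_fourier_L1_bound[OF f0] has_fourier_L1_bound[OF f2]
      proof eventually_elim
        case (elim \<xi>)
        define r where "r = norm \<xi>"
        let ?g = "u1 \<xi> + \<tau> *\<^sub>R u2 \<xi>"
        have e: "norm (v t \<xi> - (sin (r * t) / r) *\<^sub>R ?g) \<le> 4 * norm (u0 \<xi>) + 3 * \<tau>\<^sup>2 * norm (u2 \<xi>)"
          "r < \<delta> \<longrightarrow> r powr (- s) * (P / 2) \<le> norm ?g" "norm (u0 \<xi>) \<le> M0" "norm (u2 \<xi>) \<le> M2"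
          using elim by (auto simp: r_def M0_def M2_def)
        show ?case
        proof (cases "r \<in> ?S")
          case True
          then have r: "0 < r" "r < d" "\<bar>sin (r * t)\<bar> \<ge> 1/2" by auto
          have "r powr (-1 - s) * (P / 4) = (1/2 / r) * (r powr (- s) * (P / 2))"
          proof -
            have "r powr (-1 - s) = r powr (- s) / r"
              using r powr_diff[of r "- s" 1] by (simp add: minus_diff_commute)
            then show ?thesis by simp
          qed
          also have "\<dots> \<le> (\<bar>sin (r * t)\<bar> / r) * norm ?g"
            using r d e(2) P by (intro mult_mono divide_right_mono) auto
          also have "\<dots> = norm ((sin (r * t) / r) *\<^sub>R ?g)" using r by (simp add: abs_divide)
          also have "\<dots> \<le> norm (v t \<xi>) + norm (v t \<xi> - (sin (r * t) / r) *\<^sub>R ?g)"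
            by (subst norm_minus_commute) (rule norm_triangle_sub)
          also have "\<dots> \<le> norm (v t \<xi>) + K"
          proof -
            have "4 * norm (u0 \<xi>) + 3 * \<tau>\<^sup>2 * norm (u2 \<xi>) \<le> 4 * M0 + 3 * \<tau>\<^sup>2 * M2"
              using e(3,4) by (intro add_mono mult_left_mono) auto
            then show ?thesis using e(1) by (simp add: K_def)
          qed
          finally have 1: "r powr (-1 - s) * (P / 4) \<le> norm (v t \<xi>) + K" .
          have "K \<le> r powr (-1 - s) * (P / 8)"
          proof -
            have "r powr (-1) \<le> r powr (-1 - s)"
              using r d s by (intro powr_mono') auto
            then have "r powr (-1) * (P / 8) \<le> r powr (-1 - s) * (P / 8)"
              using P by (intro mult_right_mono) auto
            moreover have "r * (8 * K) \<le> P" using r(2) d(4) K by (simp add: pos_le_divide_eq[symmetric])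
            then have "K \<le> r powr (-1) * (P / 8)"
              using r(1) by (simp add: powr_minus_divide field_simps)
            ultimately show ?thesis by linarith
          qed
          with 1 have "r powr (-1 - s) * (P / 8) \<le> norm (v t \<xi>)" by simp
          then have "(r powr (-1 - s) * (P / 8))\<^sup>2 \<le> (norm (v t \<xi>))\<^sup>2"
            using P by (intro power_mono) auto
          moreover have "(r powr (-1 - s) * (P / 8))\<^sup>2 = r powr ?q * (P / 8)\<^sup>2"
          proof -
            have "r powr ?q = r powr (-1 - s) * r powr (-1 - s)" unfolding powr_add[symmetric] by simp
            then show ?thesis by (simp add: power2_eq_square mult_ac)
          qed
          ultimately have "ennreal (r powr ?q * (P / 8)\<^sup>2) \<le> ennreal ((norm (v t \<xi>))\<^sup>2)"
            by (intro ennreal_leI) simp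
          then show ?thesis using True by (simp add: r_def[symmetric] ennreal_mult)
        qed (simp add: r_def)
      qed
    qed
    finally have le: "ennreal ((P / 8)\<^sup>2 * \<kappa> * (c * D\<^sup>2)) \<le> L2_sq (v t)" .
    have sq: "(P / 8)\<^sup>2 * \<kappa> * (c * D\<^sup>2) = (sqrt (\<kappa> * c) / 8 * D * P) * (sqrt (\<kappa> * c) / 8 * D * P)"
      using \<kappa> c by (simp add: power2_eq_square field_simps)
    have "sqrt (\<kappa> * c) / 8 * D * P \<ge> 0" using \<kappa> c D P by simp
    with le[unfolded sq] have "ennreal (sqrt (\<kappa> * c) / 8 * D * P) \<le> ennreal_sqrt (L2_sq (v t))"
      by (rule ennreal_sqrt_ge)
    then have "ennreal q * ennreal (sqrt (\<kappa> * c) / 8 * D * P) \<le> plancherel_norm (v t)"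
      unfolding plancherel_norm_def L2_norm_eq q_def by (intro mult_left_mono) auto
    then show ?thesis using q \<kappa> c D P by (simp add: ennreal_mult[symmetric] D_def mult.assoc)
  qed
  moreover have "q * sqrt (\<kappa> * c) / 8 > 0" using q \<kappa> c by simp
  moreover have "max T (exp 1) > 0" using T by auto
  ultimately show ?thesis unfolding P_def by blast
qed

text \<open>The derivative \<open>cos x - 1/2\<close> of the difference is nonnegative up to
  \<open>pi / 3\<close>, which exceeds \<open>1\<close>.\<close>

lemma half_le_sin:
  fixes x :: real
  assumes "0 \<le> x" "x \<le> 1"
  shows "x / 2 \<le> sin x"
proof -
  have "sin 0 - 0 / 2 \<le> sin x - x / 2"
  proof (rule DERIV_nonneg_imp_nondecreasing[OF assms(1)])
    fix y :: real assume y: "0 \<le> y" "y \<le> x"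
    have "cos y \<ge> cos (pi / 3)"
      using y assms pi_gt3 by (intro cos_monotone_0_pi_le) auto
    then have "cos y - 1 / 2 \<ge> 0" by (simp add: cos_60)
    moreover have "((\<lambda>x. sin x - x / 2) has_real_derivative cos y - 1 / 2) (at y)"
      by (auto intro!: derivative_eq_intros)
    ultimately show "\<exists>z. ((\<lambda>x. sin x - x / 2) has_real_derivative z) (at y) \<and> 0 \<le> z" by blast
  qed
  then show ?thesis by simp
qed

text \<open>At a fixed time the sine no longer oscillates for \<open>r <= 1 / t\<close>: there
  \<open>sin (r t) / r >= t / 2\<close>, so the wave part is at least a multiple of
  \<open>r powr (- s)\<close>, which is not square integrable at the origin when
  \<open>n <= 2 s\<close>.\<close>

lemma plancherel_norm_mgt_solution_infinite:
  fixes f0 f2 hg u0 u1 u2 :: "'a::euclidean_space \<Rightarrow> complex"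
  assumes n: "real DIM('a) \<le> 2 * s" and \<tau>: "\<tau> > 0" and t: "t > 0"
    and f0: "f0 \<in> L2" "has_fourier f0 u0" and f2: "f2 \<in> L2" "has_fourier f2 u2"
    and hg: "hg \<in> L1" "has_nabla s (\<lambda>\<xi>. u1 \<xi> + \<tau> *\<^sub>R u2 \<xi>) hg" "mass hg \<noteq> 0"
    and v: "mgt_solution \<tau> u0 u1 u2 v"
  shows "plancherel_norm (v t) = \<infinity>"
proof -
  define P where "P = norm (mass hg)"
  have P: "P > 0" using hg(3) by (simp add: P_def)
  obtain \<delta> where \<delta>: "\<delta> > 0" and low: "AE \<xi> in lebesgue. norm \<xi> < \<delta> \<longrightarrow> norm \<xi> powr (- s) * (P / 2) \<le> norm (u1 \<xi> + \<tau> *\<^sub>R u2 \<xi>)"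
    using low_frequency_lower_bound[OF hg] unfolding P_def by blast
  define d where "d = min \<delta> (1 / t)"
  have d: "d > 0" "d \<le> \<delta>" "d \<le> 1 / t" using \<delta> t by (auto simp: d_def)
  have [measurable]: "u0 \<in> borel_measurable lebesgue" "u2 \<in> borel_measurable lebesgue"
    using f0(2) f2(2) by (auto simp: has_fourier_def)
  \<comment> \<open>Half the squared lower bound of the wave part, and a bound for the squared
    error. The inequality \<open>(a + b + c)^2 <= 2 a^2 + 4 (b^2 + c^2)\<close> turns the triangle
    inequality into \<open>?G - ?B <= (norm (v t \<xi>))\<^sup>2\<close>, where \<open>?G\<close>
    has infinite and \<open>?B\<close> finite integral.\<close>
  let ?G = "\<lambda>\<xi>::'a. (P * t / 4)\<^sup>2 / 2 * norm \<xi> powr (- 2 * s) * indicator {0<..<d} (norm \<xi>)"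
  let ?B = "\<lambda>\<xi>. 2 * (16 * (norm (u0 \<xi>))\<^sup>2 + 9 * \<tau> ^ 4 * (norm (u2 \<xi>))\<^sup>2)"
  have [measurable]: "?G \<in> borel_measurable lebesgue"
    by (rule borel_measurable_norm_lebesgue) measurable
  have Ginf: "(\<integral>\<^sup>+\<xi>. ennreal (?G \<xi>) \<partial>lebesgue) = \<infinity>"
  proof -
    let ?\<psi> = "\<lambda>r. ennreal ((P * t / 4)\<^sup>2 / 2) * indicator {0<..<d} r"
    have "(\<integral>\<^sup>+\<xi>. ennreal (?G \<xi>) \<partial>lebesgue) = (\<integral>\<^sup>+\<xi>. ennreal (norm (\<xi>::'a) powr (- 2 * s)) * ?\<psi> (norm \<xi>) \<partial>lebesgue)"
      by (intro nn_integral_cong) (auto simp: indicator_def ennreal_mult[symmetric] mult_ac)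
    also have "\<dots> = ennreal (DIM('a) * unit_ball_vol (real DIM('a))) *
       (\<integral>\<^sup>+r. ennreal (r powr (- 2 * s + real DIM('a) - 1)) * ?\<psi> r * indicator {0<..} r \<partial>lborel)"
      by (rule nn_integral_radial_powr) measurable
    also have "(\<integral>\<^sup>+r. ennreal (r powr (- 2 * s + real DIM('a) - 1)) * ?\<psi> r * indicator {0<..} r \<partial>lborel) =
       (\<integral>\<^sup>+r. ennreal ((P * t / 4)\<^sup>2 / 2) * (ennreal (r powr (- 2 * s + real DIM('a) - 1)) * indicator {0<..<d} r) \<partial>lborel)"
      by (intro nn_integral_cong) (auto simp: indicator_def mult_ac)
    also have "\<dots> = ennreal ((P * t / 4)\<^sup>2 / 2) * (\<integral>\<^sup>+r. ennreal (r powr (- 2 * s + real DIM('a) - 1)) * indicator {0<..<d} r \<partial>lborel)"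
      by (rule nn_integral_cmult) measurable
    also have "(\<integral>\<^sup>+r. ennreal (r powr (- 2 * s + real DIM('a) - 1)) * indicator {0<..<d} r \<partial>lborel) = \<infinity>"
      using n d by (intro nn_integral_powr_diverges) auto
    finally show ?thesis
      using P t unit_ball_vol_pos[of "real DIM('a)", THEN less_imp_neq] by (auto simp: ennreal_mult_top)
  qed
  have Bfin: "(\<integral>\<^sup>+\<xi>. ennreal (?B \<xi>) \<partial>lebesgue) < \<infinity>"
  proof -
    have fin: "L2_sq f0 < \<infinity>" "L2_sq f2 < \<infinity>" using f0(1) f2(1) by (auto simp: mem_L2_iff)
    have u: "L2_sq u0 < \<infinity>" "L2_sq u2 < \<infinity>"
      using has_fourier_L2_sq_le[OF f0] has_fourier_L2_sq_le[OF f2] fin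
      by (auto elim!: order.strict_trans1 simp: ennreal_mult_less_top)
    have "(\<integral>\<^sup>+\<xi>. ennreal (?B \<xi>) \<partial>lebesgue) = (\<integral>\<^sup>+\<xi>. ennreal 32 * ennreal ((norm (u0 \<xi>))\<^sup>2) + ennreal (18 * \<tau> ^ 4) * ennreal ((norm (u2 \<xi>))\<^sup>2) \<partial>lebesgue)"
    proof (rule nn_integral_cong)
      fix \<xi>
      have "?B \<xi> = 32 * (norm (u0 \<xi>))\<^sup>2 + (18 * \<tau> ^ 4) * (norm (u2 \<xi>))\<^sup>2" by simp
      then show "ennreal (?B \<xi>) = ennreal 32 * ennreal ((norm (u0 \<xi>))\<^sup>2) + ennreal (18 * \<tau> ^ 4) * ennreal ((norm (u2 \<xi>))\<^sup>2)"
        by (simp only: ennreal_mult' ennreal_plus zero_le_power2 zero_le_numeral zero_le_even_power even_numeral mult_nonneg_nonneg)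
    qed
    also have "\<dots> = ennreal 32 * L2_sq u0 + ennreal (18 * \<tau> ^ 4) * L2_sq u2"
      unfolding L2_sq_def by (subst nn_integral_add) (auto simp: nn_integral_cmult)
    also have "\<dots> < \<infinity>" using u by (auto simp: ennreal_mult_less_top)
    finally show ?thesis .
  qed
  text \<open>The solution itself need not be measurable, so its square is minorized by a measurable function.\<close>
  let ?F = "\<lambda>\<xi>. max (?G \<xi> - ?B \<xi>) 0"
  have "(\<integral>\<^sup>+\<xi>. ennreal (?G \<xi>) \<partial>lebesgue) \<le> (\<integral>\<^sup>+\<xi>. ennreal (?F \<xi>) + ennreal (?B \<xi>) \<partial>lebesgue)"
  proof (rule nn_integral_mono)
    fix \<xi>
    have *: "ennreal g \<le> ennreal (max (g - b) 0) + ennreal b" if "b \<ge> 0" for g b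
      using that ennreal_leI[of g "max (g - b) 0 + b"] by (simp add: ennreal_plus)
    show "ennreal (?G \<xi>) \<le> ennreal (?F \<xi>) + ennreal (?B \<xi>)" by (rule *) simp
  qed
  also have "\<dots> = (\<integral>\<^sup>+\<xi>. ennreal (?F \<xi>) \<partial>lebesgue) + (\<integral>\<^sup>+\<xi>. ennreal (?B \<xi>) \<partial>lebesgue)"
    by (rule nn_integral_add) measurable
  finally have Finf: "(\<integral>\<^sup>+\<xi>. ennreal (?F \<xi>) \<partial>lebesgue) = \<infinity>"
    using Ginf Bfin by (auto simp: top_unique)
  have "(\<integral>\<^sup>+\<xi>. ennreal (?F \<xi>) \<partial>lebesgue) \<le> L2_sq (v t)"
    unfolding L2_sq_def
  proof (rule nn_integral_mono_AE)
    have t0: "t \<ge> 0" using t by simp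
    show "AE \<xi> in lebesgue. ennreal (?F \<xi>) \<le> ennreal ((norm (v t \<xi>))\<^sup>2)"
      using mgt_solution_wave_part[OF v \<tau> t0] low
    proof eventually_elim
      case (elim \<xi>)
      define r where "r = norm \<xi>"
      let ?g = "u1 \<xi> + \<tau> *\<^sub>R u2 \<xi>"
      have e: "norm (v t \<xi> - (sin (r * t) / r) *\<^sub>R ?g) \<le> 4 * norm (u0 \<xi>) + 3 * \<tau>\<^sup>2 * norm (u2 \<xi>)"
        "r < \<delta> \<longrightarrow> r powr (- s) * (P / 2) \<le> norm ?g"
        using elim by (auto simp: r_def)
      have "?G \<xi> - ?B \<xi> \<le> (norm (v t \<xi>))\<^sup>2"
      proof (cases "0 < r \<and> r < d")
        case True
        then have r: "0 < r" "r < d" by auto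
        have rt: "0 \<le> r * t" "r * t \<le> 1"
        proof -
          have "r < 1 / t" using r d by linarith
          then show "0 \<le> r * t" "r * t \<le> 1" using r t by (auto simp: field_simps)
        qed
        have "(t / 2) * (r powr (- s) * (P / 2)) \<le> (sin (r * t) / r) * norm ?g"
        proof (rule mult_mono)
          show "t / 2 \<le> sin (r * t) / r" using half_le_sin[OF rt] r by (simp add: field_simps)
          then show "0 \<le> sin (r * t) / r" using t by linarith
          show "r powr (- s) * (P / 2) \<le> norm ?g" using e(2) r d by auto
        qed (use P in auto)
        also have "\<dots> \<le> norm ((sin (r * t) / r) *\<^sub>R ?g)"
          unfolding norm_scaleR by (intro mult_right_mono abs_ge_self norm_ge_zero)
        also have "\<dots> \<le> norm (v t \<xi>) + norm (v t \<xi> - (sin (r * t) / r) *\<^sub>R ?g)"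
          by (subst norm_minus_commute) (rule norm_triangle_sub)
        finally have 1: "(t / 2) * (r powr (- s) * (P / 2)) \<le> norm (v t \<xi>) + norm (v t \<xi> - (sin (r * t) / r) *\<^sub>R ?g)" .
        have "(t / 2) * (r powr (- s) * (P / 2)) = (P * t / 4) * r powr (- s)" by simp
        with 1 e(1) have "(P * t / 4) * r powr (- s) \<le> norm (v t \<xi>) + (4 * norm (u0 \<xi>) + 3 * \<tau>\<^sup>2 * norm (u2 \<xi>))"
          by linarith
        then have "((P * t / 4) * r powr (- s))\<^sup>2 \<le> (norm (v t \<xi>) + (4 * norm (u0 \<xi>) + 3 * \<tau>\<^sup>2 * norm (u2 \<xi>)))\<^sup>2"
          using P t by (intro power_mono) auto
        also have "\<dots> \<le> 2 * (norm (v t \<xi>))\<^sup>2 + 4 * ((4 * norm (u0 \<xi>))\<^sup>2 + (3 * \<tau>\<^sup>2 * norm (u2 \<xi>))\<^sup>2)"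
        proof -
          have "(a + (b + c))\<^sup>2 \<le> 2 * a\<^sup>2 + 4 * (b\<^sup>2 + c\<^sup>2)" for a b c :: real
            using zero_le_power2[of "a - (b + c)"] zero_le_power2[of "b - c"]
            by (simp add: power2_eq_square algebra_simps)
          then show ?thesis .
        qed
        also have "\<dots> = 2 * ((norm (v t \<xi>))\<^sup>2 + ?B \<xi>)"
          by (simp add: power_mult_distrib power_mult[symmetric])
        finally have "((P * t / 4) * r powr (- s))\<^sup>2 / 2 \<le> (norm (v t \<xi>))\<^sup>2 + ?B \<xi>" by simp
        moreover have "((P * t / 4) * r powr (- s))\<^sup>2 / 2 = ?G \<xi>"
        proof -
          have "r powr (- 2 * s) = r powr (- s) * r powr (- s)" unfolding powr_add[symmetric] by simp
          then show ?thesis using r by (simp add: r_def[symmetric] power2_eq_square mult_ac)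
        qed
        ultimately show ?thesis by simp
      next
        case False
        then have "?G \<xi> = 0" by (auto simp: r_def indicator_def)
        moreover have "?B \<xi> \<ge> 0" by simp
        ultimately show ?thesis using zero_le_power2[of "norm (v t \<xi>)"] by linarith
      qed
      then show ?case by (intro ennreal_leI) simp
    qed
  qed
  then have "L2_sq (v t) = \<infinity>" using Finf by (simp add: top_unique)
  then show ?thesis
    unfolding plancherel_norm_def L2_norm_eq ennreal_sqrt_def by (simp add: ennreal_mult_top)
qed

theorem mainTheorem7:
  fixes s \<tau> :: real
  assumes "s \<ge> 0" and "\<tau> > 0"
  shows
    "(real CARD('n::finite) > 2 * s \<longrightarrow>
      (\<exists>C>0. \<exists>T>0.
        \<forall>(f0 :: real^'n \<Rightarrow> complex) h1 h2 u0 u1 u2 v.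
          f0 \<in> L2 \<and> has_fourier f0 u0 \<and>
          h1 \<in> L2 \<inter> L1 \<and> has_nabla s u1 h1 \<and>
          h2 \<in> L2 \<inter> L1 \<and> has_nabla s u2 h2 \<and>
          mgt_solution \<tau> u0 u1 u2 v \<longrightarrow>
          (\<forall>t\<ge>T. plancherel_norm (v t) \<le>
             ennreal (C * mgt_rate CARD('n) s t) *
               (L2_norm f0 + L2_L1_norm h1 + L2_L1_norm h2)))) \<and>
     (real CARD('n) > 2 * s \<longrightarrow>
      (\<forall>(f0 :: real^'n \<Rightarrow> complex) f2 h1 h2 hg u0 u1 u2 v.
          f0 \<in> L2 \<inter> L1 \<and> has_fourier f0 u0 \<and>
          f2 \<in> L2 \<inter> L1 \<and> has_fourier f2 u2 \<and>
          h1 \<in> L2 \<inter> L1 \<and> has_nabla s u1 h1 \<and>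
          h2 \<in> L2 \<inter> L1 \<and> has_nabla s u2 h2 \<and>
          hg \<in> L11 \<and> has_nabla s (\<lambda>\<xi>. u1 \<xi> + \<tau> *\<^sub>R u2 \<xi>) hg \<and> mass hg \<noteq> 0 \<and>
          mgt_solution \<tau> u0 u1 u2 v \<longrightarrow>
          (\<exists>c>0. \<exists>T>0. \<forall>t\<ge>T.
             plancherel_norm (v t) \<ge> ennreal (c * mgt_rate CARD('n) s t * norm (mass hg))))) \<and>
     (real CARD('n) \<le> 2 * s \<longrightarrow>
      (\<forall>(f0 :: real^'n \<Rightarrow> complex) f2 hg u0 u1 u2 v.
          f0 \<in> L2 \<and> has_fourier f0 u0 \<and>
          f2 \<in> L2 \<and> has_fourier f2 u2 \<and>
          hg \<in> L11 \<and> has_nabla s (\<lambda>\<xi>. u1 \<xi> + \<tau> *\<^sub>R u2 \<xi>) hg \<and> mass hg \<noteq> 0 \<and>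
          mgt_solution \<tau> u0 u1 u2 v \<longrightarrow>
          (\<forall>t0>0. \<forall>t\<in>{0<..t0}. plancherel_norm (v t) = \<infinity>)))"
proof (intro conjI impI)
  assume n: "2 * s < real CARD('n)"
  then have n': "real DIM(real^'n) > 2 * s" by simp
  obtain C where "C > 0" and C: "\<forall>(f0 :: real^'n \<Rightarrow> complex) h1 h2 u0 u1 u2 v t.
    f0 \<in> L2 \<and> has_fourier f0 u0 \<and> h1 \<in> L2 \<inter> L1 \<and> has_nabla s u1 h1 \<and> h2 \<in> L2 \<inter> L1 \<and> has_nabla s u2 h2 \<and>
    mgt_solution \<tau> u0 u1 u2 v \<and> t \<ge> exp 1 \<longrightarrow>
    plancherel_norm (v t) \<le> ennreal (C * mgt_rate DIM(real^'n) s t) * (L2_norm f0 + L2_L1_norm h1 + L2_L1_norm h2)"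
    using plancherel_norm_mgt_solution_le[OF assms n'] by blast
  show "\<exists>C>0. \<exists>T>0. \<forall>(f0 :: real^'n \<Rightarrow> complex) h1 h2 u0 u1 u2 v.
          f0 \<in> L2 \<and> has_fourier f0 u0 \<and>
          h1 \<in> L2 \<inter> L1 \<and> has_nabla s u1 h1 \<and>
          h2 \<in> L2 \<inter> L1 \<and> has_nabla s u2 h2 \<and>
          mgt_solution \<tau> u0 u1 u2 v \<longrightarrow>
          (\<forall>t\<ge>T. plancherel_norm (v t) \<le>
             ennreal (C * mgt_rate CARD('n) s t) *
               (L2_norm f0 + L2_L1_norm h1 + L2_L1_norm h2))"
    \<comment> \<open>The threshold \<open>exp 1\<close> depends on nothing, and \<open>C\<close>
      was obtained before the data were introduced.\<close>
    using C \<open>C > 0\<close> by (intro exI[of _ C] exI[of _ "exp 1"] conjI) auto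
next
  show "\<forall>(f0 :: real^'n \<Rightarrow> complex) f2 h1 h2 hg u0 u1 u2 v.
          f0 \<in> L2 \<inter> L1 \<and> has_fourier f0 u0 \<and>
          f2 \<in> L2 \<inter> L1 \<and> has_fourier f2 u2 \<and>
          h1 \<in> L2 \<inter> L1 \<and> has_nabla s u1 h1 \<and>
          h2 \<in> L2 \<inter> L1 \<and> has_nabla s u2 h2 \<and>
          hg \<in> L11 \<and> has_nabla s (\<lambda>\<xi>. u1 \<xi> + \<tau> *\<^sub>R u2 \<xi>) hg \<and> mass hg \<noteq> 0 \<and>
          mgt_solution \<tau> u0 u1 u2 v \<longrightarrow>
          (\<exists>c>0. \<exists>T>0. \<forall>t\<ge>T.
             plancherel_norm (v t) \<ge> ennreal (c * mgt_rate CARD('n) s t * norm (mass hg)))"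
  proof (intro allI impI, elim conjE)
    fix f0 f2 h1 h2 hg u0 u1 u2 :: "real^'n \<Rightarrow> complex" and v
    assume "f0 \<in> L2 \<inter> L1" "has_fourier f0 u0" "f2 \<in> L2 \<inter> L1" "has_fourier f2 u2"
      "hg \<in> L11" "has_nabla s (\<lambda>\<xi>. u1 \<xi> + \<tau> *\<^sub>R u2 \<xi>) hg" "mass hg \<noteq> 0"
      "mgt_solution \<tau> u0 u1 u2 v"
    then show "\<exists>c>0. \<exists>T>0. \<forall>t\<ge>T.
        plancherel_norm (v t) \<ge> ennreal (c * mgt_rate CARD('n) s t * norm (mass hg))"
      using plancherel_norm_mgt_solution_ge[OF assms, of f0 u0 f2 u2 hg u1 v] by (simp add: L11_def)
  qed
next
  assume n: "real CARD('n) \<le> 2 * s"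
  show "\<forall>(f0 :: real^'n \<Rightarrow> complex) f2 hg u0 u1 u2 v.
          f0 \<in> L2 \<and> has_fourier f0 u0 \<and>
          f2 \<in> L2 \<and> has_fourier f2 u2 \<and>
          hg \<in> L11 \<and> has_nabla s (\<lambda>\<xi>. u1 \<xi> + \<tau> *\<^sub>R u2 \<xi>) hg \<and> mass hg \<noteq> 0 \<and>
          mgt_solution \<tau> u0 u1 u2 v \<longrightarrow>
          (\<forall>t0>0. \<forall>t\<in>{0<..t0}. plancherel_norm (v t) = \<infinity>)"
  proof (intro allI impI ballI, elim conjE)
    fix f0 f2 hg u0 u1 u2 :: "real^'n \<Rightarrow> complex" and v and t0 t :: real
    assume "f0 \<in> L2" "has_fourier f0 u0" "f2 \<in> L2" "has_fourier f2 u2"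
      "hg \<in> L11" "has_nabla s (\<lambda>\<xi>. u1 \<xi> + \<tau> *\<^sub>R u2 \<xi>) hg" "mass hg \<noteq> 0"
      "mgt_solution \<tau> u0 u1 u2 v" "t \<in> {0<..t0}"
    then show "plancherel_norm (v t) = \<infinity>"
      using n assms(2) by (intro plancherel_norm_mgt_solution_infinite[of s \<tau> t f0 u0 f2 u2 hg u1 v]) (auto simp: L11_def)
  qed
qed

end
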